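(* Let $X=\{X_n, n\ge 0\}$ be a centered stationary Gaussian sequence of random variables with unit variance, and set $\rho(k)=\mathbb{E}(X_0X_k)$ for $k\ge 0$ and $\rho(k)=\rho(-k)$ for $k<0$. Assume that $g\in L^2(\mathbb{R},\gamma)$ has Hermite rank $d\ge 2$ and satisfies $A(g)\in \mathbb{D}^{1,4}(\mathbb{R},\gamma)$. Suppose that $\sum_{j\in\mathbb{Z}}|\rho(j)|^d<\infty$. For $n\ge 1$ let $F_n=\frac{1}{\sqrt n}\sum_{i=1}^n g(X_i)$ and $Y_n=F_n/\sqrt{\mathrm{Var}(F_n)}$, and assume that $\sigma^2:=\sum_{q=d}^\infty q!\,c_q^2\sum_{k\in\mathbb{Z}}\rho(k)^q>0$, where $g=\sum_{q=d}^\infty c_qH_q$. Let $Z$ be a $N(0,1)$ random variable. Then there is a constant $C$, not depending on $n$, such that for all $n\ge 1$ with $\mathrm{Var}(F_n)>0$ the following estimates hold: (i) If $d=2$, then $$d_{\rm TV}(Y_n,Z)\le C n^{-\frac12}\Big(\sum_{|k|\le n}|\rho(k)|\Big)^{\frac12}+C n^{-\frac12}\Big(\sum_{|k|\le n}|\rho(k)|^{\frac43}\Big)^{\frac32}.$$ (ii) If $d\ge 3$, then $$d_{\rm TV}(Y_n,Z)\le C n^{-\frac12}\sum_{|k|\le n}|\rho(k)|^{d-1}\Big(\sum_{|k|\le n}|\rho(k)|^2\Big)^{\frac12}+C n^{-\frac12}\Big(\sum_{|k|\le n}|\rho(k)|^2\Big)^{\frac12}\Big(\sum_{|k|\le n}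|\rho(k)|\Big)^{\frac12}.$$
   Context: $\gamma$ is the standard Gaussian measure on $\mathbb{R}$. $H_q$ is the $q$-th Hermite polynomial: $H_0=1$ and $H_q(x)=(-1)^q e^{x^2/2}\frac{d^q}{dx^q}e^{-x^2/2}$ for $q\ge 1$. A function $g\in L^2(\mathbb{R},\gamma)$ has Hermite rank $d\ge1$ if its Hermite expansion (convergent in $L^2(\mathbb{R},\gamma)$) has the form $g=\sum_{q=d}^\infty c_qH_q$ with $c_d\ne 0$. For such $g$, $A(g)=\sum_{q=d}^\infty |c_q|H_q\in L^2(\mathbb{R},\gamma)$. For an integer $k\ge1$ and real $p\ge1$, $\mathbb{D}^{k,p}(\mathbb{R},\gamma)$ is the Sobolev space of functions that are $k$ times weakly differentiable and that, together with their derivatives up to order $k$, have finite moments of order $p$ with respect to $\gamma$. The total variation distance is $d_{\rm TV}(F,G)=\sup_{B\in\mathcal{B}(\mathbb{R})}|P(F\in B)-P(G\in B)|$. $C$ denotes a generic constant independent of $n$ (it may depend on $g$ and on the covariance function $\rho$, and may differ from one occurrence to another). *)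

theory Defs
  imports "HOL-Probability.Probability"
begin

definition hermite :: "nat \<Rightarrow> real \<Rightarrow> real" where
  "hermite q x = (-1) ^ q * exp (x\<^sup>2 / 2) * (deriv ^^ q) (\<lambda>t. exp (- (t\<^sup>2) / 2)) x"

text \<open>Elements of $L^2$ are represented by Borel functions.\<close>

definition L2_gauss :: "(real \<Rightarrow> real) set" where
  "L2_gauss = {g \<in> borel_measurable borel. integrable std_normal_distribution (\<lambda>x. (g x)\<^sup>2)}"

definition has_hermite_expansion :: "(real \<Rightarrow> real) \<Rightarrow> (nat \<Rightarrow> real) \<Rightarrow> bool" where
  "has_hermite_expansion g c \<longleftrightarrow>
     g \<in> L2_gauss \<and>
     (\<lambda>m. \<integral>x. (g x - (\<Sum>q\<le>m. c q * hermite q x))\<^sup>2 \<partial>std_normal_distribution)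
       \<longlonglongrightarrow> 0"

text \<open>The coefficient sequence \<open>c\<close> is determined by \<open>g\<close>; it is an argument of the
  next predicate only so that it can be referred to later.\<close>

definition has_hermite_rank :: "(real \<Rightarrow> real) \<Rightarrow> (nat \<Rightarrow> real) \<Rightarrow> nat \<Rightarrow> bool" where
  "has_hermite_rank g c d \<longleftrightarrow>
     has_hermite_expansion g c \<and> 1 \<le> d \<and> (\<forall>q<d. c q = 0) \<and> c d \<noteq> 0"

definition test_function :: "(real \<Rightarrow> real) \<Rightarrow> bool" where
  "test_function \<phi> \<longleftrightarrow>
     (\<forall>n x. (deriv ^^ n) \<phi> differentiable (at x)) \<and> compact (closure {x. \<phi> x \<noteq> 0})"

definition locally_integrable :: "(real \<Rightarrow> real) \<Rightarrow> bool" where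
  "locally_integrable f \<longleftrightarrow> (\<forall>a b. set_integrable lborel {a..b} f)"

definition weak_derivative :: "(real \<Rightarrow> real) \<Rightarrow> (real \<Rightarrow> real) \<Rightarrow> bool" where
  "weak_derivative f f' \<longleftrightarrow>
     locally_integrable f \<and> locally_integrable f' \<and>
     (\<forall>\<phi>. test_function \<phi> \<longrightarrow>
        (\<integral>x. f x * deriv \<phi> x \<partial>lborel) = - (\<integral>x. f' x * \<phi> x \<partial>lborel))"

text \<open>In the following definition \<open>D j\<close> is the weak derivative of order \<open>j\<close>.
  The space is meant for real \<open>p \<ge> 1\<close>.\<close>

definition gauss_sobolev :: "nat \<Rightarrow> real \<Rightarrow> (real \<Rightarrow> real) set" where
  "gauss_sobolev k p =
     {f. \<exists>D :: nat \<Rightarrow> real \<Rightarrow> real. D 0 = f \<and>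
           (\<forall>j<k. weak_derivative (D j) (D (Suc j))) \<and>
           (\<forall>j\<le>k. D j \<in> borel_measurable borel \<and>
                  integrable std_normal_distribution (\<lambda>x. \<bar>D j x\<bar> powr p))}"

text \<open>Almost surely constant variables count as (degenerate) Gaussian ones.\<close>

definition gaussian_rv :: "'a measure \<Rightarrow> ('a \<Rightarrow> real) \<Rightarrow> bool" where
  "gaussian_rv M Y \<longleftrightarrow> Y \<in> borel_measurable M \<and>
     ((\<exists>\<mu>. AE \<omega> in M. Y \<omega> = \<mu>) \<or>
      (\<exists>\<mu> \<sigma>. \<sigma> > 0 \<and> distributed M lborel Y (normal_density \<mu> \<sigma>)))"

definition gaussian_seq :: "'a measure \<Rightarrow> (nat \<Rightarrow> 'a \<Rightarrow> real) \<Rightarrow> bool" where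
  "gaussian_seq M X \<longleftrightarrow>
     (\<forall>n. X n \<in> borel_measurable M) \<and>
     (\<forall>I a. finite I \<longrightarrow> gaussian_rv M (\<lambda>\<omega>. \<Sum>i\<in>I. a i * X i \<omega>))"

definition stationary_seq :: "'a measure \<Rightarrow> (nat \<Rightarrow> 'a \<Rightarrow> real) \<Rightarrow> bool" where
  "stationary_seq M X \<longleftrightarrow>
     (\<forall>k. distr M (\<Pi>\<^sub>M i\<in>UNIV. borel) (\<lambda>\<omega> i. X (i + k) \<omega>) =
          distr M (\<Pi>\<^sub>M i\<in>UNIV. borel) (\<lambda>\<omega> i. X i \<omega>))"

definition autocov :: "'a measure \<Rightarrow> (nat \<Rightarrow> 'a \<Rightarrow> real) \<Rightarrow> int \<Rightarrow> real" where
  "autocov M X k = (\<integral>\<omega>. X 0 \<omega> * X (nat \<bar>k\<bar>) \<omega> \<partial>M)"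

text \<open>The two random variables may live on different probability spaces.\<close>

definition tv_dist ::
  "'a measure \<Rightarrow> ('a \<Rightarrow> real) \<Rightarrow> 'b measure \<Rightarrow> ('b \<Rightarrow> real) \<Rightarrow> real" where
  "tv_dist M F N G =
     (SUP B\<in>sets borel. \<bar>measure M {\<omega> \<in> space M. F \<omega> \<in> B} - measure N {\<omega> \<in> space N. G \<omega> \<in> B}\<bar>)"

definition partial_sum :: "(real \<Rightarrow> real) \<Rightarrow> (nat \<Rightarrow> 'a \<Rightarrow> real) \<Rightarrow> nat \<Rightarrow> 'a \<Rightarrow> real" where
  "partial_sum g X n \<omega> = 1 / sqrt (real n) * (\<Sum>i=1..n. g (X i \<omega>))"

definition normalized_sum ::
  "'a measure \<Rightarrow> (real \<Rightarrow> real) \<Rightarrow> (nat \<Rightarrow> 'a \<Rightarrow> real) \<Rightarrow> nat \<Rightarrow> 'a \<Rightarrow> real" where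
  "normalized_sum M g X n \<omega> =
     partial_sum g X n \<omega> / sqrt (prob_space.variance M (partial_sum g X n))"

definition limit_variance :: "(nat \<Rightarrow> real) \<Rightarrow> nat \<Rightarrow> (int \<Rightarrow> real) \<Rightarrow> real" where
  "limit_variance c d \<rho> =
     (\<Sum>\<^sub>\<infinity>q\<in>{d..}. fact q * (c q)\<^sup>2 * (\<Sum>\<^sub>\<infinity>k\<in>UNIV. \<rho> k ^ q))"

end

theory Submission
  imports Defs
begin

text \<open>
  For a finite Hermite sum \<open>p = \<Sum>\<^sub>q c\<^sub>q H\<^sub>q\<close> put \<open>p\<^sub>1 = \<Sum>\<^sub>q c\<^sub>q H\<^sub>q\<^sub>-\<^sub>1\<close> and
  \<open>Y = \<kappa> \<Sum>\<^sub>i p(X\<^sub>i)\<close>. Gaussian integration by parts gives \<open>E[Y f(Y)] = E[T f'(Y)]\<close> with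
  \<open>T = \<kappa>\<^sup>2 \<Sum>\<^sub>i\<^sub>j \<rho>(i-j) p\<^sub>1(X\<^sub>i) p'(X\<^sub>j)\<close>, so Stein's method bounds the total variation distance by a
  multiple of the standard deviation of \<open>T\<close>.

  The variance of \<open>T\<close> is a sum over quadruples of indices of \<open>\<rho>\<^sub>1\<^sub>2 \<rho>\<^sub>3\<^sub>4\<close> times the covariance of
  \<open>p\<^sub>1(X\<^sub>1) p'(X\<^sub>2)\<close> and \<open>p\<^sub>1(X\<^sub>3) p'(X\<^sub>4)\<close>. For Hermite polynomials in place of \<open>p\<^sub>1\<close> and \<open>p'\<close>, Wick's
  formula makes that covariance a positive combination of monomials in the six correlations, one
  for each multigraph on four vertices with prescribed degrees at least \<open>d - 1\<close> and an edge between
  \<open>{1,2}\<close> and \<open>{3,4}\<close>. Each such monomial times \<open>\<rho>\<^sub>1\<^sub>2 \<rho>\<^sub>3\<^sub>4\<close> is dominated by spanning tree monomials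
  with exponents \<open>d, 2, 1\<close> and, only if \<open>d = 2\<close>, by two 4-cycles. What remains after extracting
  them is the fourth moment of the derivative of the truncated \<open>A(g)\<close>; it is bounded uniformly
  because all Hermite coefficients involved are nonnegative.
\<close>

section \<open>Hermite polynomials and variables with all moments\<close>

text \<open>Total variation is not continuous under convergence in \<open>L\<^sup>2\<close>, so the
  truncation cannot be removed in that distance. It is removed for each Lipschitz test function with
  values in [0, 1]. The resulting bound does not involve the Lipschitz constant and therefore
  survives the approximation of indicators, of closed sets and, by inner regularity, of Borel sets.
  Integration by parts is reduced to one dimension: the residuals
  \<open>X\<^sub>j - cov i j * X\<^sub>i\<close>, over all j, are independent of
  \<open>X\<^sub>i\<close>, so for fixed residuals a function of the sequence is a function of one
  standard normal variable. The factors in front of the covariance raise all vertex degrees from d -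
  1 to d. Hence a vertex can be split off as a leaf with exponent d, and summing over it costs only
  a constant because the d-th powers of the covariances are summable. The remaining paths with
  exponents 1 and 2, and for d = 2 the cycles, give the rates. Positivity of the limit variance
  enters through the normalization: it keeps the variance of the partial sums away from 0.\<close>

lemma hermite_recursive_family:
  "\<exists>He :: nat \<Rightarrow> real \<Rightarrow> real. He 0 = (\<lambda>x. 1) \<and>
     (\<forall>q x. He (Suc q) x = x * He q x - real q * He (q - 1) x) \<and>
     (\<forall>q x. (He q has_real_derivative real q * He (q - 1) x) (at x))"
proof -
  \<comment> \<open>The pair holds the polynomials of degrees q and q - 1, as the three-term
    recursion needs both. At q = 0 the second entry is a dummy: it is only multiplied by
    \<open>real 0\<close>.\<close>
  define P :: "nat \<Rightarrow> (real \<Rightarrow> real) \<times> (real \<Rightarrow> real)"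
    where "P = rec_nat ((\<lambda>x. 1), (\<lambda>x. 0)) (\<lambda>q (a, b). ((\<lambda>x. x * a x - real q * b x), a))"
  define He where "He q = fst (P q)" for q
  have s: "snd (P (Suc q)) = He q" for q
    by (simp add: P_def He_def split: prod.splits)
  have s0: "real q * snd (P q) x = real q * He (q - 1) x" for q x
    by (cases q) (auto simp: s)
  have rec: "He (Suc q) x = x * He q x - real q * He (q - 1) x" for q x
  proof -
    have "He (Suc q) x = x * He q x - real q * snd (P q) x"
      by (simp add: P_def He_def split: prod.splits)
    then show ?thesis by (simp add: s0)
  qed
  have h0: "He 0 = (\<lambda>x. 1)" by (simp add: He_def P_def)
  have der: "\<forall>x. (He q has_real_derivative real q * He (q - 1) x) (at x)" for q
  proof (induction q rule: less_induct)
    case (less q)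
    show ?case
    proof (cases q)
      case 0 then show ?thesis by (simp add: h0)
    next
      case (Suc p)
      have e: "He q = (\<lambda>x. x * He p x - real p * He (p - 1) x)"
        using Suc rec by blast
      show ?thesis
      proof
        fix x
        have d1: "(He p has_real_derivative real p * He (p - 1) x) (at x)"
          using less[of p] Suc by blast
        have d2: "((\<lambda>x. real p * He (p - 1) x) has_real_derivative
            real p * (real (p - 1) * He (p - 1 - 1) x)) (at x)"
          by (rule DERIV_cmult) (use less[of "p - 1"] Suc in auto)
        have "((\<lambda>x. x * He p x - real p * He (p - 1) x) has_real_derivative
           (1 * He p x + real p * He (p - 1) x * x - real p * (real (p - 1) * He (p - 1 - 1) x))) (at x)"
          by (rule DERIV_diff[OF DERIV_mult[OF DERIV_ident d1] d2])
        moreover have "1 * He p x + real p * He (p - 1) x * x - real p * (real (p - 1) * He (p - 1 - 1) x)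
            = real q * He (q - 1) x"
        proof (cases p)
          case 0 then show ?thesis using Suc by simp
        next
          case (Suc r)
          have "He p x = x * He r x - real r * He (r - 1) x" using rec Suc by blast
          then have "real (Suc r) * (x * He r x - real r * He (r - 1) x) = real (Suc r) * He (Suc r) x"
            unfolding \<open>p = Suc r\<close> by simp
          then show ?thesis unfolding \<open>q = Suc p\<close> \<open>p = Suc r\<close> by (simp add: algebra_simps)
        qed
        ultimately show "(He q has_real_derivative real q * He (q - 1) x) (at x)" by (simp add: e)
      qed
    qed
  qed
  show ?thesis using h0 rec der by blast
qed

text \<open>Induction on q shows that the q-th derivative of \<open>exp (- (t\<^sup>2) / 2)\<close>
  is \<open>(-1) ^ q * He q t\<close> times that exponential, and the prefactor in
  \<open>hermite_def\<close> cancels both. The truncated index \<open>q - 1\<close> is harmless,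
  since its coefficient is 0 at q = 0.\<close>

lemma hermite_basics:
  shows hermite_0: "hermite 0 x = 1"
    and hermite_Suc: "hermite (Suc q) x = x * hermite q x - real q * hermite (q - 1) x"
    and hermite_has_derivative: "(hermite q has_real_derivative real q * hermite (q - 1) x) (at x)"
proof -
  obtain He :: "nat \<Rightarrow> real \<Rightarrow> real" where h0: "He 0 = (\<lambda>x. 1)"
    and rec: "\<And>q x. He (Suc q) x = x * He q x - real q * He (q - 1) x"
    and der: "\<And>q x. (He q has_real_derivative real q * He (q - 1) x) (at x)"
    using hermite_recursive_family by blast
  have it: "(deriv ^^ q) (\<lambda>t. exp (- (t\<^sup>2) / 2)) = (\<lambda>x. (-1) ^ q * He q x * exp (- (x\<^sup>2) / 2))" for q
  proof (induction q)
    case 0 show ?case by (simp add: h0)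
  next
    case (Suc q)
    have "(deriv ^^ Suc q) (\<lambda>t. exp (- (t\<^sup>2) / 2)) = deriv (\<lambda>x. (-1) ^ q * He q x * exp (- (x\<^sup>2) / 2))"
      by (simp only: Suc funpow.simps o_apply)
    also have "\<dots> = (\<lambda>x. (-1) ^ Suc q * He (Suc q) x * exp (- (x\<^sup>2) / 2))"
    proof
      fix x
      show "deriv (\<lambda>x. (-1) ^ q * He q x * exp (- (x\<^sup>2) / 2)) x = (-1) ^ Suc q * He (Suc q) x * exp (- (x\<^sup>2) / 2)"
        by (rule DERIV_imp_deriv)
           (auto intro!: derivative_eq_intros der simp: rec algebra_simps)
    qed
    finally show ?case .
  qed
  have eq: "hermite = He"
  proof (intro ext)
    fix q x
    have "hermite q x = ((-1) ^ q * (-1) ^ q) * (exp (x\<^sup>2 / 2) * exp (- (x\<^sup>2) / 2)) * He q x"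
      unfolding hermite_def it by (simp only: ac_simps)
    also have "(-1) ^ q * (-1) ^ q = (1::real)" by (simp flip: power_mult_distrib)
    also have "exp (x\<^sup>2 / 2) * exp (- (x\<^sup>2) / 2) = 1" by (simp add: mult_exp_exp)
    finally show "hermite q x = He q x" by simp
  qed
  show "hermite 0 x = 1" "hermite (Suc q) x = x * hermite q x - real q * hermite (q - 1) x"
    "(hermite q has_real_derivative real q * hermite (q - 1) x) (at x)"
    unfolding eq using h0 rec der by auto
qed

lemma continuous_on_hermite [continuous_intros]:
  assumes "continuous_on A f" shows "continuous_on A (\<lambda>x. hermite q (f x))"
proof -
  have "continuous_on UNIV (hermite q)"
    by (intro continuous_at_imp_continuous_on ballI DERIV_isCont[OF hermite_has_derivative])
  from continuous_on_compose2[OF this assms] show ?thesis by simp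
qed

lemma borel_measurable_hermite [measurable]: "hermite q \<in> borel_measurable borel"
  by (intro borel_measurable_continuous_onI continuous_on_hermite continuous_on_id)

section \<open>Random variables with moments of all orders\<close>

text \<open>A class closed under sums, products and Hermite polynomials, so that the integrability
  conditions of all manipulations with polynomials in the variables follow from its closure
  rules.\<close>

definition all_moments :: "'a measure \<Rightarrow> ('a \<Rightarrow> real) \<Rightarrow> bool" where
  "all_moments M W \<longleftrightarrow> W \<in> borel_measurable M \<and> (\<forall>k. integrable M (\<lambda>\<omega>. \<bar>W \<omega>\<bar> ^ k))"

lemma all_moments_measurable: "all_moments M W \<Longrightarrow> W \<in> borel_measurable M"
  by (simp add: all_moments_def)

lemma all_moments_integrable: "all_moments M W \<Longrightarrow> integrable M W"
  unfolding all_moments_def using integrable_abs_cancel[of M W] by (auto dest: spec[where x="1::nat"])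

lemma all_moments_bound:
  assumes "W \<in> borel_measurable M" "all_moments M V" "AE \<omega> in M. \<bar>W \<omega>\<bar> \<le> \<bar>V \<omega>\<bar>"
  shows "all_moments M W"
  unfolding all_moments_def
proof (intro conjI allI)
  show "W \<in> borel_measurable M" by fact
  fix k
  show "integrable M (\<lambda>\<omega>. \<bar>W \<omega>\<bar> ^ k)"
    by (rule Bochner_Integration.integrable_bound[where f="\<lambda>\<omega>. \<bar>V \<omega>\<bar> ^ k"])
       (use assms in \<open>auto simp: all_moments_def power_mono elim!: eventually_mono\<close>)
qed

lemma all_moments_mult:
  assumes "all_moments M V" "all_moments M W"
  shows "all_moments M (\<lambda>\<omega>. V \<omega> * W \<omega>)"
  unfolding all_moments_def
proof (intro conjI allI)
  note [measurable] = assms[THEN all_moments_measurable]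
  show "(\<lambda>\<omega>. V \<omega> * W \<omega>) \<in> borel_measurable M" by measurable
  fix k
  have le: "\<bar>V \<omega> * W \<omega>\<bar> ^ k \<le> \<bar>V \<omega>\<bar> ^ (2*k) + \<bar>W \<omega>\<bar> ^ (2*k)" for \<omega>
  proof -
    have "2 * (\<bar>V \<omega>\<bar> ^ k * \<bar>W \<omega>\<bar> ^ k) \<le> (\<bar>V \<omega>\<bar> ^ k)\<^sup>2 + (\<bar>W \<omega>\<bar> ^ k)\<^sup>2"
      using sum_squares_bound[of "\<bar>V \<omega>\<bar> ^ k" "\<bar>W \<omega>\<bar> ^ k"] by simp
    moreover have "0 \<le> \<bar>V \<omega>\<bar> ^ k * \<bar>W \<omega>\<bar> ^ k" by simp
    ultimately have "\<bar>V \<omega>\<bar> ^ k * \<bar>W \<omega>\<bar> ^ k \<le> (\<bar>V \<omega>\<bar> ^ k)\<^sup>2 + (\<bar>W \<omega>\<bar> ^ k)\<^sup>2"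
      by linarith
    then show ?thesis
      by (simp only: abs_mult power_mult_distrib power_even_eq)
  qed
  show "integrable M (\<lambda>\<omega>. \<bar>V \<omega> * W \<omega>\<bar> ^ k)"
    by (rule Bochner_Integration.integrable_bound[where f="\<lambda>\<omega>. \<bar>V \<omega>\<bar> ^ (2*k) + \<bar>W \<omega>\<bar> ^ (2*k)"])
       (use assms le in \<open>auto simp: all_moments_def intro!: AE_I2\<close>)
qed

lemma all_moments_add:
  assumes "all_moments M V" "all_moments M W"
  shows "all_moments M (\<lambda>\<omega>. V \<omega> + W \<omega>)"
  unfolding all_moments_def
proof (intro conjI allI)
  note [measurable] = assms[THEN all_moments_measurable]
  show "(\<lambda>\<omega>. V \<omega> + W \<omega>) \<in> borel_measurable M" by measurable
  fix k
  have le: "\<bar>V \<omega> + W \<omega>\<bar> ^ k \<le> 2 ^ k * (\<bar>V \<omega>\<bar> ^ k + \<bar>W \<omega>\<bar> ^ k)" for \<omega>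
  proof -
    have "\<bar>V \<omega> + W \<omega>\<bar> ^ k \<le> (2 * max \<bar>V \<omega>\<bar> \<bar>W \<omega>\<bar>) ^ k"
      by (intro power_mono) auto
    also have "\<dots> = 2 ^ k * (max \<bar>V \<omega>\<bar> \<bar>W \<omega>\<bar>) ^ k" by (simp add: power_mult_distrib)
    also have "\<dots> \<le> 2 ^ k * (\<bar>V \<omega>\<bar> ^ k + \<bar>W \<omega>\<bar> ^ k)"
      by (intro mult_left_mono) (auto simp: max_def)
    finally show ?thesis .
  qed
  show "integrable M (\<lambda>\<omega>. \<bar>V \<omega> + W \<omega>\<bar> ^ k)"
    by (rule Bochner_Integration.integrable_bound[where f="\<lambda>\<omega>. 2 ^ k * (\<bar>V \<omega>\<bar> ^ k + \<bar>W \<omega>\<bar> ^ k)"])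
       (use assms le in \<open>auto simp: all_moments_def intro!: AE_I2\<close>)
qed

lemma (in finite_measure) all_moments_const: "all_moments M (\<lambda>_. c)"
  by (auto simp: all_moments_def)

lemma (in finite_measure) all_moments_sum:
  assumes "\<And>i. i \<in> I \<Longrightarrow> all_moments M (W i)"
  shows "all_moments M (\<lambda>\<omega>. \<Sum>i\<in>I. W i \<omega>)"
  using assms
  by (induction I rule: infinite_finite_induct) (simp_all add: all_moments_const all_moments_add)

lemma (in finite_measure) all_moments_cmult:
  "all_moments M W \<Longrightarrow> all_moments M (\<lambda>\<omega>. c * W \<omega>)"
  by (intro all_moments_mult all_moments_const)

lemma (in finite_measure) all_moments_power:
  "all_moments M W \<Longrightarrow> all_moments M (\<lambda>\<omega>. W \<omega> ^ k)"
  by (induction k) (simp_all add: all_moments_const all_moments_mult)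

lemma (in finite_measure) all_moments_diff:
  assumes "all_moments M V" "all_moments M W"
  shows "all_moments M (\<lambda>\<omega>. V \<omega> - W \<omega>)"
  using all_moments_add[OF assms(1) all_moments_cmult[OF assms(2), of "-1"]] by simp

lemma (in finite_measure) all_moments_hermite:
  assumes "all_moments M W" shows "all_moments M (\<lambda>\<omega>. hermite q (W \<omega>))"
proof (induction q rule: less_induct)
  case (less q)
  show ?case
  proof (cases q)
    case 0 then show ?thesis by (simp add: hermite_0 all_moments_const)
  next
    case (Suc p)
    have "all_moments M (\<lambda>\<omega>. W \<omega> * hermite p (W \<omega>) - real p * hermite (p - 1) (W \<omega>))"
      by (intro all_moments_diff all_moments_mult all_moments_cmult less assms) (use Suc in auto)
    then show ?thesis using Suc by (simp add: hermite_Suc)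
  qed
qed

section \<open>Uniqueness of joint laws\<close>

interpretation gamma: real_distribution std_normal_distribution
  by (rule real_dist_normal_dist)

text \<open>The real form of the characteristic function of \<gamma>. The free phase \<theta> turns
  the cosine into a sine at \<theta> = - pi / 2, so statements about cosines alone replace those
  about complex exponentials.\<close>

lemma gamma_cos: "(\<integral>x. cos (\<theta> + t * x) \<partial>std_normal_distribution) = cos \<theta> * exp (- t\<^sup>2 / 2)"
proof -
  let ?\<gamma> = "std_normal_distribution"
  have ii: "integrable ?\<gamma> (\<lambda>x. iexp (t * x))"
    by (rule gamma.integrable_const_bound[where B=1]) (auto intro!: AE_I2)
  have ch: "(CLINT x|?\<gamma>. iexp (t * x)) = complex_of_real (exp (- (t\<^sup>2) / 2))"
    using fun_cong[OF char_std_normal_distribution, of t] by (simp add: char_def)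
  have c: "(\<integral>x. cos (t * x) \<partial>?\<gamma>) = exp (- (t\<^sup>2) / 2)"
    using integral_Re[OF ii] ch by (simp add: Re_exp)
  have s: "(\<integral>x. sin (t * x) \<partial>?\<gamma>) = 0"
    using integral_Im[OF ii] ch by (simp add: Im_exp)
  have i1: "integrable ?\<gamma> (\<lambda>x. cos (t * x))" "integrable ?\<gamma> (\<lambda>x. sin (t * x))"
    by (rule gamma.integrable_const_bound[where B=1]; auto intro!: AE_I2)+
  have "(\<integral>x. cos (\<theta> + t * x) \<partial>?\<gamma>) = (\<integral>x. cos \<theta> * cos (t * x) - sin \<theta> * sin (t * x) \<partial>?\<gamma>)"
    by (simp add: cos_add)
  also have "\<dots> = cos \<theta> * exp (- (t\<^sup>2) / 2)"
    using i1 by (simp add: c s)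
  finally show ?thesis by simp
qed

lemma sin_eq_cos_phase: "sin x = cos (- pi / 2 + x)" for x :: real
  by (simp add: cos_diff)

lemma cos_cos_phase:
  fixes u v w :: real
  shows "w * cos u * cos v = (1/2) * (w * cos (u + v)) + (1/2) * (w * cos (u + - v))"
  by (simp only: cos_add cos_minus sin_minus) (simp add: algebra_simps)

lemma cos_sin_phase:
  fixes u v w :: real
  shows "w * cos u * sin v = (1/2) * (w * sin (u + v)) - (1/2) * (w * sin (u + - v))"
  by (simp only: sin_add cos_minus sin_minus) (simp add: algebra_simps)

text \<open>Uniqueness of characteristic functions is applied to the probability densities \<open>1 + V\<close> and \<open>1\<close>.\<close>

lemma (in prob_space) weighted_uniqueness:
  fixes V Y :: "'a \<Rightarrow> real"
  assumes V[measurable]: "V \<in> borel_measurable M" and V1: "\<And>\<omega>. \<bar>V \<omega>\<bar> \<le> 1"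
    and Y[measurable]: "Y \<in> borel_measurable M"
    and c: "\<And>t. expectation (\<lambda>\<omega>. V \<omega> * cos (t * Y \<omega>)) = 0"
    and s: "\<And>t. expectation (\<lambda>\<omega>. V \<omega> * sin (t * Y \<omega>)) = 0"
    and B[measurable]: "B \<in> sets borel"
  shows "expectation (\<lambda>\<omega>. V \<omega> * indicator B (Y \<omega>)) = 0"
proof -
  define P where "P = density M (\<lambda>\<omega>. ennreal (1 + V \<omega>))"
  have sP [measurable_cong, simp]: "sets P = sets M" by (simp add: P_def)
  have sp [simp]: "space P = space M" by (simp add: P_def)
  have pos: "0 \<le> 1 + V \<omega>" for \<omega> using V1[of \<omega>] by linarith
  have intV: "integrable M V"
    by (rule integrable_const_bound[where B=1]) (auto intro!: AE_I2 V1)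
  \<comment> \<open>At t = 0 the cosine hypothesis says that \<open>V\<close> has mean zero; hence
    \<open>1 + V\<close> is a probability density.\<close>
  have EV: "expectation V = 0" using c[of 0] by simp
  have "emeasure P (space P) = (\<integral>\<^sup>+\<omega>. ennreal (1 + V \<omega>) \<partial>M)"
    unfolding P_def
    by (subst emeasure_density) (auto intro!: nn_integral_cong)
  also have "\<dots> = ennreal (expectation (\<lambda>\<omega>. 1 + V \<omega>))"
    by (rule nn_integral_eq_integral) (auto intro!: AE_I2 pos Bochner_Integration.integrable_add intV)
  also have "\<dots> = 1" using intV EV by (simp add: prob_space)
  finally interpret P: prob_space P by (rule prob_spaceI)
  have bdd: "integrable M (\<lambda>\<omega>. V \<omega> * f \<omega>)" if "f \<in> borel_measurable M" "\<And>\<omega>. \<bar>f \<omega>\<bar> \<le> 1" for f :: "'a \<Rightarrow> real"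
    by (rule integrable_const_bound[where B=1])
       (use that V1 in \<open>auto intro!: AE_I2 mult_le_one simp: abs_mult\<close>)
  have eq: "distr P borel Y = distr M borel Y"
  proof (rule Levy_uniqueness)
    show "real_distribution (distr P borel Y)" by (rule P.real_distribution_distr) simp
    show "real_distribution (distr M borel Y)" by (rule real_distribution_distr) simp
    show "char (distr P borel Y) = char (distr M borel Y)"
    proof
      fix t
      have i1: "integrable M (\<lambda>\<omega>. iexp (t * Y \<omega>))"
        by (rule integrable_const_bound[where B=1]) (auto intro!: AE_I2)
      have i2: "integrable M (\<lambda>\<omega>. complex_of_real (V \<omega> * cos (t * Y \<omega>)))"
        "integrable M (\<lambda>\<omega>. complex_of_real (V \<omega> * sin (t * Y \<omega>)))"
        by (intro integrable_of_real bdd; auto)+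
      have "char (distr P borel Y) t = (CLINT \<omega>|P. iexp (t * Y \<omega>))"
        unfolding char_def by (subst integral_distr) auto
      also have "\<dots> = (CLINT \<omega>|M. (1 + V \<omega>) *\<^sub>R iexp (t * Y \<omega>))"
        unfolding P_def by (rule integral_density) (auto intro!: AE_I2 pos)
      also have "\<dots> = (CLINT \<omega>|M. iexp (t * Y \<omega>) + (complex_of_real (V \<omega> * cos (t * Y \<omega>)) +
          \<i> * complex_of_real (V \<omega> * sin (t * Y \<omega>))))"
        by (intro Bochner_Integration.integral_cong refl)
           (simp add: complex_eq_iff Re_exp Im_exp algebra_simps)
      also have "\<dots> = (CLINT \<omega>|M. iexp (t * Y \<omega>)) + ((CLINT \<omega>|M. complex_of_real (V \<omega> * cos (t * Y \<omega>)))
          + (CLINT \<omega>|M. \<i> * complex_of_real (V \<omega> * sin (t * Y \<omega>))))"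
        by (subst Bochner_Integration.integral_add, rule i1)
           (intro Bochner_Integration.integrable_add i2 integrable_mult_right,
            subst Bochner_Integration.integral_add, auto intro!: i2 integrable_mult_right simp del: of_real_mult)
      also have "\<dots> = (CLINT \<omega>|M. iexp (t * Y \<omega>))"
        using c[of t] s[of t] by (simp del: of_real_mult)
      also have "\<dots> = char (distr M borel Y) t"
        unfolding char_def by (subst integral_distr) auto
      finally show "char (distr P borel Y) t = char (distr M borel Y) t" .
    qed
  qed
  have i3: "integrable M (\<lambda>\<omega>. indicat_real B (Y \<omega>))"
    by (rule integrable_const_bound[where B=1]) (auto intro!: AE_I2 simp: indicator_def)
  have i4: "integrable M (\<lambda>\<omega>. V \<omega> * indicat_real B (Y \<omega>))"
    by (rule bdd) (auto simp: indicator_def)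
  have "(\<integral>\<omega>. indicat_real B (Y \<omega>) \<partial>P) = (\<integral>\<omega>. (1 + V \<omega>) *\<^sub>R indicat_real B (Y \<omega>) \<partial>M)"
    unfolding P_def by (rule integral_density) (auto intro!: AE_I2 pos)
  also have "\<dots> = (\<integral>\<omega>. indicat_real B (Y \<omega>) \<partial>M) + expectation (\<lambda>\<omega>. V \<omega> * indicat_real B (Y \<omega>))"
    using i3 i4 by (simp add: algebra_simps)
  finally have e: "(\<integral>\<omega>. indicat_real B (Y \<omega>) \<partial>P) =
    (\<integral>\<omega>. indicat_real B (Y \<omega>) \<partial>M) + expectation (\<lambda>\<omega>. V \<omega> * indicat_real B (Y \<omega>))" .
  have "(\<integral>\<omega>. indicat_real B (Y \<omega>) \<partial>P) = (\<integral>x. indicat_real B x \<partial>distr P borel Y)"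
    by (rule integral_distr[symmetric]) auto
  also have "\<dots> = (\<integral>\<omega>. indicat_real B (Y \<omega>) \<partial>M)"
    unfolding eq by (rule integral_distr) auto
  finally show ?thesis using e by simp
qed

text \<open>Trades one Fourier variable for an indicator. By the product formulas the weight
  \<open>W * cos (\<theta> + A)\<close> has vanishing cosine and sine transforms against
  \<open>Y\<close>, so \<open>weighted_uniqueness\<close> applies; the phase \<open>A\<close> stays
  available for the remaining coordinates.\<close>

lemma (in prob_space) phase_uniqueness:
  fixes W A Y :: "'a \<Rightarrow> real"
  assumes [measurable]: "W \<in> borel_measurable M" "A \<in> borel_measurable M" "Y \<in> borel_measurable M" "B \<in> sets borel"
    and W1: "\<And>\<omega>. \<bar>W \<omega>\<bar> \<le> 1"
    and z: "\<And>t \<theta>. expectation (\<lambda>\<omega>. W \<omega> * cos (\<theta> + A \<omega> + t * Y \<omega>)) = 0"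
  shows "expectation (\<lambda>\<omega>. W \<omega> * indicator B (Y \<omega>) * cos (\<theta> + A \<omega>)) = 0"
proof -
  have bdd: "integrable M (\<lambda>\<omega>. W \<omega> * f \<omega>)" if "f \<in> borel_measurable M" "\<And>\<omega>. \<bar>f \<omega>\<bar> \<le> 1" for f :: "'a \<Rightarrow> real"
    by (rule integrable_const_bound[where B=1])
       (use that W1 in \<open>auto intro!: AE_I2 mult_le_one simp: abs_mult\<close>)
  have "expectation (\<lambda>\<omega>. (W \<omega> * cos (\<theta> + A \<omega>)) * indicator B (Y \<omega>)) = 0"
  proof (rule weighted_uniqueness)
    show "\<bar>W \<omega> * cos (\<theta> + A \<omega>)\<bar> \<le> 1" for \<omega>
      using mult_mono[OF W1[of \<omega>] abs_cos_le_one[of "\<theta> + A \<omega>"]] by (simp add: abs_mult)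
    fix t
    have "expectation (\<lambda>\<omega>. W \<omega> * cos (\<theta> + A \<omega>) * cos (t * Y \<omega>)) =
        expectation (\<lambda>\<omega>. (1/2) * (W \<omega> * cos (\<theta> + A \<omega> + t * Y \<omega>)) + (1/2) * (W \<omega> * cos (\<theta> + A \<omega> + (-t) * Y \<omega>)))"
      unfolding mult_minus_left by (intro Bochner_Integration.integral_cong refl cos_cos_phase)
    also have "\<dots> = 0"
      by (subst Bochner_Integration.integral_add; (intro integrable_mult_right bdd)?; (simp add: z)?)
         (use z[of \<theta> "-t"] in simp)
    finally show "expectation (\<lambda>\<omega>. W \<omega> * cos (\<theta> + A \<omega>) * cos (t * Y \<omega>)) = 0" .
    \<comment> \<open>Shifting \<theta> by - pi / 2 expresses the sine transform through the cosines
      of the hypothesis.\<close>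
    have "expectation (\<lambda>\<omega>. W \<omega> * cos (\<theta> + A \<omega>) * sin (t * Y \<omega>)) =
        expectation (\<lambda>\<omega>. (1/2) * (W \<omega> * cos ((- pi / 2 + \<theta>) + A \<omega> + t * Y \<omega>)) + (-1/2) * (W \<omega> * cos ((- pi / 2+\<theta>) + A \<omega> + (-t) * Y \<omega>)))"
    proof (intro Bochner_Integration.integral_cong refl)
      fix \<omega>
      have e: "cos ((- pi / 2 + \<theta>) + A \<omega> + t * Y \<omega>) = sin (\<theta> + A \<omega> + t * Y \<omega>)"
        "cos ((- pi / 2 + \<theta>) + A \<omega> + (-t) * Y \<omega>) = sin (\<theta> + A \<omega> + - (t * Y \<omega>))"
        unfolding sin_eq_cos_phase by (simp_all add: algebra_simps)
      show "W \<omega> * cos (\<theta> + A \<omega>) * sin (t * Y \<omega>) =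
        (1/2) * (W \<omega> * cos ((- pi / 2 + \<theta>) + A \<omega> + t * Y \<omega>)) + (-1/2) * (W \<omega> * cos ((- pi / 2+\<theta>) + A \<omega> + (-t) * Y \<omega>))"
        unfolding e using cos_sin_phase[of "W \<omega>" "\<theta> + A \<omega>" "t * Y \<omega>"] by simp
    qed
    also have "\<dots> = 0"
      by (subst Bochner_Integration.integral_add; (intro integrable_mult_right bdd)?; (simp add: z)?)
         (use z[of "- pi / 2+\<theta>" "-t"] z[of "- pi / 2+\<theta>" "t"] in simp)
    finally show "expectation (\<lambda>\<omega>. W \<omega> * cos (\<theta> + A \<omega>) * sin (t * Y \<omega>)) = 0" .
  qed auto
  then show ?thesis by (simp add: mult_ac)
qed

text \<open>Uniqueness of Fourier transforms in finitely many variables, one coordinate at a time: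
  each induction step turns the exponential in one coordinate into an indicator, which is absorbed
  into the weight \<open>W\<close> and keeps it bounded by 1.\<close>

lemma (in prob_space) cylinder_uniqueness:
  fixes R :: "nat \<Rightarrow> 'a \<Rightarrow> real"
  assumes "finite J" and R[measurable]: "\<And>j. R j \<in> borel_measurable M"
    and B: "\<And>j. B j \<in> sets borel"
    and W[measurable]: "W \<in> borel_measurable M" and W1: "\<And>\<omega>. \<bar>W \<omega>\<bar> \<le> 1"
    and z: "\<And>t \<theta>. expectation (\<lambda>\<omega>. W \<omega> * cos (\<theta> + (\<Sum>j\<in>J. t j * R j \<omega>))) = 0"
  shows "expectation (\<lambda>\<omega>. W \<omega> * (\<Prod>j\<in>J. indicator (B j) (R j \<omega>))) = 0"
  using \<open>finite J\<close> W W1 z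
proof (induction J arbitrary: W)
  case empty
  from empty(3)[of 0 "\<lambda>_. 0"] show ?case by simp
next
  case (insert k J)
  note [measurable] = insert.prems(1) B[of k]
  have e: "expectation (\<lambda>\<omega>. W \<omega> * indicator (B k) (R k \<omega>) * (\<Prod>j\<in>J. indicator (B j) (R j \<omega>))) = 0"
  proof (rule insert.IH)
    show "(\<lambda>\<omega>. W \<omega> * indicator (B k) (R k \<omega>)) \<in> borel_measurable M" by measurable
    show "\<bar>W \<omega> * indicator (B k) (R k \<omega>)\<bar> \<le> 1" for \<omega>
      using insert.prems(2)[of \<omega>] by (auto simp: indicator_def)
    fix t \<theta>
    show "expectation (\<lambda>\<omega>. W \<omega> * indicator (B k) (R k \<omega>) * cos (\<theta> + (\<Sum>j\<in>J. t j * R j \<omega>))) = 0"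
    proof (rule phase_uniqueness)
      fix s \<theta>'
      have "(\<Sum>j\<in>insert k J. (t(k := s)) j * R j \<omega>) = s * R k \<omega> + (\<Sum>j\<in>J. t j * R j \<omega>)" for \<omega>
        using insert.hyps by (auto intro!: sum.cong)
      then show "expectation (\<lambda>\<omega>. W \<omega> * cos (\<theta>' + (\<Sum>j\<in>J. t j * R j \<omega>) + s * R k \<omega>)) = 0"
        using insert.prems(3)[of \<theta>' "t(k := s)"] by (simp add: ac_simps)
    qed (use insert.prems(2) in auto)
  qed
  then show ?case using insert.hyps by (simp add: mult_ac)
qed

section \<open>Gaussian families\<close>

text \<open>Two instances are used: the given sequence, and the constant family of the identity
  under \<gamma>, for which all covariances are 1 and joint moments become moments of one normal
  variable.\<close>

locale gaussian_family = prob_space +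
  fixes X :: "nat \<Rightarrow> 'a \<Rightarrow> real"
  assumes gaussian: "gaussian_seq M X"
    and mean_zero: "expectation (X n) = 0"
    and unit_variance: "variance (X n) = 1"
begin

definition cov :: "nat \<Rightarrow> nat \<Rightarrow> real" where
  "cov i j = expectation (\<lambda>\<omega>. X i \<omega> * X j \<omega>)"

lemma X_measurable [measurable]: "X n \<in> borel_measurable M"
  using gaussian by (simp add: gaussian_seq_def)

text \<open>Unit variance excludes the degenerate alternative of \<open>gaussian_rv\<close> and,
  together with mean zero, fixes both parameters of the normal density.\<close>

lemma X_distributed: "distributed M lborel (X n) std_normal_density"
proof -
  have "gaussian_rv M (\<lambda>\<omega>. \<Sum>i\<in>{n}. 1 * X i \<omega>)"
    using gaussian unfolding gaussian_seq_def by (elim conjE allE[of _ "{n}"] allE[of _ "\<lambda>_. 1"]) auto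
  then have "gaussian_rv M (X n)" by simp
  then consider \<mu> where "AE \<omega> in M. X n \<omega> = \<mu>"
    | \<mu> \<sigma> where "\<sigma> > 0" "distributed M lborel (X n) (normal_density \<mu> \<sigma>)"
    unfolding gaussian_rv_def by blast
  then show ?thesis
  proof cases
    case 1
    have "expectation (X n) = expectation (\<lambda>_. \<mu>)" using 1 by (intro integral_cong_AE) auto
    then have m: "\<mu> = 0" using mean_zero by (simp add: prob_space)
    have "variance (X n) = expectation (\<lambda>_. 0)" using 1 m mean_zero by (intro integral_cong_AE) auto
    with unit_variance show ?thesis by simp
  next
    case 2
    then have "\<mu> = 0" "\<sigma>\<^sup>2 = 1"
      using normal_distributed_expectation[of \<sigma> "X n" \<mu>] normal_distributed_variance[of \<sigma> "X n" \<mu>]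
        mean_zero unit_variance by auto
    with 2 show ?thesis by (simp add: power2_eq_1_iff)
  qed
qed

lemma X_distr: "distr M borel (X n) = std_normal_distribution"
proof -
  have "distr M borel (X n) = distr M lborel (X n)" by (rule distr_cong) auto
  also have "\<dots> = std_normal_distribution"
    by (rule distributed_distr_eq_density[OF X_distributed])
  finally show ?thesis .
qed

lemma X_all_moments: "all_moments M (X n)"
  unfolding all_moments_def
proof (intro conjI allI)
  fix k
  have "integrable std_normal_distribution (\<lambda>x. \<bar>x\<bar> ^ k)"
    by (subst integrable_density) (auto intro!: AE_I2 integrable_std_normal_moment_abs)
  then have "integrable (distr M borel (X n)) (\<lambda>x. \<bar>x\<bar> ^ k)" by (simp add: X_distr)
  then show "integrable M (\<lambda>\<omega>. \<bar>X n \<omega>\<bar> ^ k)" by (subst (asm) integrable_distr_eq) auto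
qed simp

lemma cov_self: "cov i i = 1"
  using unit_variance[of i] mean_zero[of i] by (simp add: cov_def power2_eq_square)

definition lin :: "nat set \<Rightarrow> (nat \<Rightarrow> real) \<Rightarrow> 'a \<Rightarrow> real" where
  "lin I a \<omega> = (\<Sum>i\<in>I. a i * X i \<omega>)"

lemma lin_all_moments: "all_moments M (lin I a)"
  unfolding lin_def by (intro all_moments_sum all_moments_cmult X_all_moments)

lemma lin_measurable [measurable]: "lin I a \<in> borel_measurable M"
  by (rule all_moments_measurable[OF lin_all_moments])

lemma lin_expectation: "expectation (lin I a) = 0"
  unfolding lin_def
  by (subst Bochner_Integration.integral_sum)
     (auto intro!: all_moments_integrable X_all_moments simp: mean_zero)

text \<open>The formula covers degenerate combinations too: an almost surely constant one has mean
  zero, hence is 0, and both sides are \<open>cos \<theta>\<close>.\<close>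

lemma expectation_cos_lin:
  assumes "finite I"
  shows "expectation (\<lambda>\<omega>. cos (\<theta> + lin I a \<omega>)) = cos \<theta> * exp (- expectation (\<lambda>\<omega>. (lin I a \<omega>)\<^sup>2) / 2)"
proof -
  have "gaussian_rv M (lin I a)"
    using gaussian assms unfolding gaussian_seq_def lin_def[abs_def] by auto
  then consider \<mu> where "AE \<omega> in M. lin I a \<omega> = \<mu>"
    | \<mu> \<sigma> where "\<sigma> > 0" "distributed M lborel (lin I a) (normal_density \<mu> \<sigma>)"
    unfolding gaussian_rv_def by blast
  then show ?thesis
  proof cases
    case 1
    have "expectation (lin I a) = expectation (\<lambda>_. \<mu>)" using 1 by (intro integral_cong_AE) auto
    then have m: "\<mu> = 0" using lin_expectation by (simp add: prob_space)
    have "expectation (\<lambda>\<omega>. cos (\<theta> + lin I a \<omega>)) = expectation (\<lambda>_. cos \<theta>)"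
      using 1 m by (intro integral_cong_AE) auto
    moreover have "expectation (\<lambda>\<omega>. (lin I a \<omega>)\<^sup>2) = expectation (\<lambda>_. 0)"
      using 1 m by (intro integral_cong_AE) auto
    ultimately show ?thesis by (simp add: prob_space)
  next
    case 2
    have m: "\<mu> = 0" using normal_distributed_expectation[OF 2] lin_expectation by simp
    have v: "expectation (\<lambda>\<omega>. (lin I a \<omega>)\<^sup>2) = \<sigma>\<^sup>2"
      using normal_distributed_variance[OF 2] lin_expectation by simp
    have D: "distributed M lborel (\<lambda>\<omega>. lin I a \<omega> / \<sigma>) std_normal_density"
      using normal_standard_normal_convert[of \<sigma> "lin I a" \<mu>] 2 m by simp
    have "distr M borel (\<lambda>\<omega>. lin I a \<omega> / \<sigma>) = distr M lborel (\<lambda>\<omega>. lin I a \<omega> / \<sigma>)"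
      by (rule distr_cong) auto
    also have "\<dots> = std_normal_distribution"
      by (rule distributed_distr_eq_density[OF D])
    finally have dd: "distr M borel (\<lambda>\<omega>. lin I a \<omega> / \<sigma>) = std_normal_distribution" .
    have "expectation (\<lambda>\<omega>. cos (\<theta> + lin I a \<omega>)) = expectation (\<lambda>\<omega>. cos (\<theta> + \<sigma> * (lin I a \<omega> / \<sigma>)))"
      using 2 by simp
    also have "\<dots> = (\<integral>x. cos (\<theta> + \<sigma> * x) \<partial>distr M borel (\<lambda>\<omega>. lin I a \<omega> / \<sigma>))"
      by (rule integral_distr[symmetric]) auto
    also have "\<dots> = cos \<theta> * exp (- \<sigma>\<^sup>2 / 2)"
      unfolding dd by (rule gamma_cos)
    finally show ?thesis by (simp add: v)
  qed
qed

section \<open>Regression residuals and their independence\<close>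

text \<open>The residual of the regression of \<open>X j\<close> on \<open>X i\<close>; the
  coefficient is the covariance because \<open>X i\<close> has unit variance. In particular
  \<open>res i i\<close> vanishes.\<close>

definition res :: "nat \<Rightarrow> nat \<Rightarrow> 'a \<Rightarrow> real" where
  "res i j \<omega> = X j \<omega> - cov i j * X i \<omega>"

lemma res_measurable [measurable]: "res i j \<in> borel_measurable M"
  unfolding res_def[abs_def] by measurable

lemma res_all_moments: "all_moments M (res i j)"
  unfolding res_def[abs_def] by (intro all_moments_diff all_moments_cmult X_all_moments)

lemma X_res_uncorrelated: "expectation (\<lambda>\<omega>. X i \<omega> * res i j \<omega>) = 0"
proof -
  have i: "integrable M (\<lambda>\<omega>. X i \<omega> * X j \<omega>)" "integrable M (\<lambda>\<omega>. X i \<omega> * X i \<omega>)"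
    by (intro all_moments_integrable all_moments_mult X_all_moments)+
  have "expectation (\<lambda>\<omega>. X i \<omega> * res i j \<omega>) =
      expectation (\<lambda>\<omega>. X i \<omega> * X j \<omega> - cov i j * (X i \<omega> * X i \<omega>))"
    by (intro Bochner_Integration.integral_cong refl) (simp add: res_def algebra_simps)
  also have "\<dots> = cov i j - cov i j * cov i i"
    using i by (simp add: cov_def)
  finally show ?thesis by (simp add: cov_self)
qed

lemma res_comb_lin:
  assumes "finite J"
  shows "\<exists>I a. finite I \<and> (\<forall>\<omega>. s * X i \<omega> + (\<Sum>j\<in>J. t j * res i j \<omega>) = lin I a \<omega>)"
proof (intro exI conjI allI)
  let ?I = "insert i J"
  \<comment> \<open>Two separate summands, because i may or may not belong to
    \<open>J\<close>.\<close>
  let ?a = "\<lambda>k. (if k \<in> J then t k else 0) + (if k = i then s - (\<Sum>j\<in>J. t j * cov i j) else 0)"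
  show "finite ?I" using assms by simp
  fix \<omega>
  have "lin ?I ?a \<omega> = (\<Sum>k\<in>?I. (if k \<in> J then t k else 0) * X k \<omega>) +
     (\<Sum>k\<in>?I. (if k = i then s - (\<Sum>j\<in>J. t j * cov i j) else 0) * X k \<omega>)"
    unfolding lin_def by (simp add: distrib_right sum.distrib)
  also have "(\<Sum>k\<in>?I. (if k = i then s - (\<Sum>j\<in>J. t j * cov i j) else 0) * X k \<omega>) =
      (\<Sum>k\<in>?I. if k = i then (s - (\<Sum>j\<in>J. t j * cov i j)) * X i \<omega> else 0)"
    by (intro sum.cong) auto
  also have "\<dots> = (s - (\<Sum>j\<in>J. t j * cov i j)) * X i \<omega>" using assms by simp
  also have "(\<Sum>k\<in>?I. (if k \<in> J then t k else 0) * X k \<omega>) = (\<Sum>k\<in>J. t k * X k \<omega>)"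
    using assms by (intro sum.mono_neutral_cong_right) auto
  finally have e: "lin ?I ?a \<omega> = (\<Sum>k\<in>J. t k * X k \<omega>) + (s - (\<Sum>j\<in>J. t j * cov i j)) * X i \<omega>" .
  have "(\<Sum>j\<in>J. t j * res i j \<omega>) = (\<Sum>k\<in>J. t k * X k \<omega>) - (\<Sum>j\<in>J. t j * cov i j) * X i \<omega>"
    by (simp add: res_def algebra_simps sum_subtractf sum_distrib_left sum_distrib_right)
  then show "s * X i \<omega> + (\<Sum>j\<in>J. t j * res i j \<omega>) = lin ?I ?a \<omega>"
    unfolding e by (simp add: algebra_simps)
qed

text \<open>The cross term in the variance of the combination vanishes by
  \<open>X_res_uncorrelated\<close>, so the joint characteristic function splits off the factor
  \<open>exp (- s\<^sup>2 / 2)\<close> of \<open>X i\<close>.\<close>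

lemma expectation_cos_res:
  assumes "finite J"
  shows "expectation (\<lambda>\<omega>. cos (\<theta> + (\<Sum>j\<in>J. t j * res i j \<omega>) + s * X i \<omega>)) =
    cos \<theta> * exp (- expectation (\<lambda>\<omega>. (\<Sum>j\<in>J. t j * res i j \<omega>)\<^sup>2) / 2) * exp (- s\<^sup>2 / 2)"
proof -
  let ?Q = "\<lambda>\<omega>. \<Sum>j\<in>J. t j * res i j \<omega>"
  obtain I a where I: "finite I" "\<And>\<omega>. s * X i \<omega> + ?Q \<omega> = lin I a \<omega>"
    using res_comb_lin[OF assms] by metis
  have Q: "all_moments M ?Q" by (intro all_moments_sum all_moments_cmult res_all_moments)
  have ii: "integrable M (\<lambda>\<omega>. X i \<omega> * ?Q \<omega>)" "integrable M (\<lambda>\<omega>. ?Q \<omega> * ?Q \<omega>)" "integrable M (\<lambda>\<omega>. X i \<omega> * X i \<omega>)"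
    by (intro all_moments_integrable all_moments_mult X_all_moments Q)+
  have "expectation (\<lambda>\<omega>. X i \<omega> * ?Q \<omega>) = (\<Sum>j\<in>J. t j * expectation (\<lambda>\<omega>. X i \<omega> * res i j \<omega>))"
    by (simp add: sum_distrib_left mult.left_commute Bochner_Integration.integral_sum
        all_moments_integrable all_moments_mult X_all_moments res_all_moments)
  then have u: "expectation (\<lambda>\<omega>. X i \<omega> * ?Q \<omega>) = 0" by (simp add: X_res_uncorrelated)
  have "expectation (\<lambda>\<omega>. (lin I a \<omega>)\<^sup>2) =
     expectation (\<lambda>\<omega>. s\<^sup>2 * (X i \<omega> * X i \<omega>) + (2 * s * (X i \<omega> * ?Q \<omega>) + ?Q \<omega> * ?Q \<omega>))"
    unfolding I(2)[symmetric] by (intro Bochner_Integration.integral_cong refl) (simp add: power2_eq_square algebra_simps)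
  also have "\<dots> = s\<^sup>2 * cov i i + expectation (\<lambda>\<omega>. ?Q \<omega> * ?Q \<omega>)"
    using ii u by (simp add: cov_def)
  finally have v: "expectation (\<lambda>\<omega>. (lin I a \<omega>)\<^sup>2) = s\<^sup>2 + expectation (\<lambda>\<omega>. (?Q \<omega>)\<^sup>2)"
    by (simp add: cov_self power2_eq_square)
  have "expectation (\<lambda>\<omega>. cos (\<theta> + ?Q \<omega> + s * X i \<omega>)) = expectation (\<lambda>\<omega>. cos (\<theta> + lin I a \<omega>))"
    unfolding I(2)[symmetric] by (simp add: ac_simps)
  then show ?thesis
    unfolding expectation_cos_lin[OF I(1)] v by (simp add: exp_add[symmetric] add_divide_distrib)
qed

text \<open>The centred indicator of the event that \<open>X i\<close> lies in \<open>A\<close>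
  serves as weight in \<open>cylinder_uniqueness\<close>. That its transforms against the residuals
  vanish is again a uniqueness statement, now in the single variable \<open>X i\<close>, with a
  centred cosine of the residuals as weight.\<close>

lemma X_res_cylinder_indep:
  assumes J: "finite J" and A[measurable]: "A \<in> sets borel" and B: "\<And>j. B j \<in> sets borel"
  shows "expectation (\<lambda>\<omega>. indicator A (X i \<omega>) * (\<Prod>j\<in>J. indicator (B j) (res i j \<omega>))) =
    measure std_normal_distribution A * expectation (\<lambda>\<omega>. \<Prod>j\<in>J. indicator (B j) (res i j \<omega>))"
proof -
  let ?p = "measure std_normal_distribution A"
  note [measurable] = B
  have bi: "integrable M f" if "f \<in> borel_measurable M" "\<And>\<omega>. \<bar>f \<omega>\<bar> \<le> 1" for f :: "'a \<Rightarrow> real"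
    by (rule integrable_const_bound[where B=1]) (use that in \<open>auto intro!: AE_I2\<close>)
  have lin3: "expectation (\<lambda>\<omega>. x * a \<omega> + y * b \<omega> - z * c \<omega>) = x * expectation a + y * expectation b - z * expectation c"
    if "integrable M a" "integrable M b" "integrable M c" for a b c :: "'a \<Rightarrow> real" and x y z :: real
    using that by simp
  have pA: "expectation (\<lambda>\<omega>. indicat_real A (X i \<omega>)) = ?p"
  proof -
    have "expectation (\<lambda>\<omega>. indicat_real A (X i \<omega>)) = (\<integral>x. indicat_real A x \<partial>distr M borel (X i))"
      by (rule integral_distr[symmetric]) auto
    then show ?thesis by (simp add: X_distr)
  qed
  have p01: "0 \<le> ?p" "?p \<le> 1" by (auto intro: gamma.prob_le_1)
  have z: "expectation (\<lambda>\<omega>. (indicator A (X i \<omega>) - ?p) * (\<Prod>j\<in>J. indicator (B j) (res i j \<omega>))) = 0"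
  proof (rule cylinder_uniqueness[OF J])
    show "\<bar>indicat_real A (X i \<omega>) - ?p\<bar> \<le> 1" for \<omega> using p01 by (auto simp: indicator_def)
    fix t \<theta>
    let ?Q = "\<lambda>\<omega>. \<Sum>j\<in>J. t j * res i j \<omega>"
    let ?q = "exp (- expectation (\<lambda>\<omega>. (?Q \<omega>)\<^sup>2) / 2)"
    have E: "expectation (\<lambda>\<omega>. cos (\<eta> + ?Q \<omega> + s * X i \<omega>)) = cos \<eta> * ?q * exp (- s\<^sup>2 / 2)" for \<eta> s
      by (rule expectation_cos_res[OF J])
    have E0: "expectation (\<lambda>\<omega>. cos (\<eta> + ?Q \<omega>)) = cos \<eta> * ?q" for \<eta>
      using E[of \<eta> 0] by simp
    have EX: "expectation (\<lambda>\<omega>. cos (\<eta> + s * X i \<omega>)) = cos \<eta> * exp (- s\<^sup>2 / 2)" for \<eta> s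
      using expectation_cos_res[of "{}" \<eta> t i s] by simp
    have ES: "expectation (\<lambda>\<omega>. sin (\<eta> + ?Q \<omega> + s * X i \<omega>)) = sin \<eta> * ?q * exp (- s\<^sup>2 / 2)" for \<eta> s
      using E[of "- pi / 2 + \<eta>" s] unfolding sin_eq_cos_phase by (simp add: algebra_simps)
    have EXS: "expectation (\<lambda>\<omega>. sin (s * X i \<omega>)) = 0" for s
      using EX[of "- pi / 2" s] unfolding sin_eq_cos_phase by (simp add: algebra_simps)
    \<comment> \<open>Centred, so that its transforms against \<open>X i\<close> vanish by the
      factorization in \<open>E\<close> and \<open>ES\<close>; halved, since
      \<open>weighted_uniqueness\<close> needs a weight bounded by 1.\<close>
    let ?V = "\<lambda>\<omega>. (cos (\<theta> + ?Q \<omega>) - cos \<theta> * ?q) / 2"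
    have Vb: "\<bar>?V \<omega>\<bar> \<le> 1" for \<omega>
    proof -
      have "\<bar>cos \<theta> * ?q\<bar> \<le> 1 * 1"
        unfolding abs_mult by (intro mult_mono) auto
      moreover have "\<bar>(c - k) / 2\<bar> \<le> 1" if "\<bar>k\<bar> \<le> 1 * 1" "\<bar>c\<bar> \<le> 1" for c k :: real
        using that by (simp add: abs_le_iff)
      ultimately show ?thesis using abs_cos_le_one by blast
    qed
    have "expectation (\<lambda>\<omega>. ?V \<omega> * indicator A (X i \<omega>)) = 0"
    proof (rule weighted_uniqueness[OF _ Vb])
      fix s
      have "expectation (\<lambda>\<omega>. ?V \<omega> * cos (s * X i \<omega>)) =
        expectation (\<lambda>\<omega>. (1/4) * cos (\<theta> + ?Q \<omega> + s * X i \<omega>) + (1/4) * cos (\<theta> + ?Q \<omega> + (-s) * X i \<omega>)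
           - (cos \<theta> * ?q / 2) * cos (0 + s * X i \<omega>))"
      proof (intro Bochner_Integration.integral_cong refl)
        fix \<omega>
        show "?V \<omega> * cos (s * X i \<omega>) = (1/4) * cos (\<theta> + ?Q \<omega> + s * X i \<omega>) + (1/4) * cos (\<theta> + ?Q \<omega> + (-s) * X i \<omega>)
           - (cos \<theta> * ?q / 2) * cos (0 + s * X i \<omega>)"
          using cos_cos_phase[of "1/2" "\<theta> + ?Q \<omega>" "s * X i \<omega>"]
          unfolding mult_minus_left left_diff_distrib diff_divide_distrib by simp
      qed
      also have "\<dots> = 0"
        by (subst lin3; (rule bi)?; (simp only: E EX)?) auto
      finally show "expectation (\<lambda>\<omega>. ?V \<omega> * cos (s * X i \<omega>)) = 0" .
      have "expectation (\<lambda>\<omega>. ?V \<omega> * sin (s * X i \<omega>)) =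
        expectation (\<lambda>\<omega>. (1/4) * sin (\<theta> + ?Q \<omega> + s * X i \<omega>) + (-1/4) * sin (\<theta> + ?Q \<omega> + (-s) * X i \<omega>)
           - (cos \<theta> * ?q / 2) * sin (s * X i \<omega>))"
      proof (intro Bochner_Integration.integral_cong refl)
        fix \<omega>
        show "?V \<omega> * sin (s * X i \<omega>) = (1/4) * sin (\<theta> + ?Q \<omega> + s * X i \<omega>) + (-1/4) * sin (\<theta> + ?Q \<omega> + (-s) * X i \<omega>)
           - (cos \<theta> * ?q / 2) * sin (s * X i \<omega>)"
          using cos_sin_phase[of "1/2" "\<theta> + ?Q \<omega>" "s * X i \<omega>"]
          unfolding mult_minus_left left_diff_distrib diff_divide_distrib by simp
      qed
      also have "\<dots> = 0"
        by (subst lin3; (rule bi)?; (simp only: ES EXS)?) auto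
      finally show "expectation (\<lambda>\<omega>. ?V \<omega> * sin (s * X i \<omega>)) = 0" .
    qed auto
    moreover have "expectation (\<lambda>\<omega>. ?V \<omega> * indicator A (X i \<omega>)) =
      (1/2) * expectation (\<lambda>\<omega>. indicator A (X i \<omega>) * cos (\<theta> + ?Q \<omega>)) - (cos \<theta> * ?q / 2) * ?p"
    proof -
      have i1: "integrable M (\<lambda>\<omega>. indicator A (X i \<omega>) * cos (\<theta> + ?Q \<omega>))"
        "integrable M (\<lambda>\<omega>. indicat_real A (X i \<omega>))"
        by (rule bi; auto simp: indicator_def)+
      have "expectation (\<lambda>\<omega>. ?V \<omega> * indicator A (X i \<omega>)) =
        expectation (\<lambda>\<omega>. (1/2) * (indicator A (X i \<omega>) * cos (\<theta> + ?Q \<omega>)) - (cos \<theta> * ?q / 2) * indicator A (X i \<omega>))"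
        by (intro Bochner_Integration.integral_cong refl) (simp add: left_diff_distrib right_diff_distrib diff_divide_distrib mult_ac)
      also have "\<dots> = (1/2) * expectation (\<lambda>\<omega>. indicator A (X i \<omega>) * cos (\<theta> + ?Q \<omega>)) - (cos \<theta> * ?q / 2) * ?p"
        using i1 pA by (subst Bochner_Integration.integral_diff) auto
      finally show ?thesis .
    qed
    ultimately have m: "expectation (\<lambda>\<omega>. indicator A (X i \<omega>) * cos (\<theta> + ?Q \<omega>)) = cos \<theta> * ?q * ?p"
      by simp
    have i1: "integrable M (\<lambda>\<omega>. indicator A (X i \<omega>) * cos (\<theta> + ?Q \<omega>))"
        "integrable M (\<lambda>\<omega>. cos (\<theta> + ?Q \<omega>))"
        by (rule bi; auto simp: indicator_def)+
    show "expectation (\<lambda>\<omega>. (indicator A (X i \<omega>) - ?p) * cos (\<theta> + ?Q \<omega>)) = 0"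
      using i1 m E0[of \<theta>] by (simp add: left_diff_distrib)
  qed (use B in auto)
  have pb: "\<bar>\<Prod>j\<in>J. indicat_real (B j) (res i j \<omega>)\<bar> \<le> 1" for \<omega>
    unfolding abs_prod by (intro prod_le_1) (auto simp: indicator_def)
  have "integrable M (\<lambda>\<omega>. indicator A (X i \<omega>) * (\<Prod>j\<in>J. indicat_real (B j) (res i j \<omega>)))"
    "integrable M (\<lambda>\<omega>. \<Prod>j\<in>J. indicat_real (B j) (res i j \<omega>))"
    using pb by (auto intro!: bi simp: indicator_def[of A])
  then show ?thesis using z by (simp add: left_diff_distrib)
qed

end

section \<open>Gaussian integration by parts\<close>

lemma std_normal_density_has_derivative:
  "(std_normal_density has_real_derivative (- x * std_normal_density x)) (at x)"
proof -
  have "((\<lambda>x. (1 / sqrt (2 * pi)) * exp (- x\<^sup>2 / 2)) has_real_derivative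
      (1 / sqrt (2 * pi)) * (exp (- x\<^sup>2 / 2) * (- x))) (at x)"
    by (rule DERIV_cmult) (auto intro!: derivative_eq_intros)
  then show ?thesis unfolding std_normal_density_def[abs_def] by (simp add: mult_ac)
qed

text \<open>The cutoff \<open>1 - x\<^sup>2 / n\<^sup>2\<close> on \<open>[-n, n]\<close> removes the boundary terms, so that no growth
  condition on \<open>\<psi>\<close> is needed.\<close>

lemma gaussian_integration_by_parts_1d:
  fixes \<psi> \<psi>' :: "real \<Rightarrow> real"
  assumes d: "\<And>x. (\<psi> has_real_derivative \<psi>' x) (at x)"
    and c: "continuous_on UNIV \<psi>'"
    and i1: "integrable std_normal_distribution (\<lambda>x. x * \<psi> x)"
    and i2: "integrable std_normal_distribution \<psi>'"
  shows "(\<integral>x. x * \<psi> x \<partial>std_normal_distribution) = (\<integral>x. \<psi>' x \<partial>std_normal_distribution)"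
proof -
  let ?\<phi> = "std_normal_density"
  have c\<psi>: "continuous_on UNIV \<psi>" by (intro continuous_at_imp_continuous_on ballI DERIV_isCont[OF d])
  have [measurable]: "\<psi> \<in> borel_measurable borel" "\<psi>' \<in> borel_measurable borel"
    by (intro borel_measurable_continuous_onI c\<psi> c)+
  have j1: "integrable lborel (\<lambda>x. ?\<phi> x * (x * \<psi> x))"
    using i1 by (subst (asm) integrable_density) (auto intro!: AE_I2)
  have j2: "integrable lborel (\<lambda>x. ?\<phi> x * \<psi>' x)"
    using i2 by (subst (asm) integrable_density) (auto intro!: AE_I2)
  note d\<phi> = std_normal_density_has_derivative
  have c\<phi>: "isCont ?\<phi> x" for x by (rule DERIV_isCont[OF d\<phi>])
  \<comment> \<open>The derivative of the density times \<psi> times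
    \<open>1 - x\<^sup>2 / m\<^sup>2\<close> on [-m, m], with m = n + 1 so that m is never 0. That
    product vanishes at both end points.\<close>
  define s where "s n x = (?\<phi> x * (\<psi>' x - x * \<psi> x) * (1 - x\<^sup>2 / (real (Suc n))\<^sup>2) - ?\<phi> x * (2 * x * \<psi> x) / (real (Suc n))\<^sup>2)
       * indicator {- real (Suc n)..real (Suc n)} x" for n x
  have zero: "(\<integral>x. s n x \<partial>lborel) = 0" for n
  proof -
    let ?m = "real (Suc n)"
    have "(\<integral>x. s n x \<partial>lborel) = ?\<phi> ?m * \<psi> ?m * (1 - ?m\<^sup>2 / ?m\<^sup>2) - ?\<phi> (-?m) * \<psi> (-?m) * (1 - (-?m)\<^sup>2 / ?m\<^sup>2)"
      unfolding s_def
    proof (rule integral_FTC_Icc_real)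
      fix x
      show "((\<lambda>x. ?\<phi> x * \<psi> x * (1 - x\<^sup>2 / ?m\<^sup>2)) has_real_derivative
         ?\<phi> x * (\<psi>' x - x * \<psi> x) * (1 - x\<^sup>2 / ?m\<^sup>2) - ?\<phi> x * (2 * x * \<psi> x) / ?m\<^sup>2) (at x)"
      proof -
        have "((\<lambda>x. 1 - x\<^sup>2 / ?m\<^sup>2) has_real_derivative - (2 * x / ?m\<^sup>2)) (at x)"
          by (rule DERIV_cong[OF DERIV_diff[OF DERIV_const DERIV_cdivide[OF DERIV_pow]]]) simp
        from DERIV_mult[OF DERIV_mult[OF d\<phi> d] this]
        show ?thesis by (rule DERIV_cong) (simp add: algebra_simps)
      qed
      have "isCont \<psi>' x" "isCont \<psi> x" using c c\<psi> by (auto simp: continuous_on_eq_continuous_at)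
      then show "isCont (\<lambda>x. ?\<phi> x * (\<psi>' x - x * \<psi> x) * (1 - x\<^sup>2 / ?m\<^sup>2) - ?\<phi> x * (2 * x * \<psi> x) / ?m\<^sup>2) x"
        by (intro continuous_intros c\<phi>) auto
    qed simp
    also have "\<dots> = 0" by (simp del: of_nat_Suc)
    finally show ?thesis .
  qed
  have lim: "(\<lambda>n. s n x) \<longlonglongrightarrow> ?\<phi> x * (\<psi>' x - x * \<psi> x)" for x
  proof -
    have z: "(\<lambda>n. a / (real (Suc n))\<^sup>2) \<longlonglongrightarrow> 0" for a :: real
    proof -
      have "(\<lambda>n. a / real (Suc n) * (1 / real (Suc n))) \<longlonglongrightarrow> 0 * 0"
        by (intro tendsto_mult LIMSEQ_Suc[OF lim_const_over_n])
      then show ?thesis by (simp add: power2_eq_square del: of_nat_Suc)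
    qed
    have "(\<lambda>n. ?\<phi> x * (\<psi>' x - x * \<psi> x) * (1 - x\<^sup>2 / (real (Suc n))\<^sup>2) - ?\<phi> x * (2 * x * \<psi> x) / (real (Suc n))\<^sup>2)
        \<longlonglongrightarrow> ?\<phi> x * (\<psi>' x - x * \<psi> x) * (1 - 0) - 0"
      by (intro tendsto_intros z)
    moreover have "\<forall>\<^sub>F n in sequentially. s n x = ?\<phi> x * (\<psi>' x - x * \<psi> x) * (1 - x\<^sup>2 / (real (Suc n))\<^sup>2) - ?\<phi> x * (2 * x * \<psi> x) / (real (Suc n))\<^sup>2"
      using eventually_ge_at_top[of "nat \<lceil>\<bar>x\<bar>\<rceil>"]
    proof eventually_elim
      case (elim n)
      then have "\<bar>x\<bar> \<le> real (Suc n)" by linarith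
      then show ?case by (auto simp: s_def indicator_def)
    qed
    ultimately show ?thesis by (simp add: tendsto_cong)
  qed
  have bound: "norm (s n x) \<le> ?\<phi> x * \<bar>\<psi>' x\<bar> + 3 * (?\<phi> x * \<bar>x * \<psi> x\<bar>)" for n x
  proof (cases "\<bar>x\<bar> \<le> real (Suc n)")
    case True
    let ?m = "real (Suc n)"
    have m: "0 < ?m\<^sup>2" "1 \<le> ?m\<^sup>2" by (auto simp: one_le_power simp del: of_nat_Suc) 
    have "x\<^sup>2 \<le> ?m\<^sup>2" using True by (metis abs_ge_zero power2_abs power_mono)
    then have q: "0 \<le> x\<^sup>2 / ?m\<^sup>2" "x\<^sup>2 / ?m\<^sup>2 \<le> 1" using m by (auto simp: divide_le_eq simp del: of_nat_Suc)
    have "\<bar>?\<phi> x * (\<psi>' x - x * \<psi> x) * (1 - x\<^sup>2 / ?m\<^sup>2)\<bar> \<le> ?\<phi> x * (\<bar>\<psi>' x\<bar> + \<bar>x * \<psi> x\<bar>) * 1"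
      unfolding abs_mult[of _ "1 - x\<^sup>2 / ?m\<^sup>2"] abs_mult[of "?\<phi> x"]
      by (intro mult_mono) (use q in \<open>auto intro!: mult_left_mono abs_triangle_ineq4\<close>)
    moreover have "\<bar>?\<phi> x * (2 * x * \<psi> x) / ?m\<^sup>2\<bar> \<le> 2 * (?\<phi> x * \<bar>x * \<psi> x\<bar>)"
    proof -
      have "\<bar>?\<phi> x * (2 * x * \<psi> x) / ?m\<^sup>2\<bar> = 2 * (?\<phi> x * \<bar>x * \<psi> x\<bar>) / ?m\<^sup>2"
        by (simp add: abs_mult)
      also have "\<dots> \<le> 2 * (?\<phi> x * \<bar>x * \<psi> x\<bar>) / 1"
        using m by (intro divide_left_mono) auto
      finally show ?thesis by simp
    qed
    ultimately have "\<bar>?\<phi> x * (\<psi>' x - x * \<psi> x) * (1 - x\<^sup>2 / ?m\<^sup>2) - ?\<phi> x * (2 * x * \<psi> x) / ?m\<^sup>2\<bar>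
       \<le> ?\<phi> x * (\<bar>\<psi>' x\<bar> + \<bar>x * \<psi> x\<bar>) * 1 + 2 * (?\<phi> x * \<bar>x * \<psi> x\<bar>)"
      by linarith
    moreover have ind: "indicat_real {- ?m..?m} x = 1" using True by (auto simp: indicator_def)
    ultimately have "norm (s n x) \<le> ?\<phi> x * (\<bar>\<psi>' x\<bar> + \<bar>x * \<psi> x\<bar>) * 1 + 2 * (?\<phi> x * \<bar>x * \<psi> x\<bar>)"
      by (simp only: s_def ind mult_1_right real_norm_def)
    also have "\<dots> = ?\<phi> x * \<bar>\<psi>' x\<bar> + 3 * (?\<phi> x * \<bar>x * \<psi> x\<bar>)"
      by (simp add: algebra_simps)
    finally show ?thesis .
  next
    case False
    then have "indicat_real {- real (Suc n)..real (Suc n)} x = 0" by (simp add: indicator_def abs_le_iff del: of_nat_Suc) linarith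
    then have "s n x = 0" by (simp add: s_def)
    then show ?thesis by simp
  qed
  have "(\<lambda>n. \<integral>x. s n x \<partial>lborel) \<longlonglongrightarrow> (\<integral>x. ?\<phi> x * (\<psi>' x - x * \<psi> x) \<partial>lborel)"
  proof (rule integral_dominated_convergence[where w="\<lambda>x. ?\<phi> x * \<bar>\<psi>' x\<bar> + 3 * (?\<phi> x * \<bar>x * \<psi> x\<bar>)"])
    show "integrable lborel (\<lambda>x. ?\<phi> x * \<bar>\<psi>' x\<bar> + 3 * (?\<phi> x * \<bar>x * \<psi> x\<bar>))"
      using integrable_abs[OF j1] integrable_abs[OF j2] by (simp add: abs_mult)
    show "s n \<in> borel_measurable lborel" for n unfolding s_def[abs_def] by measurable
    show "AE x in lborel. (\<lambda>n. s n x) \<longlonglongrightarrow> ?\<phi> x * (\<psi>' x - x * \<psi> x)" by (intro AE_I2 lim)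
    show "AE x in lborel. norm (s n x) \<le> ?\<phi> x * \<bar>\<psi>' x\<bar> + 3 * (?\<phi> x * \<bar>x * \<psi> x\<bar>)" for n by (intro AE_I2 bound)
  qed auto
  then have "(\<integral>x. ?\<phi> x * (\<psi>' x - x * \<psi> x) \<partial>lborel) = 0"
    unfolding zero by (simp add: LIMSEQ_const_iff)
  then have "(\<integral>x. ?\<phi> x * \<psi>' x \<partial>lborel) = (\<integral>x. ?\<phi> x * (x * \<psi> x) \<partial>lborel)"
    using j1 j2 by (simp add: right_diff_distrib)
  then show ?thesis by (simp add: integral_density)
qed

section \<open>Integration by parts for functions of the whole sequence\<close>

abbreviation seq_space :: "(nat \<Rightarrow> real) measure" where
  "seq_space \<equiv> PiM UNIV (\<lambda>_. borel)"

context gaussian_family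
begin

abbreviation res_seq :: "nat \<Rightarrow> 'a \<Rightarrow> nat \<Rightarrow> real" where
  "res_seq i \<omega> \<equiv> (\<lambda>j. res i j \<omega>)"

lemma res_seq_measurable [measurable]: "res_seq i \<in> M \<rightarrow>\<^sub>M seq_space"
  by (rule measurable_PiM_single') (auto simp: space_PiM)

lemma X_seq_measurable [measurable]: "(\<lambda>\<omega> j. X j \<omega>) \<in> M \<rightarrow>\<^sub>M seq_space"
  by (rule measurable_PiM_single') (auto simp: space_PiM)

text \<open>For fixed \<open>A\<close> both sides are finite measures in \<open>B\<close>: the law
  of the residuals restricted to the event that \<open>X i\<close> lies in \<open>A\<close>, and a
  multiple of the law of the residuals. They agree on cylinders by
  \<open>X_res_cylinder_indep\<close>.\<close>

lemma X_res_indep: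
  "distr M (borel \<Otimes>\<^sub>M seq_space) (\<lambda>\<omega>. (X i \<omega>, res_seq i \<omega>)) =
     std_normal_distribution \<Otimes>\<^sub>M distr M seq_space (res_seq i)"
proof (rule pair_measure_eqI[symmetric])
  let ?\<nu> = "distr M seq_space (res_seq i)"
  interpret \<nu>: prob_space ?\<nu> by (rule prob_space_distr) measurable
  show "sigma_finite_measure std_normal_distribution" "sigma_finite_measure ?\<nu>"
    by unfold_locales
  show "sets (std_normal_distribution \<Otimes>\<^sub>M ?\<nu>) = sets (distr M (borel \<Otimes>\<^sub>M seq_space) (\<lambda>\<omega>. (X i \<omega>, res_seq i \<omega>)))"
    unfolding sets_distr by (rule sets_pair_measure_cong) auto
  fix A B assume "A \<in> sets std_normal_distribution" "B \<in> sets ?\<nu>"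
  then have A[measurable]: "A \<in> sets borel" and B[measurable]: "B \<in> sets seq_space" by auto
  let ?p = "measure std_normal_distribution A"
  let ?S = "{\<omega> \<in> space M. X i \<omega> \<in> A}"
  define P where "P = distr (density M (indicator ?S)) seq_space (res_seq i)"
  define Q where "Q = density ?\<nu> (\<lambda>_. ennreal ?p)"
  have eP: "emeasure P C = emeasure M {\<omega> \<in> space M. X i \<omega> \<in> A \<and> res_seq i \<omega> \<in> C}" if C[measurable]: "C \<in> sets seq_space" for C
  proof -
    have "emeasure P C = emeasure (density M (indicator ?S)) (res_seq i -` C \<inter> space M)"
      unfolding P_def by (subst emeasure_distr) (auto simp: C)
    also have "\<dots> = emeasure M (?S \<inter> (res_seq i -` C \<inter> space M))"
      by (rule emeasure_restricted) auto
    also have "?S \<inter> (res_seq i -` C \<inter> space M) = {\<omega> \<in> space M. X i \<omega> \<in> A \<and> res_seq i \<omega> \<in> C}" by auto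
    finally show ?thesis .
  qed
  have eQ: "emeasure Q C = ennreal ?p * emeasure ?\<nu> C" if C[measurable]: "C \<in> sets seq_space" for C
    unfolding Q_def by (rule emeasure_density_const) (simp add: C)
  have "P = Q"
  proof (rule measure_eqI_PiM_infinite)
    show "sets P = sets seq_space" "sets Q = sets seq_space" by (auto simp: P_def Q_def)
    show "finite_measure P"
    proof
      have "emeasure P (space P) \<le> emeasure M (space M)"
        by (subst eP) (auto simp: P_def intro!: emeasure_mono)
      then show "emeasure P (space P) \<noteq> \<infinity>" by (auto simp: emeasure_space_1 top_unique)
    qed
    fix B :: "nat \<Rightarrow> real set" and J assume J: "finite J" and BJ: "\<And>j. j \<in> J \<Longrightarrow> B j \<in> sets borel"
    \<comment> \<open>\<open>B\<close> is completed by \<open>UNIV\<close> outside \<open>J\<close>,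
      since the factorization asks for Borel sets at all indices.\<close>
    let ?B = "\<lambda>j. if j \<in> J then B j else UNIV"
    let ?C = "prod_emb UNIV (\<lambda>_. borel) J (Pi\<^sub>E J B) :: (nat \<Rightarrow> real) set"
    have B': "?B j \<in> sets borel" for j using BJ by simp
    note [measurable] = B'
    have C[measurable]: "?C \<in> sets seq_space"
      by (rule sets_PiM_I) (use J BJ in auto)
    have mem: "x \<in> ?C \<longleftrightarrow> (\<forall>j\<in>J. x j \<in> ?B j)" for x
      by (auto simp: prod_emb_def space_PiM PiE_iff)
    have ind: "indicat_real ?C x = (\<Prod>j\<in>J. indicator (?B j) (x j))" for x
      unfolding indicator_def mem using J by (auto simp: prod_zero_iff split: if_splits)
    have "measure M {\<omega> \<in> space M. X i \<omega> \<in> A \<and> res_seq i \<omega> \<in> ?C} =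
        expectation (\<lambda>\<omega>. indicator {\<omega> \<in> space M. X i \<omega> \<in> A \<and> res_seq i \<omega> \<in> ?C} \<omega>)"
      by (simp add: Int_absorb1)
    also have "\<dots> = expectation (\<lambda>\<omega>. indicator A (X i \<omega>) * (\<Prod>j\<in>J. indicator (?B j) (res i j \<omega>)))"
      by (intro Bochner_Integration.integral_cong refl) (simp only: ind[symmetric], auto simp: indicator_def)
    also have "\<dots> = ?p * expectation (\<lambda>\<omega>. \<Prod>j\<in>J. indicator (?B j) (res i j \<omega>))"
      by (rule X_res_cylinder_indep[OF J A B'])
    also have "expectation (\<lambda>\<omega>. \<Prod>j\<in>J. indicat_real (?B j) (res i j \<omega>)) =
       expectation (\<lambda>\<omega>. indicat_real {\<omega> \<in> space M. res_seq i \<omega> \<in> ?C} \<omega>)"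
      by (intro Bochner_Integration.integral_cong refl) (simp only: ind[symmetric], auto simp: indicator_def)
    also have "\<dots> = measure M {\<omega> \<in> space M. res_seq i \<omega> \<in> ?C}" by (simp add: Int_absorb1)
    finally have m: "measure M {\<omega> \<in> space M. X i \<omega> \<in> A \<and> res_seq i \<omega> \<in> ?C} =
      ?p * measure M {\<omega> \<in> space M. res_seq i \<omega> \<in> ?C}" .
    have "emeasure ?\<nu> ?C = emeasure M {\<omega> \<in> space M. res_seq i \<omega> \<in> ?C}"
      by (subst emeasure_distr) (auto simp: C intro!: arg_cong[where f="emeasure M"])
    then show "emeasure P ?C = emeasure Q ?C"
      by (simp add: eP[OF C] eQ[OF C] emeasure_eq_measure m ennreal_mult)
  qed
  then have "emeasure std_normal_distribution A * emeasure ?\<nu> B = emeasure M {\<omega> \<in> space M. X i \<omega> \<in> A \<and> res_seq i \<omega> \<in> B}"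
    using eP[OF B] eQ[OF B] by (simp add: gamma.emeasure_eq_measure)
  also have "\<dots> = emeasure (distr M (borel \<Otimes>\<^sub>M seq_space) (\<lambda>\<omega>. (X i \<omega>, res_seq i \<omega>))) (A \<times> B)"
    by (subst emeasure_distr) (auto intro!: arg_cong[where f="emeasure M"])
  finally show "emeasure std_normal_distribution A * emeasure ?\<nu> B =
    emeasure (distr M (borel \<Otimes>\<^sub>M seq_space) (\<lambda>\<omega>. (X i \<omega>, res_seq i \<omega>))) (A \<times> B)" .
qed

text \<open>For fixed residuals r the sequence is the point \<open>r j + cov i j * x\<close> of a
  line, where x is the value of \<open>X i\<close>, standard normal and independent of r.
  One-dimensional integration by parts in x for almost every r, combined with Fubini, gives the
  claim. \<open>D\<close> is the derivative along these lines; for smooth \<Phi> it is the sum over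
  j of \<open>cov i j\<close> times the j-th partial derivative.\<close>

lemma gaussian_integration_by_parts:
  assumes \<Phi>[measurable]: "\<Phi> \<in> borel_measurable seq_space" and D[measurable]: "D \<in> borel_measurable seq_space"
    and deriv: "\<And>r t. ((\<lambda>s. \<Phi> (\<lambda>j. r j + cov i j * s)) has_real_derivative D (\<lambda>j. r j + cov i j * t)) (at t)"
    and cont: "\<And>r. continuous_on UNIV (\<lambda>t. D (\<lambda>j. r j + cov i j * t))"
    and i1: "integrable M (\<lambda>\<omega>. X i \<omega> * \<Phi> (\<lambda>j. X j \<omega>))"
    and i2: "integrable M (\<lambda>\<omega>. D (\<lambda>j. X j \<omega>))"
  shows "expectation (\<lambda>\<omega>. X i \<omega> * \<Phi> (\<lambda>j. X j \<omega>)) = expectation (\<lambda>\<omega>. D (\<lambda>j. X j \<omega>))"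
proof -
  let ?\<gamma> = "std_normal_distribution"
  let ?\<nu> = "distr M seq_space (res_seq i)"
  let ?J = "distr M (borel \<Otimes>\<^sub>M seq_space) (\<lambda>\<omega>. (X i \<omega>, res_seq i \<omega>))"
  interpret \<nu>: prob_space ?\<nu> by (rule prob_space_distr) measurable
  interpret pr: pair_sigma_finite ?\<gamma> ?\<nu> by unfold_locales
  define f where "f x r = x * \<Phi> (\<lambda>j. r j + cov i j * x)" for x r
  define h where "h x r = D (\<lambda>j. r j + cov i j * x)" for x r
  have sh: "(\<lambda>z j. snd z j + cov i j * fst z) \<in> borel \<Otimes>\<^sub>M seq_space \<rightarrow>\<^sub>M seq_space"
    by (rule measurable_PiM_single') (auto simp: space_PiM)
  have fm[measurable]: "case_prod f \<in> borel_measurable (borel \<Otimes>\<^sub>M seq_space)"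
    unfolding f_def split_beta' using measurable_compose[OF sh \<Phi>] by measurable
  have hm[measurable]: "case_prod h \<in> borel_measurable (borel \<Otimes>\<^sub>M seq_space)"
    unfolding h_def split_beta' using measurable_compose[OF sh D] by measurable
  have Xr: "(\<lambda>j. res i j \<omega> + cov i j * X i \<omega>) = (\<lambda>j. X j \<omega>)" for \<omega>
    by (simp add: res_def)
  have ef: "expectation (\<lambda>\<omega>. X i \<omega> * \<Phi> (\<lambda>j. X j \<omega>)) = integral\<^sup>L ?J (case_prod f)"
    by (subst integral_distr) (auto simp: f_def Xr)
  have eh: "expectation (\<lambda>\<omega>. D (\<lambda>j. X j \<omega>)) = integral\<^sup>L ?J (case_prod h)"
    by (subst integral_distr) (auto simp: h_def Xr)
  have "integrable ?J (case_prod f)" "integrable ?J (case_prod h)"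
    using i1 i2 by (subst integrable_distr_eq; auto simp: f_def h_def Xr)+
  then have jf: "integrable (?\<gamma> \<Otimes>\<^sub>M ?\<nu>) (case_prod f)" and jh: "integrable (?\<gamma> \<Otimes>\<^sub>M ?\<nu>) (case_prod h)"
    by (simp_all only: X_res_indep)
  have "AE r in ?\<nu>. (\<integral>x. f x r \<partial>?\<gamma>) = (\<integral>x. h x r \<partial>?\<gamma>)"
    using pr.AE_integrable_snd[OF jf] pr.AE_integrable_snd[OF jh]
  proof eventually_elim
    case (elim r)
    then show ?case unfolding f_def h_def
      by (intro gaussian_integration_by_parts_1d deriv cont) auto
  qed
  then have "(\<integral>r. (\<integral>x. f x r \<partial>?\<gamma>) \<partial>?\<nu>) = (\<integral>r. (\<integral>x. h x r \<partial>?\<gamma>) \<partial>?\<nu>)"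
    by (intro integral_cong_AE borel_measurable_integrable[OF pr.integrable_snd[OF jf]]
        borel_measurable_integrable[OF pr.integrable_snd[OF jh]])
  then show ?thesis
    unfolding ef eh X_res_indep pr.integral_snd[OF jf] pr.integral_snd[OF jh] .
qed

end

section \<open>Mixed moments of Hermite polynomials\<close>

text \<open>\<open>wick_sum V a b c e\<close> sums \<open>V\<close> over the pairings of four blocks of \<open>a\<close>, \<open>b\<close>, \<open>c\<close>, \<open>e\<close> half-edges
  without pairs inside a block; the arguments of \<open>V\<close> are the numbers of pairs between the blocks
  12, 34, 13, 14, 23, 24, in this order.\<close>

fun wick_sum :: "(nat \<Rightarrow> nat \<Rightarrow> nat \<Rightarrow> nat \<Rightarrow> nat \<Rightarrow> nat \<Rightarrow> real) \<Rightarrow> nat \<Rightarrow> nat \<Rightarrow> nat \<Rightarrow> nat \<Rightarrow> real" where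
  "wick_sum V (Suc a) b c e =
     real b * wick_sum (\<lambda>u v A B C D. V (Suc u) v A B C D) a (b - 1) c e
     + real c * wick_sum (\<lambda>u v A B C D. V u v (Suc A) B C D) a b (c - 1) e
     + real e * wick_sum (\<lambda>u v A B C D. V u v A (Suc B) C D) a b c (e - 1)"
| "wick_sum V 0 (Suc b) c e =
     real c * wick_sum (\<lambda>u v A B C D. V u v A B (Suc C) D) 0 b (c - 1) e
     + real e * wick_sum (\<lambda>u v A B C D. V u v A B C (Suc D)) 0 b c (e - 1)"
| "wick_sum V 0 0 (Suc c) e =
     real e * wick_sum (\<lambda>u v A B C D. V u (Suc v) A B C D) 0 0 c (e - 1)"
| "wick_sum V 0 0 0 e = (if e = 0 then V 0 0 0 0 0 0 else 0)"

text \<open>The recursion evaluates \<open>V\<close> only at multiplicities with degrees a, b, c, e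
  at the four vertices, so a comparison there suffices. Empty blocks are treated apart, because
  \<open>b - 1\<close> does not undo a successor at b = 0; there the coefficient vanishes.\<close>

lemma wick_sum_mono:
  assumes "\<And>u v A B C D. u + A + B = a \<Longrightarrow> u + C + D = b \<Longrightarrow> v + A + C = c \<Longrightarrow> v + B + D = e \<Longrightarrow>
     V u v A B C D \<le> V' u v A B C D"
  shows "wick_sum V a b c e \<le> wick_sum V' a b c e"
  using assms
proof (induction V a b c e arbitrary: V' rule: wick_sum.induct)
  case (1 V a b c e)
  have "real b * wick_sum (\<lambda>u v A B C D. V (Suc u) v A B C D) a (b - 1) c e
      \<le> real b * wick_sum (\<lambda>u v A B C D. V' (Suc u) v A B C D) a (b - 1) c e"
    by (cases "b = 0") (simp, rule mult_left_mono, rule "1.IH"(1), rule "1.prems", auto)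
  moreover have "real c * wick_sum (\<lambda>u v A B C D. V u v (Suc A) B C D) a b (c - 1) e
      \<le> real c * wick_sum (\<lambda>u v A B C D. V' u v (Suc A) B C D) a b (c - 1) e"
    by (cases "c = 0") (simp, rule mult_left_mono, rule "1.IH"(2), rule "1.prems", auto)
  moreover have "real e * wick_sum (\<lambda>u v A B C D. V u v A (Suc B) C D) a b c (e - 1)
      \<le> real e * wick_sum (\<lambda>u v A B C D. V' u v A (Suc B) C D) a b c (e - 1)"
    by (cases "e = 0") (simp, rule mult_left_mono, rule "1.IH"(3), rule "1.prems", auto)
  ultimately show ?case by simp
next
  case (2 V b c e)
  have "real c * wick_sum (\<lambda>u v A B C D. V u v A B (Suc C) D) 0 b (c - 1) e
      \<le> real c * wick_sum (\<lambda>u v A B C D. V' u v A B (Suc C) D) 0 b (c - 1) e"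
    by (cases "c = 0") (simp, rule mult_left_mono, rule "2.IH"(1), rule "2.prems", auto)
  moreover have "real e * wick_sum (\<lambda>u v A B C D. V u v A B C (Suc D)) 0 b c (e - 1)
      \<le> real e * wick_sum (\<lambda>u v A B C D. V' u v A B C (Suc D)) 0 b c (e - 1)"
    by (cases "e = 0") (simp, rule mult_left_mono, rule "2.IH"(2), rule "2.prems", auto)
  ultimately show ?case by simp
next
  case (3 V c e)
  have "real e * wick_sum (\<lambda>u v A B C D. V u (Suc v) A B C D) 0 0 c (e - 1)
      \<le> real e * wick_sum (\<lambda>u v A B C D. V' u (Suc v) A B C D) 0 0 c (e - 1)"
    by (cases "e = 0") (simp, rule mult_left_mono, rule "3.IH"(1), rule "3.prems", auto)
  then show ?case by simp
next
  case (4 V e)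
  then show ?case by auto
qed

lemma wick_sum_scale:
  "wick_sum (\<lambda>u v A B C D. k * V u v A B C D) a b c e = k * wick_sum V a b c e"
  by (induction V a b c e rule: wick_sum.induct) (simp_all add: algebra_simps)

lemma wick_sum_diff:
  "wick_sum (\<lambda>u v A B C D. V u v A B C D - V' u v A B C D) a b c e = wick_sum V a b c e - wick_sum V' a b c e"
proof (induction V a b c e arbitrary: V' rule: wick_sum.induct)
  case (1 V a b c e) show ?case unfolding wick_sum.simps 1 by (simp add: algebra_simps)
next
  case (2 V b c e) show ?case unfolding wick_sum.simps 2 by (simp add: algebra_simps)
next
  case (3 V c e) show ?case unfolding wick_sum.simps 3 by (simp add: algebra_simps)
qed simp

lemma wick_sum_abs_le:
  assumes "\<And>u v A B C D. u + A + B = a \<Longrightarrow> u + C + D = b \<Longrightarrow> v + A + C = c \<Longrightarrow> v + B + D = e \<Longrightarrow>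
     \<bar>V u v A B C D\<bar> \<le> V' u v A B C D"
  shows "\<bar>wick_sum V a b c e\<bar> \<le> wick_sum V' a b c e"
proof -
  have "wick_sum V a b c e \<le> wick_sum V' a b c e"
    using assms by (intro wick_sum_mono) (auto simp: abs_le_iff)
  moreover have "wick_sum (\<lambda>u v A B C D. (-1) * V u v A B C D) a b c e \<le> wick_sum V' a b c e"
    using assms by (intro wick_sum_mono) (auto simp: abs_le_iff)
  ultimately show ?thesis using wick_sum_scale[of "-1" V a b c e] by simp
qed

definition monomial ::
  "real \<Rightarrow> real \<Rightarrow> real \<Rightarrow> real \<Rightarrow> real \<Rightarrow> real \<Rightarrow> nat \<Rightarrow> nat \<Rightarrow> nat \<Rightarrow> nat \<Rightarrow> nat \<Rightarrow> nat \<Rightarrow> real" where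
  "monomial r12 r34 r13 r14 r23 r24 u v A B C D =
     r12 ^ u * r34 ^ v * r13 ^ A * r14 ^ B * r23 ^ C * r24 ^ D"

lemma wick_sum_monomial_shift:
  fixes r12 r34 r13 r14 r23 r24 :: real
  defines "m \<equiv> monomial r12 r34 r13 r14 r23 r24"
  shows "wick_sum (\<lambda>u v A B C D. m (Suc u) v A B C D) a b c e = r12 * wick_sum m a b c e"
    and "wick_sum (\<lambda>u v A B C D. m u (Suc v) A B C D) a b c e = r34 * wick_sum m a b c e"
    and "wick_sum (\<lambda>u v A B C D. m u v (Suc A) B C D) a b c e = r13 * wick_sum m a b c e"
    and "wick_sum (\<lambda>u v A B C D. m u v A (Suc B) C D) a b c e = r14 * wick_sum m a b c e"
    and "wick_sum (\<lambda>u v A B C D. m u v A B (Suc C) D) a b c e = r23 * wick_sum m a b c e"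
    and "wick_sum (\<lambda>u v A B C D. m u v A B C (Suc D)) a b c e = r24 * wick_sum m a b c e"
  unfolding m_def
  by (simp_all add: wick_sum_scale[symmetric] monomial_def[abs_def] mult_ac)

text \<open>The four equations are those that integration by parts yields for mixed Hermite moments;
  induction on the total degree shows that they have a single solution. \<open>f\<close> is
  arbitrary because both the joint moments and the products of moments of two pairs satisfy such
  equations, with different covariances.\<close>

lemma wick_sum_unique:
  fixes r12 r34 r13 r14 r23 r24 :: real and f :: "nat \<Rightarrow> nat \<Rightarrow> nat \<Rightarrow> nat \<Rightarrow> real"
  assumes f1: "\<And>a b c e. f (Suc a) b c e = real b * r12 * f a (b - 1) c e
      + real c * r13 * f a b (c - 1) e + real e * r14 * f a b c (e - 1)"
    and f2: "\<And>b c e. f 0 (Suc b) c e = real c * r23 * f 0 b (c - 1) e + real e * r24 * f 0 b c (e - 1)"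
    and f3: "\<And>c e. f 0 0 (Suc c) e = real e * r34 * f 0 0 c (e - 1)"
    and f4: "\<And>e. f 0 0 0 e = (if e = 0 then 1 else 0)"
  shows "f a b c e = wick_sum (monomial r12 r34 r13 r14 r23 r24) a b c e"
proof (induction "a + b + c + e" arbitrary: a b c e rule: less_induct)
  case less
  have IH: "real k * r * f a' b' c' e' = real k * (r * wick_sum (monomial r12 r34 r13 r14 r23 r24) a' b' c' e')"
    if "k = 0 \<or> a' + b' + c' + e' < a + b + c + e" for k r a' b' c' e'
    using that less by auto
  show ?case
  proof (cases a)
    case (Suc a')
    show ?thesis unfolding Suc f1 wick_sum.simps wick_sum_monomial_shift
      by (intro arg_cong2[where f="(+)"] IH) (auto simp: Suc)
  next
    case a: 0
    show ?thesis
    proof (cases b)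
      case (Suc b')
      show ?thesis unfolding a Suc f2 wick_sum.simps wick_sum_monomial_shift
        by (intro arg_cong2[where f="(+)"] IH) (auto simp: Suc a)
    next
      case b: 0
      show ?thesis
      proof (cases c)
        case (Suc c')
        show ?thesis unfolding a b Suc f3 wick_sum.simps wick_sum_monomial_shift
          by (intro IH) (auto simp: Suc a b)
      next
        case 0
        then show ?thesis by (simp add: a b f4 monomial_def)
      qed
    qed
  qed
qed

section \<open>Hermite moments of Gaussian families as Wick sums\<close>

context gaussian_family
begin

text \<open>In the derivative of \<open>hermite q (X i) * \<Phi>\<close> the term that
  differentiates \<open>hermite q\<close> carries the factor \<open>cov i i = 1\<close> and cancels
  against the second term in the recursion for \<open>hermite (Suc q)\<close>. Only the derivative
  of \<Phi> is left.\<close>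

lemma hermite_integration_by_parts:
  assumes \<Phi>[measurable]: "\<Phi> \<in> borel_measurable seq_space" and D[measurable]: "D \<in> borel_measurable seq_space"
    and deriv: "\<And>r t. ((\<lambda>s. \<Phi> (\<lambda>j. r j + cov i j * s)) has_real_derivative D (\<lambda>j. r j + cov i j * t)) (at t)"
    and cont: "\<And>r. continuous_on UNIV (\<lambda>t. D (\<lambda>j. r j + cov i j * t))"
    and m1: "all_moments M (\<lambda>\<omega>. \<Phi> (\<lambda>j. X j \<omega>))"
    and m2: "all_moments M (\<lambda>\<omega>. D (\<lambda>j. X j \<omega>))"
  shows "expectation (\<lambda>\<omega>. hermite (Suc q) (X i \<omega>) * \<Phi> (\<lambda>j. X j \<omega>)) =
    expectation (\<lambda>\<omega>. hermite q (X i \<omega>) * D (\<lambda>j. X j \<omega>))"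
proof -
  let ?\<Phi> = "\<lambda>x. hermite q (x i) * \<Phi> x"
  let ?D = "\<lambda>x. real q * hermite (q - 1) (x i) * \<Phi> x + hermite q (x i) * D x"
  have H: "all_moments M (\<lambda>\<omega>. hermite p (X i \<omega>))" for p
    by (intro all_moments_hermite X_all_moments)
  have a: "integrable M (\<lambda>\<omega>. X i \<omega> * (hermite q (X i \<omega>) * \<Phi> (\<lambda>j. X j \<omega>)))"
    "integrable M (\<lambda>\<omega>. real q * (hermite (q - 1) (X i \<omega>) * \<Phi> (\<lambda>j. X j \<omega>)))"
    "integrable M (\<lambda>\<omega>. hermite q (X i \<omega>) * D (\<lambda>j. X j \<omega>))"
    by (intro all_moments_integrable all_moments_mult all_moments_cmult X_all_moments H m1 m2)+
  have "expectation (\<lambda>\<omega>. X i \<omega> * ?\<Phi> (\<lambda>j. X j \<omega>)) = expectation (\<lambda>\<omega>. ?D (\<lambda>j. X j \<omega>))"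
  proof (rule gaussian_integration_by_parts)
    fix r :: "nat \<Rightarrow> real"
    show "((\<lambda>s. ?\<Phi> (\<lambda>j. r j + cov i j * s)) has_real_derivative ?D (\<lambda>j. r j + cov i j * t)) (at t)" for t
    proof -
      have "((\<lambda>s. hermite q (r i + cov i i * s)) has_real_derivative
          real q * hermite (q - 1) (r i + cov i i * t) * (cov i i)) (at t)"
        by (rule DERIV_chain2[OF hermite_has_derivative]) (auto intro!: derivative_eq_intros)
      from DERIV_mult[OF this deriv] show ?thesis
        by (rule DERIV_cong) (simp add: cov_self mult.commute)
    qed
    have "continuous_on UNIV (\<lambda>t. \<Phi> (\<lambda>j. r j + cov i j * t))"
      by (intro continuous_at_imp_continuous_on ballI DERIV_isCont[OF deriv])
    then show "continuous_on UNIV (\<lambda>t. ?D (\<lambda>j. r j + cov i j * t))"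
      by (intro continuous_intros cont)
  next
    show "integrable M (\<lambda>\<omega>. ?D (\<lambda>j. X j \<omega>))"
      using Bochner_Integration.integrable_add[OF a(2,3)] by (simp add: mult.assoc)
  qed (use a(1) in auto)
  also have "\<dots> = expectation (\<lambda>\<omega>. real q * (hermite (q - 1) (X i \<omega>) * \<Phi> (\<lambda>j. X j \<omega>)))
      + expectation (\<lambda>\<omega>. hermite q (X i \<omega>) * D (\<lambda>j. X j \<omega>))"
    using Bochner_Integration.integral_add[OF a(2,3)] by (simp add: mult.assoc)
  finally have e: "expectation (\<lambda>\<omega>. X i \<omega> * (hermite q (X i \<omega>) * \<Phi> (\<lambda>j. X j \<omega>))) = \<dots>" .
  have "expectation (\<lambda>\<omega>. hermite (Suc q) (X i \<omega>) * \<Phi> (\<lambda>j. X j \<omega>)) =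
    expectation (\<lambda>\<omega>. X i \<omega> * (hermite q (X i \<omega>) * \<Phi> (\<lambda>j. X j \<omega>)) - real q * (hermite (q - 1) (X i \<omega>) * \<Phi> (\<lambda>j. X j \<omega>)))"
    by (intro Bochner_Integration.integral_cong refl) (simp add: hermite_Suc algebra_simps)
  also have "\<dots> = expectation (\<lambda>\<omega>. hermite q (X i \<omega>) * D (\<lambda>j. X j \<omega>))"
    unfolding Bochner_Integration.integral_diff[OF a(1,2)] e by simp
  finally show ?thesis .
qed

definition herm4 :: "nat \<Rightarrow> nat \<Rightarrow> nat \<Rightarrow> nat \<Rightarrow> nat \<Rightarrow> nat \<Rightarrow> nat \<Rightarrow> nat \<Rightarrow> real" where
  "herm4 i j k l a b c e = expectation (\<lambda>\<omega>. hermite a (X i \<omega>) * (hermite b (X j \<omega>) * hermite c (X k \<omega>) * hermite e (X l \<omega>)))"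

lemma herm_all_moments: "all_moments M (\<lambda>\<omega>. hermite q (X i \<omega>))"
  by (intro all_moments_hermite X_all_moments)

lemma herm4_Suc:
  "herm4 i j k l (Suc a) b c e = real b * cov i j * herm4 i j k l a (b - 1) c e
     + real c * cov i k * herm4 i j k l a b (c - 1) e + real e * cov i l * herm4 i j k l a b c (e - 1)"
proof -
  let ?\<Phi> = "\<lambda>x. hermite b (x j) * hermite c (x k) * hermite e (x l)"
  let ?D = "\<lambda>x. real b * cov i j * (hermite (b - 1) (x j) * hermite c (x k) * hermite e (x l))
     + real c * cov i k * (hermite b (x j) * hermite (c - 1) (x k) * hermite e (x l))
     + real e * cov i l * (hermite b (x j) * hermite c (x k) * hermite (e - 1) (x l))"
  have "herm4 i j k l (Suc a) b c e = expectation (\<lambda>\<omega>. hermite a (X i \<omega>) * ?D (\<lambda>j. X j \<omega>))"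
    unfolding herm4_def
  proof (rule hermite_integration_by_parts[where \<Phi>="?\<Phi>"])
    fix r :: "nat \<Rightarrow> real"
    have h: "((\<lambda>s. hermite q (r m + cov i m * s)) has_real_derivative
          real q * hermite (q - 1) (r m + cov i m * t) * (cov i m)) (at t)" for q m t
      by (rule DERIV_chain2[OF hermite_has_derivative]) (auto intro!: derivative_eq_intros)
    show "((\<lambda>s. ?\<Phi> (\<lambda>j. r j + cov i j * s)) has_real_derivative ?D (\<lambda>j. r j + cov i j * t)) (at t)" for t
      by (rule DERIV_cong[OF DERIV_mult[OF DERIV_mult[OF h h] h]]) (simp add: algebra_simps)
    show "continuous_on UNIV (\<lambda>t. ?D (\<lambda>j. r j + cov i j * t))"
      by (intro continuous_intros)
  qed (auto intro!: all_moments_mult all_moments_add all_moments_cmult herm_all_moments)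
  also have "\<dots> = expectation (\<lambda>\<omega>. real b * cov i j * (hermite a (X i \<omega>) * (hermite (b - 1) (X j \<omega>) * hermite c (X k \<omega>) * hermite e (X l \<omega>)))
     + real c * cov i k * (hermite a (X i \<omega>) * (hermite b (X j \<omega>) * hermite (c - 1) (X k \<omega>) * hermite e (X l \<omega>)))
     + real e * cov i l * (hermite a (X i \<omega>) * (hermite b (X j \<omega>) * hermite c (X k \<omega>) * hermite (e - 1) (X l \<omega>))))"
    by (intro Bochner_Integration.integral_cong refl) (simp add: algebra_simps)
  also have "\<dots> = real b * cov i j * herm4 i j k l a (b - 1) c e
     + real c * cov i k * herm4 i j k l a b (c - 1) e + real e * cov i l * herm4 i j k l a b c (e - 1)"
    unfolding herm4_def
    by (subst Bochner_Integration.integral_add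
        | (intro Bochner_Integration.integrable_add all_moments_integrable all_moments_mult all_moments_cmult herm_all_moments; fail) | simp)+
  finally show ?thesis .
qed

lemma herm4_swap12: "herm4 i j k l a b c e = herm4 j i k l b a c e"
  by (simp add: herm4_def mult_ac)

lemma herm4_swap23: "herm4 i j k l a b c e = herm4 i k j l a c b e"
  by (simp add: herm4_def mult_ac)

lemma herm4_swap34: "herm4 i j k l a b c e = herm4 i j l k a b e c"
  by (simp add: herm4_def mult_ac)

text \<open>The empty first block is exchanged with the second by symmetry, so that
  \<open>herm4_Suc\<close> applies again.\<close>

lemma herm4_Suc2: "herm4 i j k l 0 (Suc b) c e =
    real c * cov j k * herm4 i j k l 0 b (c - 1) e + real e * cov j l * herm4 i j k l 0 b c (e - 1)"
  using herm4_Suc[of j i k l b 0 c e] by (simp add: herm4_swap12[of i j])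

lemma herm4_Suc3: "herm4 i j k l 0 0 (Suc c) e = real e * cov k l * herm4 i j k l 0 0 c (e - 1)"
  using herm4_Suc2[of i k j l c 0 e] by (simp add: herm4_swap23[of i j k l])

lemma herm4_Suc4: "herm4 i j k l 0 0 0 e = (if e = 0 then 1 else 0)"
proof (cases e)
  case 0 then show ?thesis by (simp add: herm4_def hermite_0 prob_space)
next
  case (Suc e') then show ?thesis using herm4_Suc3[of i j l k e' 0] by (simp add: herm4_swap34[of i j k l])
qed

lemma herm4_eq_wick_sum:
  "herm4 i j k l a b c e =
     wick_sum (monomial (cov i j) (cov k l) (cov i k) (cov i l) (cov j k) (cov j l)) a b c e"
  by (rule wick_sum_unique) (rule herm4_Suc herm4_Suc2 herm4_Suc3 herm4_Suc4)+

text \<open>The product of the moments of the two pairs is the joint moment as if the pairs were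
  independent: the same sum with the four cross covariances set to 0.\<close>

lemma herm4_product_eq_wick_sum:
  "herm4 i j k l a b 0 0 * herm4 i j k l 0 0 c e =
     wick_sum (monomial (cov i j) (cov k l) 0 0 0 0) a b c e"
  by (rule wick_sum_unique[where f="\<lambda>a b c e. herm4 i j k l a b 0 0 * herm4 i j k l 0 0 c e"])
     (simp_all add: herm4_Suc herm4_Suc2 herm4_Suc3 herm4_Suc4 algebra_simps)

text \<open>Subtracting the product removes exactly the diagrams without cross edges. Every other
  monomial is at most \<open>K\<close>, and the number of pairings is the mixed moment of a single
  variable, where all covariances are 1.\<close>

lemma herm4_covariance_bound:
  assumes K: "\<And>u v A B C D. u + A + B = a \<Longrightarrow> u + C + D = b \<Longrightarrow> v + A + C = c \<Longrightarrow> v + B + D = e \<Longrightarrow>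
     0 < A + B + C + D \<Longrightarrow>
     \<bar>monomial (cov i j) (cov k l) (cov i k) (cov i l) (cov j k) (cov j l) u v A B C D\<bar> \<le> K"
    and K0: "0 \<le> K"
  shows "\<bar>herm4 i j k l a b c e - herm4 i j k l a b 0 0 * herm4 i j k l 0 0 c e\<bar> \<le> K * herm4 n n n n a b c e"
proof -
  have "\<bar>herm4 i j k l a b c e - herm4 i j k l a b 0 0 * herm4 i j k l 0 0 c e\<bar>
    \<le> wick_sum (\<lambda>u v A B C D. K * monomial (cov n n) (cov n n) (cov n n) (cov n n) (cov n n) (cov n n) u v A B C D) a b c e"
    unfolding herm4_eq_wick_sum[of i j k l a b c e] herm4_product_eq_wick_sum[of i j k l a b c e] wick_sum_diff[symmetric]
  proof (rule wick_sum_abs_le)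
    fix u v A B C D
    assume s: "u + A + B = a" "u + C + D = b" "v + A + C = c" "v + B + D = e"
    \<comment> \<open>Without cross edges both monomials agree, as \<open>0 ^ 0 = 1\<close>; with a
      cross edge the second one is 0.\<close>
    have "monomial (cov i j) (cov k l) (cov i k) (cov i l) (cov j k) (cov j l) u v A B C D =
       monomial (cov i j) (cov k l) 0 0 0 0 u v A B C D" if "A + B + C + D = 0"
      using that by (simp add: monomial_def)
    moreover have "monomial (cov i j) (cov k l) 0 0 0 0 u v A B C D = 0" if "A + B + C + D > 0"
      using that by (auto simp: monomial_def)
    ultimately show "\<bar>monomial (cov i j) (cov k l) (cov i k) (cov i l) (cov j k) (cov j l) u v A B C D -
        monomial (cov i j) (cov k l) 0 0 0 0 u v A B C D\<bar>
        \<le> K * monomial (cov n n) (cov n n) (cov n n) (cov n n) (cov n n) (cov n n) u v A B C D"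
      using K[OF s] K0 by (cases "A + B + C + D = 0") (simp_all add: cov_self monomial_def[of 1])
  qed
  then show ?thesis by (simp add: wick_sum_scale herm4_eq_wick_sum)
qed

text \<open>All monomials equal 1 here, so the moment counts pairings.\<close>

lemma herm4_diagonal_nonneg: "0 \<le> herm4 n n n n a b c e"
proof -
  have "wick_sum (\<lambda>u v A B C D. 0 * monomial 1 1 1 1 1 1 u v A B C D) a b c e \<le> wick_sum (monomial 1 1 1 1 1 1) a b c e"
    by (rule wick_sum_mono) (simp add: monomial_def)
  then show ?thesis
    unfolding herm4_eq_wick_sum cov_self wick_sum_scale by simp
qed

lemma expectation_hermite_mult:
  "expectation (\<lambda>\<omega>. hermite a (X i \<omega>) * hermite b (X j \<omega>)) = (if a = b then fact a * cov i j ^ a else 0)"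
proof -
  have "herm4 i j i j a b 0 0 = (if a = b then fact a * cov i j ^ a else 0)"
  proof (induction a arbitrary: b)
    case 0 then show ?case by (cases b) (simp_all add: herm4_Suc4 herm4_Suc2)
  next
    case (Suc a)
    then show ?case by (cases b) (simp_all add: herm4_Suc algebra_simps)
  qed
  then show ?thesis by (simp add: herm4_def hermite_0)
qed

end

section \<open>Weak derivatives and Hermite coefficients\<close>

text \<open>Derivatives appear as existential witnesses, so that the sum, product and affine rules
  follow by induction on n without computing \<open>deriv\<close>.
  \<open>differentiable_upto_funpow_deriv\<close> translates back to the form required by
  \<open>test_function\<close>.\<close>

fun differentiable_upto :: "nat \<Rightarrow> (real \<Rightarrow> real) \<Rightarrow> bool" where
  "differentiable_upto 0 f \<longleftrightarrow> True"
| "differentiable_upto (Suc n) f \<longleftrightarrow>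
     (\<exists>f'. (\<forall>x. (f has_real_derivative f' x) (at x)) \<and> differentiable_upto n f')"

lemma differentiable_upto_SucD: "differentiable_upto (Suc n) f \<Longrightarrow> differentiable_upto n f"
proof (induction n arbitrary: f)
  case (Suc n)
  from Suc.prems obtain f' where "\<And>x. (f has_real_derivative f' x) (at x)" "differentiable_upto (Suc n) f'"
    unfolding differentiable_upto.simps(2)[of "Suc n"] by blast
  with Suc.IH[of f'] show ?case unfolding differentiable_upto.simps(2)[of n f] by blast
qed simp

lemma differentiable_upto_SucI:
  "(\<And>x. (f has_real_derivative f' x) (at x)) \<Longrightarrow> differentiable_upto n f' \<Longrightarrow> differentiable_upto (Suc n) f"
  unfolding differentiable_upto.simps(2) by blast

lemma differentiable_upto_const: "differentiable_upto n (\<lambda>_. c)"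
proof (induction n arbitrary: c)
  case (Suc n)
  show ?case by (rule differentiable_upto_SucI[OF DERIV_const Suc])
qed simp

lemma differentiable_upto_add:
  "differentiable_upto n f \<Longrightarrow> differentiable_upto n g \<Longrightarrow> differentiable_upto n (\<lambda>x. f x + g x)"
proof (induction n arbitrary: f g)
  case (Suc n)
  then obtain f' g' where "\<And>x. (f has_real_derivative f' x) (at x)" "differentiable_upto n f'"
    "\<And>x. (g has_real_derivative g' x) (at x)" "differentiable_upto n g'" by auto
  then show ?case by (intro differentiable_upto_SucI[OF DERIV_add Suc.IH])
qed simp

lemma differentiable_upto_mult:
  "differentiable_upto n f \<Longrightarrow> differentiable_upto n g \<Longrightarrow> differentiable_upto n (\<lambda>x. f x * g x)"
proof (induction n arbitrary: f g)
  case (Suc n)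
  then obtain f' g' where d: "\<And>x. (f has_real_derivative f' x) (at x)" "differentiable_upto n f'"
    "\<And>x. (g has_real_derivative g' x) (at x)" "differentiable_upto n g'" by auto
  have "differentiable_upto n (\<lambda>x. f' x * g x + g' x * f x)"
    by (intro differentiable_upto_add Suc.IH d Suc.prems[THEN differentiable_upto_SucD])
  with DERIV_mult[OF d(1,3)] show ?case by (rule differentiable_upto_SucI)
qed simp

lemma differentiable_upto_affine:
  "differentiable_upto n f \<Longrightarrow> differentiable_upto n (\<lambda>x. f (a + b * x))"
proof (induction n arbitrary: f)
  case (Suc n)
  then obtain f' where d: "\<And>x. (f has_real_derivative f' x) (at x)" "differentiable_upto n f'" by auto
  have "((\<lambda>x. f (a + b * x)) has_real_derivative f' (a + b * x) * b) (at x)" for x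
    by (rule DERIV_chain2[OF d(1)]) (auto intro!: derivative_eq_intros)
  moreover have "differentiable_upto n (\<lambda>x. f' (a + b * x) * b)"
    by (intro differentiable_upto_mult differentiable_upto_const Suc.IH d)
  ultimately show ?case by (rule differentiable_upto_SucI)
qed simp

lemma differentiable_upto_funpow_deriv:
  "differentiable_upto (Suc n) f \<Longrightarrow> (deriv ^^ n) f differentiable (at x)"
proof (induction n arbitrary: f)
  case 0 then show ?case by (auto simp: real_differentiable_def)
next
  case (Suc n)
  then obtain f' where d: "\<And>x. (f has_real_derivative f' x) (at x)" "differentiable_upto (Suc n) f'" by auto
  have "deriv f = f'" using d by (auto intro!: DERIV_imp_deriv)
  then show ?case using Suc.IH[OF d(2)] by (simp add: funpow_swap1)
qed

section \<open>A smooth function with compact support\<close>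

text \<open>For k = 0 this is the classical function that is flat at 0. The powers of
  \<open>1 / x\<close> are included because the derivative of each member is a combination of
  members with larger k, which makes smoothness an induction.\<close>

definition flat_exp :: "nat \<Rightarrow> real \<Rightarrow> real" where
  "flat_exp k x = (if x > 0 then (1 / x) ^ k * exp (- (1 / x)) else 0)"

lemma flat_exp_has_derivative: "(flat_exp k has_real_derivative (flat_exp (k + 2) x - real k * flat_exp (k + 1) x)) (at x)"
proof -
  consider "x > 0" | "x < 0" | "x = 0" by linarith
  then show ?thesis
  proof cases
    case 1
    have "((\<lambda>x. (1 / x) ^ k * exp (- (1 / x))) has_real_derivative
       ((1 / x) ^ (k + 2) * exp (- (1 / x)) - real k * ((1 / x) ^ (k + 1) * exp (- (1 / x))))) (at x)"
    proof -
      have F: "((\<lambda>t. t ^ k * exp (- t)) has_real_derivative real k * t ^ (k - 1) * exp (- t) - t ^ k * exp (- t)) (at t)" for t :: real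
        by (auto intro!: derivative_eq_intros)
      have q: "((\<lambda>x. 1 / x) has_real_derivative - ((1 / x) ^ 2)) (at x)"
        using 1 by (auto intro!: derivative_eq_intros simp: power2_eq_square)
      have e: "(real k * t ^ (k - 1) * exp (- t) - t ^ k * exp (- t)) * - (t ^ 2) =
        t ^ (k + 2) * exp (- t) - real k * (t ^ (k + 1) * exp (- t))" for t :: real
        by (cases k) (simp_all add: power2_eq_square algebra_simps)
      show ?thesis
        by (rule DERIV_cong[OF DERIV_chain2[OF F q] e])
    qed
    then have "((\<lambda>x. (1 / x) ^ k * exp (- (1 / x))) has_real_derivative
       (flat_exp (k + 2) x - real k * flat_exp (k + 1) x)) (at x)" using 1 by (simp add: flat_exp_def)
    then show ?thesis
      by (rule has_field_derivative_transform_within_open[where S="{0<..}"]) (use 1 in \<open>auto simp: flat_exp_def\<close>)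
  next
    case 2
    have "((\<lambda>_. 0) has_real_derivative 0) (at x)" by simp
    then have "(flat_exp k has_real_derivative 0) (at x)"
      by (rule has_field_derivative_transform_within_open[where S="{..<0}"]) (use 2 in \<open>auto simp: flat_exp_def\<close>)
    then show ?thesis using 2 by (simp add: flat_exp_def)
  next
    case 3
    \<comment> \<open>With t = 1 / h the quotient is \<open>t ^ (k + 1) / exp t\<close>, and t tends
      to infinity.\<close>
    have "((\<lambda>h. flat_exp k h / h) \<longlongrightarrow> 0) (at_right 0)"
    proof -
      have "((\<lambda>h::real. (inverse h) ^ (k + 1) / exp (inverse h)) \<longlongrightarrow> 0) (at_right 0)"
        by (rule filterlim_compose[OF tendsto_power_div_exp_0 filterlim_inverse_at_top_right])
      moreover have "\<forall>\<^sub>F h in at_right 0. (inverse h) ^ (k + 1) / exp (inverse h) = flat_exp k h / h"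
        using eventually_at_right_less[of 0]
        by eventually_elim (simp add: flat_exp_def exp_minus field_simps)
      ultimately show ?thesis by (rule Lim_transform_eventually)
    qed
    moreover have "((\<lambda>h. flat_exp k h / h) \<longlongrightarrow> 0) (at_left 0)"
      by (rule tendsto_eventually) (auto simp: flat_exp_def eventually_at_left_field intro!: exI[of _ "-1"])
    ultimately have "((\<lambda>h. flat_exp k h / h) \<longlongrightarrow> 0) (at 0)"
      by (rule filterlim_split_at[rotated])
    then have "(flat_exp k has_real_derivative 0) (at 0)"
      unfolding DERIV_def by (simp add: flat_exp_def)
    then show ?thesis using 3 by (simp add: flat_exp_def)
  qed
qed

lemma differentiable_upto_flat_exp: "differentiable_upto n (flat_exp k)"
proof (induction n arbitrary: k)
  case (Suc n)
  have "differentiable_upto n (\<lambda>x. flat_exp (k + 2) x + (- real k) * flat_exp (k + 1) x)"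
    by (intro differentiable_upto_add differentiable_upto_mult differentiable_upto_const Suc)
  then show ?case using flat_exp_has_derivative[of k]
    by (intro differentiable_upto_SucI[where f'="\<lambda>x. flat_exp (k + 2) x + (- real k) * flat_exp (k + 1) x"]) auto
qed simp

lemma flat_exp_0_bounds: "0 \<le> flat_exp 0 x" "flat_exp 0 x \<le> 1"
  by (auto simp: flat_exp_def)

text \<open>The constant 2 comes from \<open>t\<^sup>2 / 2 \<le> exp t\<close> at t = 1 / x.\<close>

lemma flat_exp_2_bounds: "0 \<le> flat_exp 2 x" "flat_exp 2 x \<le> 2"
proof -
  show "0 \<le> flat_exp 2 x" by (simp add: flat_exp_def)
  show "flat_exp 2 x \<le> 2"
  proof (cases "x > 0")
    case True
    then have "1 + 1 / x + (1 / x)\<^sup>2 / 2 \<le> exp (1 / x)" by (intro exp_lower_Taylor_quadratic) auto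
    moreover have "0 < 1 / x" using True by simp
    ultimately have "(1 / x)\<^sup>2 \<le> 2 * exp (1 / x)" by linarith
    then have "(1 / x)\<^sup>2 * exp (- (1 / x)) \<le> 2 * exp (1 / x) * exp (- (1 / x))" by (intro mult_right_mono) auto
    also have "\<dots> = 2" by (simp add: mult.assoc flip: exp_add)
    finally show ?thesis using True by (simp add: flat_exp_def)
  qed (simp add: flat_exp_def)
qed

text \<open>The factor \<open>exp 2\<close> normalizes the value at 0 to 1, as
  \<open>flat_exp 0 1\<close> is \<open>exp (- 1)\<close>. The arguments are written in the form
  \<open>a + b * x\<close> of \<open>differentiable_upto_affine\<close>.\<close>

definition bump :: "real \<Rightarrow> real" where
  "bump x = exp 2 * (flat_exp 0 (1 + (-1) * x) * flat_exp 0 (1 + 1 * x))"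

definition bump' :: "real \<Rightarrow> real" where
  "bump' x = exp 2 * (flat_exp 0 (1 - x) * flat_exp 2 (1 + x) - flat_exp 2 (1 - x) * flat_exp 0 (1 + x))"

lemma bump_0: "bump 0 = 1"
  by (simp add: bump_def flat_exp_def flip: exp_add)

lemma bump_outside: "1 \<le> \<bar>x\<bar> \<Longrightarrow> bump x = 0"
  by (auto simp: bump_def flat_exp_def)

lemma differentiable_upto_bump: "differentiable_upto n bump"
  unfolding bump_def[abs_def]
  by (rule differentiable_upto_mult[OF differentiable_upto_const
        differentiable_upto_mult[OF differentiable_upto_affine differentiable_upto_affine],
        OF differentiable_upto_flat_exp differentiable_upto_flat_exp])

lemma bump_has_derivative: "(bump has_real_derivative bump' x) (at x)"
proof -
  have f: "(flat_exp 0 has_real_derivative flat_exp 2 x) (at x)" for x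
    using flat_exp_has_derivative[of 0 x] by (simp add: numeral_2_eq_2)
  have 1: "((\<lambda>x. flat_exp 0 (1 + (-1) * x)) has_real_derivative flat_exp 2 (1 + (-1) * x) * (-1)) (at x)"
    by (rule DERIV_chain2[OF f]) (auto intro!: derivative_eq_intros)
  have 2: "((\<lambda>x. flat_exp 0 (1 + 1 * x)) has_real_derivative flat_exp 2 (1 + 1 * x) * 1) (at x)"
    by (rule DERIV_chain2[OF f]) (auto intro!: derivative_eq_intros)
  show ?thesis unfolding bump_def[abs_def]
    by (rule DERIV_cong[OF DERIV_cmult[OF DERIV_mult[OF 1 2]]]) (simp add: bump'_def algebra_simps)
qed

lemma bump_bounds: "\<bar>bump x\<bar> \<le> exp 2" "\<bar>bump' x\<bar> \<le> 4 * exp 2"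
proof -
  have "\<bar>flat_exp 0 (1 + (-1) * x) * flat_exp 0 (1 + 1 * x)\<bar> \<le> 1 * 1"
    unfolding abs_mult by (intro mult_mono) (auto simp: flat_exp_0_bounds)
  then show "\<bar>bump x\<bar> \<le> exp 2" by (simp add: bump_def abs_mult)
  have "\<bar>flat_exp 0 (1 - x) * flat_exp 2 (1 + x)\<bar> \<le> 1 * 2" "\<bar>flat_exp 2 (1 - x) * flat_exp 0 (1 + x)\<bar> \<le> 2 * 1"
    unfolding abs_mult by (intro mult_mono; auto simp: flat_exp_0_bounds flat_exp_2_bounds)+
  then have "\<bar>flat_exp 0 (1 - x) * flat_exp 2 (1 + x) - flat_exp 2 (1 - x) * flat_exp 0 (1 + x)\<bar> \<le> 4" by linarith
  then show "\<bar>bump' x\<bar> \<le> 4 * exp 2" by (simp add: bump'_def abs_mult)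
qed

lemma differentiable_upto_hermite: "differentiable_upto n (hermite q)"
proof (induction n arbitrary: q)
  case (Suc n)
  show ?case
    by (rule differentiable_upto_SucI[OF hermite_has_derivative])
       (intro differentiable_upto_mult differentiable_upto_const Suc)
qed simp

lemma differentiable_upto_std_normal_density: "differentiable_upto n std_normal_density"
proof (induction n)
  case (Suc n)
  have "differentiable_upto n (\<lambda>x. 0 + (-1) * x)"
  proof (cases n)
    case (Suc m)
    have "((\<lambda>x::real. 0 + (-1) * x) has_real_derivative -1) (at x)" for x by (auto intro!: derivative_eq_intros)
    from differentiable_upto_SucI[OF this differentiable_upto_const] show ?thesis unfolding Suc .
  qed simp
  from differentiable_upto_mult[OF this Suc] have "differentiable_upto n (\<lambda>x. - x * std_normal_density x)"
    by simp
  then show ?case by (rule differentiable_upto_SucI[OF std_normal_density_has_derivative])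
qed simp

section \<open>Weak derivatives tested against Hermite polynomials\<close>

text \<open>Testing against a Hermite polynomial times the normal density produces Hermite
  coefficients, but that function does not have compact support; the rescaled bump confines it to
  [-R, R].\<close>

lemma hermite_gauss_test_function:
  fixes R :: real
  assumes "R > 0"
  shows "test_function (\<lambda>x. hermite q x * std_normal_density x * bump (0 + (1 / R) * x))"
  unfolding test_function_def
proof (intro conjI allI)
  fix n x
  show "(deriv ^^ n) (\<lambda>x. hermite q x * std_normal_density x * bump (0 + (1 / R) * x)) differentiable (at x)"
    by (rule differentiable_upto_funpow_deriv[OF differentiable_upto_mult[OF
          differentiable_upto_mult[OF differentiable_upto_hermite differentiable_upto_std_normal_density]
          differentiable_upto_affine[OF differentiable_upto_bump]]])
next
  have "{x. hermite q x * std_normal_density x * bump (0 + (1 / R) * x) \<noteq> 0} \<subseteq> {-R..R}"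
  proof
    fix x assume "x \<in> {x. hermite q x * std_normal_density x * bump (0 + (1 / R) * x) \<noteq> 0}"
    then have "bump (x / R) \<noteq> 0" by simp
    then have "\<not> 1 \<le> \<bar>x / R\<bar>" using bump_outside by blast
    then have "\<bar>x\<bar> < R" using assms by (simp add: abs_divide)
    then show "x \<in> {-R..R}" by auto
  qed
  then have "bounded {x. hermite q x * std_normal_density x * bump (0 + (1 / R) * x) \<noteq> 0}"
    using bounded_subset bounded_closed_interval by metis
  then show "compact (closure {x. hermite q x * std_normal_density x * bump (0 + (1 / R) * x) \<noteq> 0})"
    by (simp add: compact_closure)
qed

lemma gamma_X_all_moments: "all_moments std_normal_distribution (\<lambda>x. x)"
  unfolding all_moments_def
  by (auto, subst integrable_density, auto intro!: AE_I2 integrable_std_normal_moment_abs)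

lemma gamma_hermite_all_moments: "all_moments std_normal_distribution (hermite q)"
  using gamma.all_moments_hermite[OF gamma_X_all_moments, of q] by simp

lemma gamma_integral: "f \<in> borel_measurable borel \<Longrightarrow>
    (\<integral>x. f x \<partial>std_normal_distribution) = (\<integral>x. std_normal_density x * f x \<partial>lborel)"
  for f :: "real \<Rightarrow> real"
  by (subst integral_density) auto

lemma integrable_mult_square:
  fixes f g :: "'a \<Rightarrow> real"
  assumes [measurable]: "f \<in> borel_measurable M" "g \<in> borel_measurable M"
    and "integrable M (\<lambda>x. (f x)\<^sup>2)" "integrable M (\<lambda>x. (g x)\<^sup>2)"
  shows "integrable M (\<lambda>x. f x * g x)"
proof (rule Bochner_Integration.integrable_bound[where f="\<lambda>x. (f x)\<^sup>2 + (g x)\<^sup>2"])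
  show "AE x in M. norm (f x * g x) \<le> norm ((f x)\<^sup>2 + (g x)\<^sup>2)"
  proof (rule AE_I2)
    fix x
    have "2 * (\<bar>f x\<bar> * \<bar>g x\<bar>) \<le> (f x)\<^sup>2 + (g x)\<^sup>2"
      using sum_squares_bound[of "\<bar>f x\<bar>" "\<bar>g x\<bar>"] by simp
    moreover have "0 \<le> \<bar>f x\<bar> * \<bar>g x\<bar>" by simp
    ultimately have "\<bar>f x\<bar> * \<bar>g x\<bar> \<le> (f x)\<^sup>2 + (g x)\<^sup>2" by linarith
    then show "norm (f x * g x) \<le> norm ((f x)\<^sup>2 + (g x)\<^sup>2)" by (simp add: abs_mult)
  qed
qed (use assms in auto)

text \<open>By the recursion, \<open>hermite q\<close> times the density has derivative
  \<open>- hermite (Suc q)\<close> times the density. The identity is therefore the definition of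
  the weak derivative for this function, once the cutoff has been removed by dominated
  convergence.\<close>

lemma weak_derivative_hermite:
  assumes wd: "weak_derivative f f'"
    and [measurable]: "f \<in> borel_measurable borel" "f' \<in> borel_measurable borel"
    and f2: "integrable std_normal_distribution (\<lambda>x. (f x)\<^sup>2)"
    and f'2: "integrable std_normal_distribution (\<lambda>x. (f' x)\<^sup>2)"
  shows "(\<integral>x. f' x * hermite q x \<partial>std_normal_distribution) =
     (\<integral>x. f x * hermite (Suc q) x \<partial>std_normal_distribution)"
proof -
  let ?\<gamma> = "std_normal_distribution" and ?\<phi> = "std_normal_density"
  have h2: "integrable ?\<gamma> (\<lambda>x. (hermite q x)\<^sup>2)" for q
    by (intro all_moments_integrable gamma.all_moments_power gamma_hermite_all_moments)
  have [measurable]: "bump \<in> borel_measurable borel"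
    by (intro borel_measurable_continuous_onI continuous_at_imp_continuous_on ballI DERIV_isCont[OF bump_has_derivative])
  have cf: "isCont (flat_exp k) x" for k x by (rule DERIV_isCont[OF flat_exp_has_derivative])
  have [measurable]: "flat_exp k \<in> borel_measurable borel" for k
    by (intro borel_measurable_continuous_onI continuous_at_imp_continuous_on ballI cf)
  have [measurable]: "bump' \<in> borel_measurable borel"
    unfolding bump'_def[abs_def] by measurable
  have i1: "integrable ?\<gamma> (\<lambda>x. f x * hermite q x)" for q
    by (rule integrable_mult_square[OF _ _ f2 h2]) auto
  have i2: "integrable ?\<gamma> (\<lambda>x. f' x * hermite q x)" for q
    by (rule integrable_mult_square[OF _ _ f'2 h2]) auto
  let ?r = "\<lambda>n. 1 / real (Suc n)"
  have r0: "?r \<longlonglongrightarrow> 0" by (rule LIMSEQ_Suc[OF lim_const_over_n])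
  have c0: "isCont bump 0" by (rule DERIV_isCont[OF bump_has_derivative])
  have bl: "(\<lambda>n. bump (?r n * x)) \<longlonglongrightarrow> 1" for x
  proof -
    have "(\<lambda>n. ?r n * x) \<longlonglongrightarrow> 0 * x" by (intro tendsto_intros r0)
    then have "(\<lambda>n. bump (?r n * x)) \<longlonglongrightarrow> bump 0" by (intro isCont_tendsto_compose[OF c0]) simp
    then show ?thesis by (simp add: bump_0)
  qed
  \<comment> \<open>The cutoff is at R = n + 1. Differentiating the bump produces a factor 1 / R, so
    that term vanishes in the limit.\<close>
  have eq: "(\<integral>x. f x * (- hermite (Suc q) x * bump (?r n * x) + hermite q x * bump' (?r n * x) * ?r n) \<partial>?\<gamma>)
      = - (\<integral>x. f' x * hermite q x * bump (?r n * x) \<partial>?\<gamma>)" for n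
  proof -
    let ?t = "\<lambda>x. hermite q x * ?\<phi> x * bump (0 + (1 / real (Suc n)) * x)"
    have "test_function ?t" by (rule hermite_gauss_test_function) simp
    then have e: "(\<integral>x. f x * deriv ?t x \<partial>lborel) = - (\<integral>x. f' x * ?t x \<partial>lborel)"
      using wd unfolding weak_derivative_def by blast
    have d: "deriv ?t x = ?\<phi> x * (- hermite (Suc q) x * bump (?r n * x) + hermite q x * bump' (?r n * x) * ?r n)" for x
    proof (rule DERIV_imp_deriv)
      have b: "((\<lambda>x. bump (0 + (1 / real (Suc n)) * x)) has_real_derivative bump' (0 + (1 / real (Suc n)) * x) * (1 / real (Suc n))) (at x)"
      proof (rule DERIV_chain2[OF bump_has_derivative])
        show "((\<lambda>x. 0 + (1 / real (Suc n)) * x) has_real_derivative 1 / real (Suc n)) (at x)"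
          using DERIV_cmult[OF DERIV_ident, of "1 / real (Suc n)" x UNIV] by (simp del: of_nat_Suc)
      qed
      show "(?t has_real_derivative ?\<phi> x * (- hermite (Suc q) x * bump (?r n * x) + hermite q x * bump' (?r n * x) * ?r n)) (at x)"
        by (rule DERIV_cong[OF DERIV_mult[OF DERIV_mult[OF hermite_has_derivative std_normal_density_has_derivative] b]])
           (simp add: hermite_Suc algebra_simps del: of_nat_Suc)
    qed
    have "(\<integral>x. f x * deriv ?t x \<partial>lborel) = (\<integral>x. f x * (- hermite (Suc q) x * bump (?r n * x) + hermite q x * bump' (?r n * x) * ?r n) \<partial>?\<gamma>)"
      unfolding d by (subst gamma_integral) (auto simp: mult_ac simp del: of_nat_Suc)
    moreover have "(\<integral>x. f' x * ?t x \<partial>lborel) = (\<integral>x. f' x * hermite q x * bump (?r n * x) \<partial>?\<gamma>)"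
      by (subst gamma_integral) (auto simp: mult_ac simp del: of_nat_Suc)
    ultimately show ?thesis using e by (simp only:)
  qed
  have "(\<lambda>n. \<integral>x. f x * (- hermite (Suc q) x * bump (?r n * x) + hermite q x * bump' (?r n * x) * ?r n) \<partial>?\<gamma>)
     \<longlonglongrightarrow> (\<integral>x. f x * (- hermite (Suc q) x) \<partial>?\<gamma>)"
  proof (rule integral_dominated_convergence[where w="\<lambda>x. exp 2 * \<bar>f x * hermite (Suc q) x\<bar> + (4 * exp 2) * \<bar>f x * hermite q x\<bar>"])
    show "integrable ?\<gamma> (\<lambda>x. exp 2 * \<bar>f x * hermite (Suc q) x\<bar> + (4 * exp 2) * \<bar>f x * hermite q x\<bar>)"
      by (intro Bochner_Integration.integrable_add integrable_mult_right integrable_abs i1)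
    show "AE x in ?\<gamma>. (\<lambda>n. f x * (- hermite (Suc q) x * bump (?r n * x) + hermite q x * bump' (?r n * x) * ?r n))
        \<longlonglongrightarrow> f x * (- hermite (Suc q) x)"
    proof (rule AE_I2)
      fix x
      have "(\<lambda>n. bump' (?r n * x) * ?r n) \<longlonglongrightarrow> 0"
      proof (rule Lim_null_comparison)
        show "\<forall>\<^sub>F n in sequentially. norm (bump' (?r n * x) * ?r n) \<le> 4 * exp 2 * ?r n"
          by (intro always_eventually allI) (simp add: abs_mult mult_right_mono bump_bounds(2) divide_right_mono)
        show "(\<lambda>n. 4 * exp 2 * ?r n) \<longlonglongrightarrow> 0" using tendsto_mult_left[OF r0, of "4 * exp 2"] by simp
      qed
      then have "(\<lambda>n. f x * (- hermite (Suc q) x * bump (?r n * x) + hermite q x * (bump' (?r n * x) * ?r n)))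
         \<longlonglongrightarrow> f x * (- hermite (Suc q) x * 1 + hermite q x * 0)"
        by (intro tendsto_intros bl)
      then show "(\<lambda>n. f x * (- hermite (Suc q) x * bump (?r n * x) + hermite q x * bump' (?r n * x) * ?r n))
        \<longlonglongrightarrow> f x * (- hermite (Suc q) x)" by (simp only: mult.assoc mult_1_right mult_zero_right add_0_right)
    qed
    fix n
    show "AE x in ?\<gamma>. norm (f x * (- hermite (Suc q) x * bump (?r n * x) + hermite q x * bump' (?r n * x) * ?r n))
       \<le> exp 2 * \<bar>f x * hermite (Suc q) x\<bar> + (4 * exp 2) * \<bar>f x * hermite q x\<bar>"
    proof (rule AE_I2)
      fix x
      have "\<bar>f x * (- hermite (Suc q) x * bump (?r n * x) + hermite q x * bump' (?r n * x) * ?r n)\<bar> =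
        \<bar>- (bump (?r n * x) * (f x * hermite (Suc q) x)) + (bump' (?r n * x) * ?r n) * (f x * hermite q x)\<bar>"
        by (intro arg_cong[where f=abs]) (simp add: distrib_left right_diff_distrib mult_ac del: of_nat_Suc)
      also have "\<dots> \<le> \<bar>bump (?r n * x)\<bar> * \<bar>f x * hermite (Suc q) x\<bar> + \<bar>bump' (?r n * x) * ?r n\<bar> * \<bar>f x * hermite q x\<bar>"
        by (rule order_trans[OF abs_triangle_ineq]) (simp add: abs_mult del: of_nat_Suc)
      also have "\<dots> \<le> exp 2 * \<bar>f x * hermite (Suc q) x\<bar> + (4 * exp 2) * \<bar>f x * hermite q x\<bar>"
      proof (intro add_mono mult_right_mono bump_bounds)
        have "\<bar>bump' (?r n * x)\<bar> * \<bar>?r n\<bar> \<le> 4 * exp 2 * 1"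
          by (intro mult_mono bump_bounds) auto
        then show "\<bar>bump' (?r n * x) * ?r n\<bar> \<le> 4 * exp 2" by (simp only: abs_mult mult_1_right)
      qed auto
      finally show "norm (f x * (- hermite (Suc q) x * bump (?r n * x) + hermite q x * bump' (?r n * x) * ?r n))
       \<le> exp 2 * \<bar>f x * hermite (Suc q) x\<bar> + (4 * exp 2) * \<bar>f x * hermite q x\<bar>" by (simp only: real_norm_def)
    qed
  qed auto
  moreover have "(\<lambda>n. - (\<integral>x. f' x * hermite q x * bump (?r n * x) \<partial>?\<gamma>)) \<longlonglongrightarrow> - (\<integral>x. f' x * hermite q x * 1 \<partial>?\<gamma>)"
  proof (intro tendsto_minus integral_dominated_convergence[where w="\<lambda>x. exp 2 * \<bar>f' x * hermite q x\<bar>"])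
    show "integrable ?\<gamma> (\<lambda>x. exp 2 * \<bar>f' x * hermite q x\<bar>)"
      by (intro integrable_mult_right integrable_abs i2)
    show "AE x in ?\<gamma>. (\<lambda>n. f' x * hermite q x * bump (?r n * x)) \<longlonglongrightarrow> f' x * hermite q x * 1"
      by (intro AE_I2 tendsto_intros bl)
    show "AE x in ?\<gamma>. norm (f' x * hermite q x * bump (?r n * x)) \<le> exp 2 * \<bar>f' x * hermite q x\<bar>" for n
    proof (rule AE_I2)
      fix x
      have "\<bar>f' x * hermite q x\<bar> * \<bar>bump (?r n * x)\<bar> \<le> \<bar>f' x * hermite q x\<bar> * exp 2"
        by (intro mult_left_mono bump_bounds) auto
      then show "norm (f' x * hermite q x * bump (?r n * x)) \<le> exp 2 * \<bar>f' x * hermite q x\<bar>"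
        by (simp only: real_norm_def abs_mult mult_ac)
    qed
  qed auto
  ultimately have "(\<integral>x. f x * (- hermite (Suc q) x) \<partial>?\<gamma>) = - (\<integral>x. f' x * hermite q x * 1 \<partial>?\<gamma>)"
    unfolding eq by (rule LIMSEQ_unique)
  then show ?thesis by simp
qed

section \<open>Fourth moments of truncated expansions\<close>

lemma integral_cauchy_schwarz:
  fixes f g :: "'a \<Rightarrow> real"
  assumes [measurable]: "f \<in> borel_measurable M" "g \<in> borel_measurable M"
    and f2: "integrable M (\<lambda>x. (f x)\<^sup>2)" and g2: "integrable M (\<lambda>x. (g x)\<^sup>2)"
  shows "\<bar>\<integral>x. f x * g x \<partial>M\<bar> \<le> sqrt (\<integral>x. (f x)\<^sup>2 \<partial>M) * sqrt (\<integral>x. (g x)\<^sup>2 \<partial>M)"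
proof -
  define a b c where "a = (\<integral>x. (f x)\<^sup>2 \<partial>M)" and "b = (\<integral>x. f x * g x \<partial>M)" and "c = (\<integral>x. (g x)\<^sup>2 \<partial>M)"
  have fg: "integrable M (\<lambda>x. f x * g x)" by (rule integrable_mult_square[OF _ _ f2 g2]) auto
  have q: "0 \<le> t\<^sup>2 * a + 2 * t * b + c" for t
  proof -
    have "0 \<le> (\<integral>x. (t * f x + g x)\<^sup>2 \<partial>M)" by simp
    also have "\<dots> = (\<integral>x. t\<^sup>2 * (f x)\<^sup>2 + 2 * t * (f x * g x) + (g x)\<^sup>2 \<partial>M)"
      by (intro Bochner_Integration.integral_cong refl) (simp add: power2_eq_square algebra_simps)
    also have "\<dots> = t\<^sup>2 * a + 2 * t * b + c"
      unfolding a_def b_def c_def using f2 g2 fg by simp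
    finally show ?thesis .
  qed
  have a0: "0 \<le> a" "0 \<le> c" by (simp_all add: a_def c_def)
  have "b\<^sup>2 \<le> a * c"
  proof (cases "a = 0")
    case True
    have "b = 0"
    proof (rule ccontr)
      assume "b \<noteq> 0"
      \<comment> \<open>For a = 0 the quadratic is affine in t, and at this t it would take the
        value -1.\<close>
      then have "2 * (- (c + 1) / (2 * b)) * b = - (c + 1)" by simp
      then show False using q[of "- (c + 1) / (2 * b)"] True by simp
    qed
    then show ?thesis using True by simp
  next
    case False
    then have a: "0 < a" using a0 by simp
    have "(- b / a)\<^sup>2 * a + 2 * (- b / a) * b + c = c - b\<^sup>2 / a"
      using a by (simp add: power2_eq_square field_simps)
    then have "b\<^sup>2 / a \<le> c" using q[of "- b / a"] by simp
    then show ?thesis using a by (simp add: field_simps)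
  qed
  then have "\<bar>b\<bar>\<^sup>2 \<le> a * c" by simp
  then have "\<bar>b\<bar> \<le> sqrt (a * c)" by (rule real_le_rsqrt)
  then show ?thesis by (simp add: a_def b_def c_def real_sqrt_mult)
qed

text \<open>With s the sum of the coefficients, a linear combination is \<open>s * x\<close>: normal
  if s is not 0, and otherwise the constant 0, which \<open>gaussian_rv\<close> admits.\<close>

lemma gamma_gaussian_family: "gaussian_family std_normal_distribution (\<lambda>_ x. x)"
proof (intro gaussian_family.intro gaussian_family_axioms.intro)
  let ?\<gamma> = "std_normal_distribution"
  show "prob_space ?\<gamma>" by unfold_locales
  have D: "distributed ?\<gamma> lborel (\<lambda>x. x) (normal_density 0 1)"
    unfolding distributed_def by (auto intro!: distr_id2)
  have "gaussian_rv ?\<gamma> (\<lambda>x. \<Sum>i\<in>I. a i * x)" for I and a :: "nat \<Rightarrow> real"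
  proof (cases "sum a I = 0")
    case True
    have "(\<lambda>x. \<Sum>i\<in>I. a i * x) = (\<lambda>x. 0)" using True by (simp flip: sum_distrib_right)
    moreover have "gaussian_rv ?\<gamma> (\<lambda>x. 0)" unfolding gaussian_rv_def by auto
    ultimately show ?thesis by (simp only:)
  next
    case False
    have "(\<lambda>x. \<Sum>i\<in>I. a i * x) = (\<lambda>x. 0 + sum a I * x)" by (simp add: sum_distrib_right)
    moreover have "distributed ?\<gamma> lborel (\<lambda>x. 0 + sum a I * x) (normal_density (0 + sum a I * 0) (\<bar>sum a I\<bar> * 1))"
      by (rule gamma.normal_density_affine[OF D]) (use False in auto)
    moreover have "\<bar>sum a I\<bar> * 1 > 0" using False by simp
    ultimately show ?thesis unfolding gaussian_rv_def by (auto simp del: mult_1_right)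
  qed
  then show "gaussian_seq ?\<gamma> (\<lambda>_ x. x)" unfolding gaussian_seq_def by auto
  show m: "(\<integral>x. x \<partial>?\<gamma>) = 0" using integral_std_normal_distribution_moment_odd[of 1] by simp
  show "(\<integral>x. (x - (\<integral>x. x \<partial>?\<gamma>))\<^sup>2 \<partial>?\<gamma>) = 1"
    unfolding m using std_normal_distribution_even_moments(1)[of 1] by simp
qed

lemma gamma_hermite_orthogonal:
  "(\<integral>x. hermite a x * hermite b x \<partial>std_normal_distribution) = (if a = b then fact a else 0)"
  using gaussian_family.expectation_hermite_mult[OF gamma_gaussian_family, where a=a and b=b and i=0 and j=0]
  by (simp add: gaussian_family.cov_self[OF gamma_gaussian_family])

lemma gamma_hermite4_nonneg:
  "0 \<le> (\<integral>x. hermite a x * (hermite b x * hermite c x * hermite e x) \<partial>std_normal_distribution)"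
  using gaussian_family.herm4_diagonal_nonneg[OF gamma_gaussian_family, of 0 a b c e]
  by (simp add: gaussian_family.herm4_def[OF gamma_gaussian_family])

text \<open>The strict bound makes m the number of terms, so that differentiation turns
  \<open>Suc m\<close> into m.\<close>

definition hermite_poly :: "(nat \<Rightarrow> real) \<Rightarrow> nat \<Rightarrow> real \<Rightarrow> real" where
  "hermite_poly w m x = (\<Sum>q<m. w q * hermite q x)"

lemma hermite_poly_measurable [measurable]: "hermite_poly w m \<in> borel_measurable borel"
  unfolding hermite_poly_def[abs_def] by measurable

lemma (in finite_measure) all_moments_hermite_poly:
  "all_moments M W \<Longrightarrow> all_moments M (\<lambda>\<omega>. hermite_poly w m (W \<omega>))"
  unfolding hermite_poly_def by (intro all_moments_sum all_moments_cmult all_moments_hermite)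

lemma gamma_hermite_poly_all_moments: "all_moments std_normal_distribution (hermite_poly w m)"
  using gamma.all_moments_hermite_poly[OF gamma_X_all_moments] by simp

lemma hermite_poly_integral:
  assumes "\<And>q. integrable M (\<lambda>\<omega>. hermite q (X \<omega>) * Z \<omega>)"
  shows "(\<integral>\<omega>. hermite_poly w m (X \<omega>) * Z \<omega> \<partial>M) = (\<Sum>q<m. w q * (\<integral>\<omega>. hermite q (X \<omega>) * Z \<omega> \<partial>M))"
proof -
  have "(\<integral>\<omega>. hermite_poly w m (X \<omega>) * Z \<omega> \<partial>M) = (\<integral>\<omega>. (\<Sum>q<m. w q * (hermite q (X \<omega>) * Z \<omega>)) \<partial>M)"
    by (simp add: hermite_poly_def sum_distrib_right mult.assoc)
  also have "\<dots> = (\<Sum>q<m. w q * (\<integral>\<omega>. hermite q (X \<omega>) * Z \<omega> \<partial>M))"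
    using assms by (subst Bochner_Integration.integral_sum) auto
  finally show ?thesis .
qed

lemma gamma_hermite_poly_coeff:
  "(\<integral>x. hermite_poly w m x * hermite r x \<partial>std_normal_distribution) = (if r < m then fact r * w r else 0)"
proof -
  have "(\<integral>x. hermite_poly w m x * hermite r x \<partial>std_normal_distribution) = (\<Sum>q<m. w q * (if q = r then fact q else 0))"
    by (subst hermite_poly_integral)
       (auto intro!: all_moments_integrable all_moments_mult gamma_hermite_all_moments simp: gamma_hermite_orthogonal)
  also have "\<dots> = (\<Sum>q<m. if q = r then fact r * w r else 0)" by (intro sum.cong) auto
  finally show ?thesis by simp
qed

section \<open>The algebra of finite Hermite sums\<close>

text \<open>These are all the polynomials, but presented in the Hermite basis, in which the signs of
  coefficients will matter. Closure under multiplication rests on \<open>x * hermite r x = hermite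
  (Suc r) x + real r * hermite (r - 1) x\<close>.\<close>

definition hermite_span :: "(real \<Rightarrow> real) set" where
  "hermite_span = {p. \<exists>b R. p = hermite_poly b R}"

lemma hermite_span_add:
  assumes "p \<in> hermite_span" "p' \<in> hermite_span" shows "(\<lambda>x. p x + p' x) \<in> hermite_span"
proof -
  obtain b R b' R' where p: "p = hermite_poly b R" "p' = hermite_poly b' R'"
    using assms by (auto simp: hermite_span_def)
  let ?b = "\<lambda>r. (if r < R then b r else 0) + (if r < R' then b' r else 0)"
  have "p x + p' x = hermite_poly ?b (max R R') x" for x
  proof -
    have "p x = (\<Sum>q<max R R'. (if q < R then b q else 0) * hermite q x)"
      unfolding p hermite_poly_def by (intro sum.mono_neutral_cong_left) auto
    moreover have "p' x = (\<Sum>q<max R R'. (if q < R' then b' q else 0) * hermite q x)"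
      unfolding p hermite_poly_def by (intro sum.mono_neutral_cong_left) auto
    ultimately show ?thesis by (simp add: hermite_poly_def sum.distrib distrib_right)
  qed
  then show ?thesis unfolding hermite_span_def by blast
qed

lemma hermite_span_cmult:
  assumes "p \<in> hermite_span" shows "(\<lambda>x. k * p x) \<in> hermite_span"
proof -
  obtain b R where p: "p = hermite_poly b R" using assms by (auto simp: hermite_span_def)
  have "(\<lambda>x. k * p x) = hermite_poly (\<lambda>r. k * b r) R"
    by (intro ext) (simp add: p hermite_poly_def sum_distrib_left mult.assoc)
  then show ?thesis unfolding hermite_span_def by blast
qed

lemma hermite_span_sum:
  assumes "\<And>i. i \<in> I \<Longrightarrow> p i \<in> hermite_span" shows "(\<lambda>x. \<Sum>i\<in>I. p i x) \<in> hermite_span"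
proof -
  have "(\<lambda>x. 0) = hermite_poly (\<lambda>_. 0) 0" by (intro ext) (simp add: hermite_poly_def)
  then have "(\<lambda>x. 0) \<in> hermite_span" unfolding hermite_span_def by blast
  then show ?thesis using assms
    by (induction I rule: infinite_finite_induct) (simp_all add: hermite_span_add)
qed

lemma hermite_in_span: "hermite r \<in> hermite_span"
proof -
  have "hermite r = hermite_poly (\<lambda>q. if q = r then 1 else 0) (Suc r)"
  proof
    fix x
    have "(\<Sum>q<Suc r. (if q = r then 1 else 0) * hermite q x) = (\<Sum>q<Suc r. if q = r then hermite r x else 0)"
      by (intro sum.cong) auto
    then show "hermite r x = hermite_poly (\<lambda>q. if q = r then 1 else 0) (Suc r) x" by (simp add: hermite_poly_def)
  qed
  then show ?thesis unfolding hermite_span_def by blast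
qed

lemma hermite_span_mult_ident:
  assumes "p \<in> hermite_span" shows "(\<lambda>x. x * p x) \<in> hermite_span"
proof -
  obtain b R where p: "p = hermite_poly b R" using assms by (auto simp: hermite_span_def)
  have "(\<lambda>x. x * p x) = (\<lambda>x. \<Sum>r<R. b r * (hermite (Suc r) x + real r * hermite (r - 1) x))"
    by (intro ext) (simp add: p hermite_poly_def sum_distrib_left hermite_Suc mult_ac)
  also have "\<dots> \<in> hermite_span"
    by (intro hermite_span_sum hermite_span_cmult hermite_span_add hermite_in_span)
  finally show ?thesis .
qed

lemma hermite_span_mult_hermite:
  assumes "p \<in> hermite_span" shows "(\<lambda>x. hermite q x * p x) \<in> hermite_span"
proof (induction q rule: less_induct)
  case (less q)
  show ?case
  proof (cases q)
    case 0 then show ?thesis using assms by (simp add: hermite_0)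
  next
    case (Suc k)
    have "(\<lambda>x. x * (hermite k x * p x) + (- real k) * (hermite (k - 1) x * p x)) \<in> hermite_span"
      by (intro hermite_span_add hermite_span_cmult hermite_span_mult_ident less) (auto simp: Suc)
    moreover have "(\<lambda>x. hermite q x * p x) = (\<lambda>x. x * (hermite k x * p x) + (- real k) * (hermite (k - 1) x * p x))"
      by (intro ext) (simp add: Suc hermite_Suc algebra_simps)
    ultimately show ?thesis by simp
  qed
qed

lemma hermite_span_mult:
  assumes "p \<in> hermite_span" "p' \<in> hermite_span" shows "(\<lambda>x. p x * p' x) \<in> hermite_span"
proof -
  obtain b R where p: "p = hermite_poly b R" using assms by (auto simp: hermite_span_def)
  have "(\<lambda>x. p x * p' x) = (\<lambda>x. \<Sum>r<R. b r * (hermite r x * p' x))"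
    by (intro ext) (simp add: p hermite_poly_def sum_distrib_right mult.assoc)
  also have "\<dots> \<in> hermite_span"
    by (intro hermite_span_sum hermite_span_cmult hermite_span_mult_hermite assms)
  finally show ?thesis .
qed

lemma gamma_integrable_square:
  fixes G :: "real \<Rightarrow> real"
  assumes [measurable]: "G \<in> borel_measurable borel"
    and G4: "integrable std_normal_distribution (\<lambda>x. (G x) ^ 4)"
  shows "integrable std_normal_distribution (\<lambda>x. (G x)\<^sup>2)"
proof (rule Bochner_Integration.integrable_bound[where f="\<lambda>x. 1 + (G x) ^ 4"])
  show "AE x in std_normal_distribution. norm ((G x)\<^sup>2) \<le> norm (1 + (G x) ^ 4)"
  proof (rule AE_I2)
    fix x
    have "2 * (G x)\<^sup>2 \<le> 1 + ((G x)\<^sup>2)\<^sup>2" using sum_squares_bound[of 1 "(G x)\<^sup>2"] by simp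
    moreover have "((G x)\<^sup>2)\<^sup>2 = (G x) ^ 4" by (simp add: power4_eq_xxxx power2_eq_square)
    moreover have "0 \<le> (G x)\<^sup>2" by simp
    ultimately have "(G x)\<^sup>2 \<le> 1 + (G x) ^ 4" by linarith
    then show "norm ((G x)\<^sup>2) \<le> norm (1 + (G x) ^ 4)" by simp
  qed
qed (use G4 in auto)

text \<open>The cube of a polynomial with nonnegative Hermite coefficients has nonnegative Hermite
  coefficients, so truncating \<open>G\<close> can only decrease its integral against that cube.\<close>

lemma hermite_truncation_fourth_moment:
  fixes w :: "nat \<Rightarrow> real" and G :: "real \<Rightarrow> real"
  assumes w0: "\<And>q. 0 \<le> w q"
    and [measurable]: "G \<in> borel_measurable borel"
    and G4: "integrable std_normal_distribution (\<lambda>x. (G x) ^ 4)"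
    and coeff: "\<And>q. (\<integral>x. G x * hermite q x \<partial>std_normal_distribution) = fact q * w q"
  shows "(\<integral>x. (hermite_poly w m x) ^ 4 \<partial>std_normal_distribution) \<le> 16 * (\<integral>x. (G x) ^ 4 \<partial>std_normal_distribution)"
proof -
  let ?\<gamma> = "std_normal_distribution"
  let ?P = "hermite_poly w m"
  have P: "all_moments ?\<gamma> ?P" by (rule gamma_hermite_poly_all_moments)
  note H = gamma_hermite_all_moments
  have int: "integrable ?\<gamma> f" if "all_moments ?\<gamma> f" for f using that by (rule all_moments_integrable)
  have span: "?P \<in> hermite_span" by (auto simp: hermite_span_def)
  have "(\<lambda>x. ?P x * (?P x * ?P x)) \<in> hermite_span" by (intro hermite_span_mult span)
  then obtain b R where b: "\<And>x. ?P x * (?P x * ?P x) = hermite_poly b R x"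
    unfolding hermite_span_def by (auto dest: fun_cong)
  \<comment> \<open>Positivity passes from single Hermite polynomials to \<open>?P\<close>, whose
    coefficients are nonnegative. Starting from \<open>gamma_hermite4_nonneg\<close>, this is used
    once for each of the three factors of the cube.\<close>
  have EP: "0 \<le> (\<integral>x. ?P x * Z x \<partial>?\<gamma>)" if "all_moments ?\<gamma> Z" "\<And>q. 0 \<le> (\<integral>x. hermite q x * Z x \<partial>?\<gamma>)" for Z
  proof -
    have "(\<integral>x. ?P x * Z x \<partial>?\<gamma>) = (\<Sum>q<m. w q * (\<integral>x. hermite q x * Z x \<partial>?\<gamma>))"
      by (rule hermite_poly_integral) (intro int all_moments_mult H that)
    also have "0 \<le> \<dots>" by (intro sum_nonneg mult_nonneg_nonneg w0 that)
    finally show ?thesis .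
  qed
  have c0: "0 \<le> (\<integral>x. hermite_poly b R x * hermite r x \<partial>?\<gamma>)" for r
  proof -
    have 1: "0 \<le> (\<integral>x. ?P x * (hermite i x * hermite j x * hermite r x) \<partial>?\<gamma>)" for i j
    proof (rule EP)
      fix q show "0 \<le> (\<integral>x. hermite q x * (hermite i x * hermite j x * hermite r x) \<partial>?\<gamma>)"
        by (rule gamma_hermite4_nonneg)
    qed (intro all_moments_mult H)
    have 2: "0 \<le> (\<integral>x. ?P x * (hermite i x * (?P x * hermite r x)) \<partial>?\<gamma>)" for i
    proof (rule EP)
      fix q show "0 \<le> (\<integral>x. hermite q x * (hermite i x * (?P x * hermite r x)) \<partial>?\<gamma>)"
        using 1[of q i] by (simp add: mult_ac)
    qed (intro all_moments_mult H P)
    have "0 \<le> (\<integral>x. ?P x * (?P x * (?P x * hermite r x)) \<partial>?\<gamma>)"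
    proof (rule EP)
      fix q show "0 \<le> (\<integral>x. hermite q x * (?P x * (?P x * hermite r x)) \<partial>?\<gamma>)"
        using 2[of q] by (simp add: mult_ac)
    qed (intro all_moments_mult H P)
    then show ?thesis by (simp add: b[symmetric] mult_ac)
  qed
  have b0: "0 \<le> b r" if "r < R" for r
    using c0[of r] that fact_gt_zero[of r, where ?'a=real]
    by (simp add: gamma_hermite_poly_coeff zero_le_mult_iff)
  have G2: "integrable ?\<gamma> (\<lambda>x. (G x)\<^sup>2)"
    by (rule gamma_integrable_square[OF _ G4]) simp
  have H2: "integrable ?\<gamma> (\<lambda>x. (hermite q x)\<^sup>2)" for q
    by (intro int gamma.all_moments_power H)
  have P2: "integrable ?\<gamma> (\<lambda>x. (hermite_poly b R x)\<^sup>2)"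
    by (intro int gamma.all_moments_power gamma_hermite_poly_all_moments)
  have HG: "integrable ?\<gamma> (\<lambda>x. hermite q x * G x)" for q
    by (rule integrable_mult_square[OF _ _ H2 G2]) simp_all
  have "(\<integral>x. ?P x ^ 4 \<partial>?\<gamma>) = (\<integral>x. hermite_poly b R x * ?P x \<partial>?\<gamma>)"
    by (intro Bochner_Integration.integral_cong refl) (simp add: b[symmetric] power4_eq_xxxx mult_ac)
  also have "\<dots> = (\<Sum>r<R. b r * (\<integral>x. hermite r x * ?P x \<partial>?\<gamma>))"
    by (rule hermite_poly_integral) (intro int all_moments_mult H P)
  also have "\<dots> \<le> (\<Sum>r<R. b r * (\<integral>x. hermite r x * G x \<partial>?\<gamma>))"
  proof (rule sum_mono)
    fix r assume "r \<in> {..<R}"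
    have "(\<integral>x. hermite r x * ?P x \<partial>?\<gamma>) \<le> (\<integral>x. hermite r x * G x \<partial>?\<gamma>)"
      using gamma_hermite_poly_coeff[of w m r] coeff[of r] w0[of r] by (simp add: mult.commute)
    then show "b r * (\<integral>x. hermite r x * ?P x \<partial>?\<gamma>) \<le> b r * (\<integral>x. hermite r x * G x \<partial>?\<gamma>)"
      using b0 \<open>r \<in> {..<R}\<close> by (intro mult_left_mono) auto
  qed
  also have "\<dots> = (\<integral>x. hermite_poly b R x * G x \<partial>?\<gamma>)"
    by (rule hermite_poly_integral[symmetric]) (rule HG)
  also have "\<dots> = (\<integral>x. G x * ?P x ^ 3 \<partial>?\<gamma>)"
    by (intro Bochner_Integration.integral_cong refl) (simp add: b[symmetric] power3_eq_cube mult_ac)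
  \<comment> \<open>If |P| \<le> 2 |G| the product is at most 8 times the fourth power of G,
    otherwise at most half the fourth power of P. That half is absorbed by the left-hand side, which
    doubles 8 to 16.\<close>
  also have "\<dots> \<le> (\<integral>x. 8 * G x ^ 4 + (1/2) * ?P x ^ 4 \<partial>?\<gamma>)"
  proof (rule integral_mono)
    have "integrable ?\<gamma> (\<lambda>x. hermite_poly b R x * G x)"
      by (rule integrable_mult_square[OF _ _ P2 G2]) simp_all
    then show "integrable ?\<gamma> (\<lambda>x. G x * ?P x ^ 3)"
      by (simp add: b[symmetric] power3_eq_cube mult_ac)
    show "integrable ?\<gamma> (\<lambda>x. 8 * G x ^ 4 + (1/2) * ?P x ^ 4)"
      using G4 int[OF gamma.all_moments_power[OF P, of 4]] by auto
    fix x
    show "G x * ?P x ^ 3 \<le> 8 * G x ^ 4 + (1/2) * ?P x ^ 4"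
    proof (cases "\<bar>?P x\<bar> \<le> 2 * \<bar>G x\<bar>")
      case True
      have "G x * ?P x ^ 3 \<le> \<bar>G x\<bar> * \<bar>?P x\<bar> ^ 3" by (metis abs_ge_self abs_mult power_abs)
      also have "\<dots> \<le> \<bar>G x\<bar> * (2 * \<bar>G x\<bar>) ^ 3" using True by (intro mult_left_mono power_mono) auto
      also have "\<dots> = 8 * (G x ^ 4)" by (simp add: power_mult_distrib power4_eq_xxxx power3_eq_cube)
      finally have "G x * ?P x ^ 3 \<le> \<dots>" .
      moreover have "0 \<le> ?P x ^ 4" by (rule zero_le_even_power) simp
      ultimately show ?thesis by linarith
    next
      case False
      have "G x * ?P x ^ 3 \<le> \<bar>G x\<bar> * \<bar>?P x\<bar> ^ 3" by (metis abs_ge_self abs_mult power_abs)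
      also have "\<dots> \<le> (\<bar>?P x\<bar> / 2) * \<bar>?P x\<bar> ^ 3" using False by (intro mult_right_mono) auto
      also have "\<dots> = (1/2) * (?P x ^ 4)" by (simp add: power4_eq_xxxx power3_eq_cube)
      finally have "G x * ?P x ^ 3 \<le> \<dots>" .
      moreover have "0 \<le> G x ^ 4" by (rule zero_le_even_power) simp
      ultimately show ?thesis by linarith
    qed
  qed
  also have "\<dots> = 8 * (\<integral>x. G x ^ 4 \<partial>?\<gamma>) + (1/2) * (\<integral>x. ?P x ^ 4 \<partial>?\<gamma>)"
    using G4 int[OF gamma.all_moments_power[OF P, of 4]] by simp
  finally show ?thesis by linarith
qed

section \<open>Coefficients of Hermite expansions\<close>

lemma hermite_expansion_L2:
  assumes "has_hermite_expansion g c"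
  shows "g \<in> borel_measurable borel" "integrable std_normal_distribution (\<lambda>x. (g x)\<^sup>2)"
    "integrable std_normal_distribution (\<lambda>x. (g x - hermite_poly c m x)\<^sup>2)"
    "(\<lambda>m. \<integral>x. (g x - hermite_poly c m x)\<^sup>2 \<partial>std_normal_distribution) \<longlonglongrightarrow> 0"
proof -
  show g[measurable]: "g \<in> borel_measurable borel" and g2: "integrable std_normal_distribution (\<lambda>x. (g x)\<^sup>2)"
    using assms by (auto simp: has_hermite_expansion_def L2_gauss_def)
  have P2: "integrable std_normal_distribution (\<lambda>x. (hermite_poly c m x)\<^sup>2)"
    by (intro all_moments_integrable gamma.all_moments_power gamma_hermite_poly_all_moments)
  have "integrable std_normal_distribution (\<lambda>x. (g x)\<^sup>2 - 2 * (g x * hermite_poly c m x) + (hermite_poly c m x)\<^sup>2)"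
    using g2 P2 integrable_mult_square[OF _ _ g2 P2] by auto
  then show "integrable std_normal_distribution (\<lambda>x. (g x - hermite_poly c m x)\<^sup>2)"
    by (simp add: power2_diff mult_ac algebra_simps)
  \<comment> \<open>\<open>has_hermite_expansion\<close> sums over q \<le> m, which is the
    truncation with index \<open>Suc m\<close>.\<close>
  have "(\<lambda>m. \<integral>x. (g x - hermite_poly c (Suc m) x)\<^sup>2 \<partial>std_normal_distribution) \<longlonglongrightarrow> 0"
    using assms by (simp add: has_hermite_expansion_def hermite_poly_def lessThan_Suc_atMost)
  then show "(\<lambda>m. \<integral>x. (g x - hermite_poly c m x)\<^sup>2 \<partial>std_normal_distribution) \<longlonglongrightarrow> 0"
    by (rule LIMSEQ_imp_Suc)
qed

text \<open>Pairing with \<open>hermite q\<close> is continuous in \<open>L\<^sup>2\<close> by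
  Cauchy-Schwarz, and by orthogonality its value on the m-th truncation is constant for m >
  q.\<close>

lemma hermite_expansion_coeff:
  assumes "has_hermite_expansion g c"
  shows "(\<integral>x. g x * hermite q x \<partial>std_normal_distribution) = fact q * c q"
proof -
  let ?\<gamma> = "std_normal_distribution"
  note g = hermite_expansion_L2[OF assms]
  note [measurable] = g(1)
  have H2: "integrable ?\<gamma> (\<lambda>x. (hermite q x)\<^sup>2)"
    by (intro all_moments_integrable gamma.all_moments_power gamma_hermite_all_moments)
  have gH: "integrable ?\<gamma> (\<lambda>x. g x * hermite q x)" by (rule integrable_mult_square[OF _ _ g(2) H2]) auto
  have PH: "integrable ?\<gamma> (\<lambda>x. hermite_poly c m x * hermite q x)" for m
    by (intro all_moments_integrable all_moments_mult gamma_hermite_all_moments gamma_hermite_poly_all_moments)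
  have "(\<lambda>m. \<integral>x. (g x - hermite_poly c m x) * hermite q x \<partial>?\<gamma>) \<longlonglongrightarrow> 0"
  proof (rule Lim_null_comparison)
    show "\<forall>\<^sub>F m in sequentially. norm (\<integral>x. (g x - hermite_poly c m x) * hermite q x \<partial>?\<gamma>)
       \<le> sqrt (\<integral>x. (g x - hermite_poly c m x)\<^sup>2 \<partial>?\<gamma>) * sqrt (\<integral>x. (hermite q x)\<^sup>2 \<partial>?\<gamma>)"
      unfolding real_norm_def
      by (intro always_eventually allI integral_cauchy_schwarz g(3) H2) auto
    have "(\<lambda>m. sqrt (\<integral>x. (g x - hermite_poly c m x)\<^sup>2 \<partial>?\<gamma>) * sqrt (\<integral>x. (hermite q x)\<^sup>2 \<partial>?\<gamma>)) \<longlonglongrightarrow> sqrt 0 * sqrt (\<integral>x. (hermite q x)\<^sup>2 \<partial>?\<gamma>)"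
      by (intro tendsto_intros g(4))
    then show "(\<lambda>m. sqrt (\<integral>x. (g x - hermite_poly c m x)\<^sup>2 \<partial>?\<gamma>) * sqrt (\<integral>x. (hermite q x)\<^sup>2 \<partial>?\<gamma>)) \<longlonglongrightarrow> 0" by simp
  qed
  moreover have "\<forall>\<^sub>F m in sequentially. (\<integral>x. (g x - hermite_poly c m x) * hermite q x \<partial>?\<gamma>) =
     (\<integral>x. g x * hermite q x \<partial>?\<gamma>) - fact q * c q"
    using eventually_gt_at_top[of q]
    by eventually_elim (use gH PH in \<open>simp add: left_diff_distrib gamma_hermite_poly_coeff\<close>)
  ultimately have "(\<lambda>m. (\<integral>x. g x * hermite q x \<partial>?\<gamma>) - fact q * c q) \<longlonglongrightarrow> 0"
    by (simp add: tendsto_cong)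
  then show ?thesis by (simp add: LIMSEQ_const_iff)
qed

text \<open>\<open>Q\<close> is 16 times the fourth moment of the weak derivative of
  \<open>Ag\<close>. The Hermite coefficients of that derivative are
  \<open>real (Suc q) * \<bar>c (Suc q)\<bar>\<close>, nonnegative thanks to the absolute values in
  \<open>Ag\<close>, so \<open>hermite_truncation_fourth_moment\<close> applies uniformly in
  m.\<close>

lemma fourth_moment_of_truncations:
  assumes Ag: "has_hermite_expansion Ag (\<lambda>q. \<bar>c q\<bar>)" and D: "Ag \<in> gauss_sobolev 1 4"
  shows "\<exists>Q. \<forall>m. (\<integral>x. (hermite_poly (\<lambda>q. real (Suc q) * \<bar>c (Suc q)\<bar>) m x) ^ 4 \<partial>std_normal_distribution) \<le> Q"
proof -
  let ?\<gamma> = "std_normal_distribution"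
  obtain D :: "nat \<Rightarrow> real \<Rightarrow> real" where D: "D 0 = Ag" "weak_derivative (D 0) (D (Suc 0))"
     and Dm: "\<And>j. j \<le> 1 \<Longrightarrow> D j \<in> borel_measurable borel"
     and D4: "\<And>j. j \<le> 1 \<Longrightarrow> integrable ?\<gamma> (\<lambda>x. \<bar>D j x\<bar> powr 4)"
    using D unfolding gauss_sobolev_def by auto
  let ?G = "D (Suc 0)"
  have Gm[measurable]: "?G \<in> borel_measurable borel" and [measurable]: "Ag \<in> borel_measurable borel"
    using Dm[of 1] Dm[of 0] D(1) by auto
  have "\<bar>?G x\<bar> powr 4 = ?G x ^ 4" for x
    by (simp add: powr_numeral)
  then have G4: "integrable ?\<gamma> (\<lambda>x. ?G x ^ 4)" using D4[of 1] by simp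
  have G2: "integrable ?\<gamma> (\<lambda>x. (?G x)\<^sup>2)"
    by (rule gamma_integrable_square[OF _ G4]) simp
  have "(\<integral>x. ?G x * hermite q x \<partial>?\<gamma>) = fact q * (real (Suc q) * \<bar>c (Suc q)\<bar>)" for q
  proof -
    have "(\<integral>x. ?G x * hermite q x \<partial>?\<gamma>) = (\<integral>x. Ag x * hermite (Suc q) x \<partial>?\<gamma>)"
      by (rule weak_derivative_hermite) (use D G2 hermite_expansion_L2(2)[OF Ag] in auto)
    also have "\<dots> = fact (Suc q) * \<bar>c (Suc q)\<bar>" by (rule hermite_expansion_coeff[OF Ag])
    finally show ?thesis by (simp add: mult_ac)
  qed
  then have "\<forall>m. (\<integral>x. (hermite_poly (\<lambda>q. real (Suc q) * \<bar>c (Suc q)\<bar>) m x) ^ 4 \<partial>?\<gamma>) \<le> 16 * (\<integral>x. (?G x) ^ 4 \<partial>?\<gamma>)"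
    by (intro allI hermite_truncation_fourth_moment G4 Gm) auto
  then show ?thesis by blast
qed

section \<open>Stein's equation and total variation\<close>

lemma std_normal_density_pos: "0 < std_normal_density x"
  by (rule normal_density_pos) simp

lemma std_normal_density_tendsto_0: "(std_normal_density \<longlongrightarrow> 0) at_top"
proof -
  have "filterlim (\<lambda>x::real. (-1/2) * x\<^sup>2) at_bot at_top"
    by (rule filterlim_tendsto_neg_mult_at_bot[OF tendsto_const])
       (auto intro!: filterlim_pow_at_top filterlim_ident)
  then have "filterlim (\<lambda>x::real. - (x\<^sup>2) / 2) at_bot at_top" by simp
  then have "((\<lambda>x::real. exp (- (x\<^sup>2) / 2)) \<longlongrightarrow> 0) at_top"
    by (rule filterlim_compose[OF exp_at_bot])
  then have "((\<lambda>x::real. 1 / sqrt (2 * pi) * exp (- (x\<^sup>2) / 2)) \<longlongrightarrow> 1 / sqrt (2 * pi) * 0) at_top"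
    by (intro tendsto_intros)
  then show ?thesis unfolding std_normal_density_def[abs_def] by simp
qed

text \<open>For y in \<open>{x..}\<close> the factor x is at most y, and y times the density has
  minus the density as a primitive.\<close>

lemma gamma_upper_tail:
  assumes "0 \<le> x"
  shows "x * measure std_normal_distribution {x..} \<le> std_normal_density x"
proof -
  have d: "((\<lambda>y. - std_normal_density y) has_real_derivative y * std_normal_density y) (at y)" for y
    by (rule DERIV_cong[OF DERIV_minus[OF std_normal_density_has_derivative]]) simp
  have lim: "((\<lambda>y. - std_normal_density y) \<longlongrightarrow> - 0) at_top"
    by (intro tendsto_intros std_normal_density_tendsto_0)
  have fi: "(\<integral>\<^sup>+y. ennreal (y * std_normal_density y) * indicator {x..} y \<partial>lborel) = ennreal (- 0 - (- std_normal_density x))"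
    by (rule nn_integral_FTC_atLeast[OF _ d _ lim]) (use assms in auto)
  have "ennreal (x * measure std_normal_distribution {x..}) = ennreal x * emeasure std_normal_distribution {x..}"
    using assms by (simp add: gamma.emeasure_eq_measure ennreal_mult)
  also have "\<dots> = (\<integral>\<^sup>+y. ennreal x * (ennreal (std_normal_density y) * indicator {x..} y) \<partial>lborel)"
    by (subst nn_integral_cmult) (auto simp: emeasure_density)
  also have "\<dots> \<le> (\<integral>\<^sup>+y. ennreal (y * std_normal_density y) * indicator {x..} y \<partial>lborel)"
    using assms by (intro nn_integral_mono) (auto simp: indicator_def ennreal_mult'[symmetric] intro!: ennreal_leI mult_right_mono)
  finally show ?thesis unfolding fi by (simp add: ennreal_le_iff)
qed

lemma gamma_reflect: "measure std_normal_distribution {..-x} = measure std_normal_distribution {x..}"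
proof -
  have "emeasure std_normal_distribution {..-x} = (\<integral>\<^sup>+y. ennreal (std_normal_density y) * indicator {..-x} y \<partial>lborel)"
    by (simp add: emeasure_density)
  also have "\<dots> = ennreal \<bar>-1\<bar> * (\<integral>\<^sup>+y. ennreal (std_normal_density (0 + (-1) * y)) * indicator {..-x} (0 + (-1) * y) \<partial>lborel)"
    by (rule nn_integral_real_affine) auto
  also have "\<dots> = (\<integral>\<^sup>+y. ennreal (std_normal_density y) * indicator {x..} y \<partial>lborel)"
    by (simp add: std_normal_density_def indicator_def)
  also have "\<dots> = emeasure std_normal_distribution {x..}"
    by (simp add: emeasure_density)
  finally show ?thesis by (simp add: measure_def)
qed

text \<open>The solution is I(x) divided by the density at x, where I(x) integrates h - \<mu> with
  respect to \<gamma> over the half-line below x. Gaussian tail bounds give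
  \<open>\<bar>x * f x\<bar> \<le> 1\<close>, and the equation itself then bounds the derivative by
  1 + 1. The bound \<open>K\<close> on f serves integrability and limits, so its size is
  immaterial.\<close>

lemma stein_solution:
  fixes h :: "real \<Rightarrow> real"
  assumes ch: "continuous_on UNIV h" and h01: "\<And>x. 0 \<le> h x" "\<And>x. h x \<le> 1"
  shows "\<exists>f f' K. (\<forall>x. (f has_real_derivative f' x) (at x)) \<and> continuous_on UNIV f' \<and>
    (\<forall>x. \<bar>f x\<bar> \<le> K) \<and> (\<forall>x. \<bar>f' x\<bar> \<le> 2) \<and>
    (\<forall>x. f' x - x * f x = h x - (\<integral>y. h y \<partial>std_normal_distribution))"
proof -
  let ?\<gamma> = "std_normal_distribution" and ?\<phi> = "std_normal_density"
  define \<mu> where "\<mu> = (\<integral>y. h y \<partial>?\<gamma>)"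
  define k where "k y = h y - \<mu>" for y
  have [measurable]: "h \<in> borel_measurable borel" by (rule borel_measurable_continuous_onI[OF ch])
  have ih: "integrable ?\<gamma> h"
    by (rule gamma.integrable_const_bound[where B=1]) (auto intro!: AE_I2 simp: h01)
  have \<mu>01: "0 \<le> \<mu>" "\<mu> \<le> 1"
    unfolding \<mu>_def using gamma.integral_ge_const[OF ih, of 0] gamma.integral_le_const[OF ih, of 1]
    by (auto intro!: AE_I2 simp: h01)
  have k1: "\<bar>k y\<bar> \<le> 1" for y
    unfolding k_def using h01[of y] \<mu>01 by linarith
  have ck: "continuous_on UNIV k" unfolding k_def by (intro continuous_intros ch)
  have [measurable]: "k \<in> borel_measurable borel" by (rule borel_measurable_continuous_onI[OF ck])
  have ik: "integrable ?\<gamma> k"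
    by (rule gamma.integrable_const_bound[where B=1]) (auto intro!: AE_I2 simp: k1)
  have k0: "(\<integral>y. k y \<partial>?\<gamma>) = 0"
    unfolding k_def using ih gamma.prob_space by (simp add: \<mu>_def[symmetric])
  have c\<phi>: "continuous_on UNIV ?\<phi>"
    by (intro continuous_at_imp_continuous_on ballI DERIV_isCont[OF std_normal_density_has_derivative])
  define u where "u y = k y * ?\<phi> y" for y
  have cu: "continuous_on UNIV u" unfolding u_def by (intro continuous_intros ck c\<phi>)
  have iu: "integrable lborel u"
    using ik unfolding u_def by (subst (asm) integrable_density) (auto intro!: AE_I2 simp: mult.commute)
  have siu: "set_integrable lborel A u" if "A \<in> sets borel" for A
    using iu that unfolding set_integrable_def by (intro integrable_mult_indicator) auto
  define I where "I x = (LBINT y=-\<infinity>..ereal x. u y)" for x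
  have I1: "I x = (\<integral>y. k y * indicator {..<x} y \<partial>?\<gamma>)" for x
    unfolding I_def interval_lebesgue_integral_def set_lebesgue_integral_def
    by (subst integral_density) (auto simp: u_def mult_ac)
  \<comment> \<open>Since h - \<mu> has mean zero, I is also minus the integral over the upper
    half-line. For x \<ge> 0 it is this form to which the tail bound applies.\<close>
  have I2: "I x = - (\<integral>y. k y * indicator {x..} y \<partial>?\<gamma>)" for x
  proof -
    have "(\<integral>y. k y \<partial>?\<gamma>) = (\<integral>y. k y * indicator {..<x} y + k y * indicator {x..} y \<partial>?\<gamma>)"
      by (intro Bochner_Integration.integral_cong refl) (auto simp: indicator_def)
    also have "\<dots> = (\<integral>y. k y * indicator {..<x} y \<partial>?\<gamma>) + (\<integral>y. k y * indicator {x..} y \<partial>?\<gamma>)"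
      by (intro Bochner_Integration.integral_add integrable_real_mult_indicator ik) auto
    finally show ?thesis using k0 by (simp add: I1)
  qed
  have Ibound: "\<bar>\<integral>y. k y * indicator A y \<partial>?\<gamma>\<bar> \<le> measure ?\<gamma> A" if A[measurable]: "A \<in> sets borel" for A
  proof -
    have iA: "integrable ?\<gamma> (indicat_real A)"
      by (rule gamma.integrable_const_bound[where B=1]) (auto simp: indicator_def)
    have "\<bar>\<integral>y. k y * indicator A y \<partial>?\<gamma>\<bar> \<le> (\<integral>y. \<bar>k y * indicator A y\<bar> \<partial>?\<gamma>)"
      by (rule integral_abs_bound)
    also have "\<dots> \<le> (\<integral>y. indicator A y \<partial>?\<gamma>)"
      by (intro integral_mono integrable_abs integrable_real_mult_indicator ik iA)
         (auto simp: indicator_def k1)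
    also have "\<dots> = measure ?\<gamma> A" by simp
    finally show ?thesis .
  qed
  have I_le_1: "\<bar>I x\<bar> \<le> 1" for x
    unfolding I1 by (rule order_trans[OF Ibound gamma.prob_le_1]) simp
  have I_pos: "\<bar>x\<bar> * \<bar>I x\<bar> \<le> ?\<phi> x" for x
  proof (cases "0 \<le> x")
    case True
    have "\<bar>x\<bar> * \<bar>I x\<bar> \<le> x * measure ?\<gamma> {x..}"
      unfolding I2 using True Ibound[of "{x..}"] by (auto intro!: mult_left_mono)
    also have "\<dots> \<le> ?\<phi> x" by (rule gamma_upper_tail[OF True])
    finally show ?thesis .
  next
    case False
    have "\<bar>I x\<bar> \<le> measure ?\<gamma> {..<x}" unfolding I1 by (rule Ibound) simp
    also have "\<dots> \<le> measure ?\<gamma> {..- (-x)}" by (intro gamma.finite_measure_mono) auto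
    also have "\<dots> = measure ?\<gamma> {-x..}" by (rule gamma_reflect)
    finally have "\<bar>x\<bar> * \<bar>I x\<bar> \<le> (-x) * measure ?\<gamma> {-x..}" using False by (auto intro!: mult_mono)
    also have "\<dots> \<le> ?\<phi> (-x)" using False by (intro gamma_upper_tail) simp
    finally show ?thesis by (simp add: std_normal_density_def)
  qed
  \<comment> \<open>The fundamental theorem is applied on a bounded interval with base point 0; the
    integral over the negative half-line is an additive constant.\<close>
  have dI: "(I has_real_derivative u x) (at x)" for x
  proof -
    let ?a = "min 0 x - 1" and ?b = "max 0 x + 1"
    have "((\<lambda>v. LBINT y=ereal 0..ereal v. u y) has_vector_derivative u x) (at x within {?a..?b})"
      using interval_integral_FTC2[of ?a 0 ?b u x] continuous_on_subset[OF cu] by auto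
    then have "((\<lambda>v. LBINT y=ereal 0..ereal v. u y) has_real_derivative u x) (at x)"
      by (simp add: has_real_derivative_iff_has_vector_derivative at_within_Icc_at)
    then have "((\<lambda>v. I 0 + (LBINT y=ereal 0..ereal v. u y)) has_real_derivative 0 + u x) (at x)"
      by (intro DERIV_add DERIV_const)
    moreover have "(\<lambda>v. I 0 + (LBINT y=ereal 0..ereal v. u y)) = I"
      unfolding I_def
      by (intro ext interval_integral_sum) (auto simp: interval_lebesgue_integrable_def intro!: siu)
    ultimately show ?thesis by (simp only: add_0_left)
  qed
  define f where "f x = I x / ?\<phi> x" for x
  have df: "(f has_real_derivative k x + x * f x) (at x)" for x
  proof -
    have "(f has_real_derivative (u x * ?\<phi> x - I x * (- x * ?\<phi> x)) / (?\<phi> x * ?\<phi> x)) (at x)"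
      unfolding f_def[abs_def]
      by (rule DERIV_divide[OF dI std_normal_density_has_derivative]) (use std_normal_density_pos[of x] in auto)
    moreover have "(u x * ?\<phi> x - I x * (- x * ?\<phi> x)) / (?\<phi> x * ?\<phi> x) = k x + x * f x"
      using std_normal_density_pos[of x] unfolding u_def f_def by (simp add: field_simps)
    ultimately show ?thesis by simp
  qed
  have cf: "continuous_on UNIV f"
    by (intro continuous_at_imp_continuous_on ballI DERIV_isCont[OF df])
  have xf: "\<bar>x * f x\<bar> \<le> 1" for x
    using I_pos[of x] std_normal_density_pos[of x] by (simp add: f_def abs_mult divide_le_eq)
  \<comment> \<open>The bound on \<open>x * f x\<close> is void near 0. There I is at most 1 in
    absolute value and the density is at least its value at 1.\<close>
  have fb: "\<bar>f x\<bar> \<le> 1 + 1 / ?\<phi> 1" for x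
  proof (cases "\<bar>x\<bar> \<le> 1")
    case True
    then have "x\<^sup>2 \<le> 1" by (simp add: abs_square_le_1)
    then have "?\<phi> 1 \<le> ?\<phi> x" by (simp add: std_normal_density_def divide_right_mono)
    then have "\<bar>I x\<bar> / ?\<phi> x \<le> 1 / ?\<phi> 1"
      using I_le_1[of x] std_normal_density_pos[of 1] by (intro frac_le) auto
    then show ?thesis using std_normal_density_pos[of x] by (simp add: f_def)
  next
    case False
    then have "1 * \<bar>f x\<bar> \<le> \<bar>x\<bar> * \<bar>f x\<bar>" by (intro mult_right_mono) auto
    then have "\<bar>f x\<bar> \<le> 1" using xf[of x] by (simp add: abs_mult)
    then show ?thesis using std_normal_density_pos[of 1] by (auto intro: order_trans)
  qed
  show ?thesis
  proof (intro exI conjI allI)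
    show "(f has_real_derivative k x + x * f x) (at x)" for x by (rule df)
    show "continuous_on UNIV (\<lambda>x. k x + x * f x)" by (intro continuous_intros ck cf)
    show "\<bar>f x\<bar> \<le> 1 + 1 / ?\<phi> 1" for x by (rule fb)
    show "\<bar>k x + x * f x\<bar> \<le> 2" for x using k1[of x] xf[of x] by linarith
    show "k x + x * f x - x * f x = h x - (\<integral>y. h y \<partial>?\<gamma>)" for x by (simp add: k_def \<mu>_def)
  qed
qed

section \<open>From Lipschitz test functions to Borel sets\<close>

lemma continuous_on_real_lipschitz:
  fixes h :: "real \<Rightarrow> real"
  assumes "\<And>x y. \<bar>h x - h y\<bar> \<le> L * \<bar>x - y\<bar>"
  shows "continuous_on UNIV h"
proof -
  have "\<bar>L\<bar>-lipschitz_on UNIV h"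
  proof (rule lipschitz_onI)
    fix x y :: real
    have "L * \<bar>x - y\<bar> \<le> \<bar>L\<bar> * \<bar>x - y\<bar>" by (intro mult_right_mono) auto
    then show "dist (h x) (h y) \<le> \<bar>L\<bar> * dist x y" using assms[of x y] by (simp add: dist_real_def)
  qed simp
  then show ?thesis by (rule lipschitz_on_continuous_on)
qed

text \<open>As \<open>b\<close> does not depend on \<open>L\<close>, indicators of closed sets are
  reached as limits of functions with growing Lipschitz constants. Inner regularity approximates a
  Borel set from inside by compact sets, which bounds one signed difference; exchanging the measures
  bounds the other.\<close>

lemma total_variation_from_lipschitz:
  assumes "real_distribution \<mu>" "real_distribution \<nu>"
    and b: "\<And>h L. (\<And>x y. \<bar>h x - h y\<bar> \<le> L * \<bar>x - y\<bar>) \<Longrightarrow> (\<And>x. 0 \<le> h x) \<Longrightarrow> (\<And>x. h x \<le> 1) \<Longrightarrow>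
       \<bar>(\<integral>x. h x \<partial>\<mu>) - (\<integral>x. h x \<partial>\<nu>)\<bar> \<le> b"
    and S: "S \<in> sets borel"
  shows "\<bar>measure \<mu> S - measure \<nu> S\<bar> \<le> b"
proof -
  interpret \<mu>: real_distribution \<mu> by fact
  interpret \<nu>: real_distribution \<nu> by fact
  have b0: "0 \<le> b" using b[of "\<lambda>_. 0" 0] by simp
  have closed: "\<bar>measure \<mu> C - measure \<nu> C\<bar> \<le> b" if C: "closed C" for C
  \<comment> \<open>\<open>infdist\<close> to the empty set is 0 by convention, which would make the
    approximations below equal to 1.\<close>
  proof (cases "C = {}")
    case True then show ?thesis using b0 by simp
  next
    case False
    define h where "h n x = max 0 (1 - real n * infdist x C)" for n x
    have infd: "\<bar>infdist x C - infdist y C\<bar> \<le> \<bar>x - y\<bar>" for x y :: real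
      using infdist_triangle[of x C y] infdist_triangle[of y C x] by (auto simp: dist_real_def abs_minus_commute)
    have hl: "\<bar>h n x - h n y\<bar> \<le> real n * \<bar>x - y\<bar>" for n x y
    proof -
      have "\<bar>h n x - h n y\<bar> \<le> \<bar>real n * infdist x C - real n * infdist y C\<bar>" by (auto simp: h_def max_def)
      also have "\<dots> = real n * \<bar>infdist x C - infdist y C\<bar>" by (simp add: abs_mult flip: right_diff_distrib)
      also have "\<dots> \<le> real n * \<bar>x - y\<bar>" by (intro mult_left_mono infd) simp
      finally show ?thesis .
    qed
    have h01: "0 \<le> h n x" "h n x \<le> 1" for n x by (auto simp: h_def infdist_nonneg)
    have [measurable]: "h n \<in> borel_measurable borel" for n
      by (rule borel_measurable_continuous_onI[OF continuous_on_real_lipschitz[OF hl]])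
    have [measurable]: "C \<in> sets borel" using C by auto
    have lim: "(\<lambda>n. h n x) \<longlonglongrightarrow> indicator C x" for x
    proof (cases "x \<in> C")
      case True then show ?thesis by (simp add: h_def)
    next
      case False
      then have p: "infdist x C > 0" using C \<open>C \<noteq> {}\<close> by (metis in_closed_iff_infdist_zero infdist_nonneg less_eq_real_def)
      then obtain N where "1 / infdist x C < real N" using reals_Archimedean2 by blast
      then have N: "1 < real N * infdist x C" using p by (simp add: field_simps)
      have "\<forall>\<^sub>F n in sequentially. h n x = 0"
        using eventually_ge_at_top[of N]
      proof eventually_elim
        case (elim n)
        then have "real N * infdist x C \<le> real n * infdist x C" using p by (intro mult_right_mono) auto
        then show ?case using N by (auto simp: h_def)
      qed
      then show ?thesis using False by (simp add: tendsto_eventually)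
    qed
    have l1: "(\<lambda>n. \<integral>x. h n x \<partial>\<mu>) \<longlonglongrightarrow> (\<integral>x. indicator C x \<partial>\<mu>)"
      by (rule integral_dominated_convergence[where w="\<lambda>_. 1"]) (auto intro!: AE_I2 lim simp: h01)
    have l2: "(\<lambda>n. \<integral>x. h n x \<partial>\<nu>) \<longlonglongrightarrow> (\<integral>x. indicator C x \<partial>\<nu>)"
      by (rule integral_dominated_convergence[where w="\<lambda>_. 1"]) (auto intro!: AE_I2 lim simp: h01)
    have "(\<lambda>n. \<bar>(\<integral>x. h n x \<partial>\<mu>) - (\<integral>x. h n x \<partial>\<nu>)\<bar>) \<longlonglongrightarrow> \<bar>(\<integral>x. indicator C x \<partial>\<mu>) - (\<integral>x. indicator C x \<partial>\<nu>)\<bar>"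
      by (intro tendsto_intros l1 l2)
    then have "\<bar>(\<integral>x. indicator C x \<partial>\<mu>) - (\<integral>x. indicator C x \<partial>\<nu>)\<bar> \<le> b"
      by (rule LIMSEQ_le_const2) (use b[OF hl h01] in auto)
    then show ?thesis by simp
  qed
  have one: "measure \<alpha> S - measure \<beta> S \<le> b"
    if \<alpha>: "real_distribution \<alpha>" and \<beta>: "real_distribution \<beta>"
      and cl: "\<And>C. closed C \<Longrightarrow> measure \<alpha> C - measure \<beta> C \<le> b" for \<alpha> \<beta>
  proof (rule field_le_epsilon)
    interpret \<alpha>: real_distribution \<alpha> by fact
    interpret \<beta>: real_distribution \<beta> by fact
    fix e :: real assume "e > 0"
    have "emeasure \<alpha> S = (SUP K \<in> {K. K \<subseteq> S \<and> compact K}. emeasure \<alpha> K)"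
      by (rule inner_regular) (auto simp: S \<alpha>.emeasure_eq_measure)
    also have "\<dots> = (SUP K \<in> {K. K \<subseteq> S \<and> compact K}. ennreal (measure \<alpha> K))"
      by (simp add: \<alpha>.emeasure_eq_measure)
    finally have s: "ennreal (measure \<alpha> S) = (SUP K \<in> {K. K \<subseteq> S \<and> compact K}. ennreal (measure \<alpha> K))"
      by (simp add: \<alpha>.emeasure_eq_measure)
    have "\<exists>K. K \<subseteq> S \<and> compact K \<and> measure \<alpha> S - e < measure \<alpha> K"
    proof (rule ccontr)
      assume "\<not> ?thesis"
      then have "\<And>K. K \<subseteq> S \<Longrightarrow> compact K \<Longrightarrow> measure \<alpha> K \<le> measure \<alpha> S - e" by force
      then have "ennreal (measure \<alpha> S) \<le> ennreal (measure \<alpha> S - e)"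
        unfolding s by (intro SUP_least) (auto intro!: ennreal_leI simp flip: s)
      moreover have "0 \<le> measure \<alpha> S - e"
        using \<open>\<And>K. K \<subseteq> S \<Longrightarrow> compact K \<Longrightarrow> measure \<alpha> K \<le> measure \<alpha> S - e\<close>[of "{}"] by simp
      ultimately show False using \<open>e > 0\<close> by simp
    qed
    then obtain K where K: "K \<subseteq> S" "compact K" "measure \<alpha> S - e < measure \<alpha> K" by blast
    have "measure \<beta> K \<le> measure \<beta> S" using K(1) S by (intro \<beta>.finite_measure_mono) auto
    then show "measure \<alpha> S - measure \<beta> S \<le> b + e"
      using cl[OF compact_imp_closed[OF K(2)]] K(3) by linarith
  qed
  have "measure \<mu> S - measure \<nu> S \<le> b"
    by (rule one) (use assms closed in \<open>auto simp: abs_le_iff\<close>)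
  moreover have "measure \<nu> S - measure \<mu> S \<le> b"
    by (rule one) (use assms closed in \<open>auto simp: abs_le_iff\<close>)
  ultimately show ?thesis by (simp add: abs_le_iff)
qed

section \<open>Sums over spanning trees and cycles\<close>

text \<open>The finite form of convolution estimates: summing out a leaf of a tree costs the row
  bound of the kernel on its edge.\<close>

definition row_bounded :: "nat set \<Rightarrow> real \<Rightarrow> (nat \<Rightarrow> nat \<Rightarrow> real) \<Rightarrow> bool" where
  "row_bounded I U u \<longleftrightarrow> (\<forall>i\<in>I. (\<Sum>j\<in>I. u i j) \<le> U) \<and> (\<forall>i j. 0 \<le> u i j) \<and> (\<forall>i j. u i j = u j i)"

text \<open>The vertex l occurs only in the edge that joins it to i, j or k, so it is summed out at
  cost \<open>U\<close> for each of the three choices.\<close>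

lemma row_bounded_leaf:
  assumes u: "row_bounded I U u" and b: "\<And>i j k. 0 \<le> b i j k"
  shows "(\<Sum>i\<in>I. \<Sum>j\<in>I. \<Sum>k\<in>I. \<Sum>l\<in>I. (u i l + u j l + u k l) * b i j k) \<le> 3 * U * (\<Sum>i\<in>I. \<Sum>j\<in>I. \<Sum>k\<in>I. b i j k)"
proof -
  have "(\<Sum>l\<in>I. (u i l + u j l + u k l) * b i j k) \<le> 3 * U * b i j k" if "i \<in> I" "j \<in> I" "k \<in> I" for i j k
  proof -
    have "(\<Sum>l\<in>I. (u i l + u j l + u k l) * b i j k) = ((\<Sum>l\<in>I. u i l) + (\<Sum>l\<in>I. u j l) + (\<Sum>l\<in>I. u k l)) * b i j k"
      by (simp add: sum_distrib_right sum.distrib distrib_right)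
    also have "\<dots> \<le> (U + U + U) * b i j k"
      using u that by (intro mult_right_mono add_mono b) (auto simp: row_bounded_def)
    finally show ?thesis by simp
  qed
  then show ?thesis
    by (simp add: sum_distrib_left sum_mono)
qed

lemma row_bounded_nonneg: "row_bounded I U u \<Longrightarrow> i \<in> I \<Longrightarrow> 0 \<le> U"
  unfolding row_bounded_def by (meson order_trans sum_nonneg)

lemma row_bounded_star:
  assumes u: "row_bounded I U u" and v: "row_bounded I V v" and "finite I"
  shows "(\<Sum>i\<in>I. \<Sum>j\<in>I. \<Sum>k\<in>I. u i j * v i k) \<le> real (card I) * U * V"
proof -
  have "(\<Sum>j\<in>I. \<Sum>k\<in>I. u i j * v i k) \<le> U * V" if "i \<in> I" for i
  proof -
    have "(\<Sum>j\<in>I. \<Sum>k\<in>I. u i j * v i k) = (\<Sum>j\<in>I. u i j) * (\<Sum>k\<in>I. v i k)"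
      by (simp add: sum_product)
    also have "\<dots> \<le> U * V"
      using u v that by (intro mult_mono row_bounded_nonneg[OF u]) (auto simp: row_bounded_def intro!: sum_nonneg)
    finally show ?thesis .
  qed
  then have "(\<Sum>i\<in>I. \<Sum>j\<in>I. \<Sum>k\<in>I. u i j * v i k) \<le> (\<Sum>i\<in>I. U * V)" by (intro sum_mono)
  then show ?thesis by (simp add: mult.assoc)
qed

text \<open>A path on three vertices is a star about its middle vertex, which is i, j and k in the
  three statements.\<close>

lemma row_bounded_paths:
  assumes u: "row_bounded I U u" and v: "row_bounded I V v" and fin: "finite I"
  shows "(\<Sum>i\<in>I. \<Sum>j\<in>I. \<Sum>k\<in>I. u i j * v i k) \<le> real (card I) * U * V"
    and "(\<Sum>i\<in>I. \<Sum>j\<in>I. \<Sum>k\<in>I. u i j * v j k) \<le> real (card I) * U * V"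
    and "(\<Sum>i\<in>I. \<Sum>j\<in>I. \<Sum>k\<in>I. u i k * v j k) \<le> real (card I) * U * V"
proof -
  have su: "u i j = u j i" and sv: "v i j = v j i" for i j using u v by (auto simp: row_bounded_def)
  show "(\<Sum>i\<in>I. \<Sum>j\<in>I. \<Sum>k\<in>I. u i j * v i k) \<le> real (card I) * U * V"
    by (rule row_bounded_star[OF u v fin])
  have "(\<Sum>i\<in>I. \<Sum>j\<in>I. \<Sum>k\<in>I. u i j * v j k) = (\<Sum>j\<in>I. \<Sum>i\<in>I. \<Sum>k\<in>I. u j i * v j k)"
    by (subst sum.swap) (simp add: su)
  then show "(\<Sum>i\<in>I. \<Sum>j\<in>I. \<Sum>k\<in>I. u i j * v j k) \<le> real (card I) * U * V"
    using row_bounded_star[OF u v fin] by simp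
  have "(\<Sum>i\<in>I. \<Sum>j\<in>I. \<Sum>k\<in>I. u i k * v j k) = (\<Sum>i\<in>I. \<Sum>k\<in>I. \<Sum>j\<in>I. u k i * v k j)"
    by (subst (2) sum.swap) (simp add: su sv)
  also have "\<dots> = (\<Sum>k\<in>I. \<Sum>i\<in>I. \<Sum>j\<in>I. u k i * v k j)"
    by (rule sum.swap)
  finally show "(\<Sum>i\<in>I. \<Sum>j\<in>I. \<Sum>k\<in>I. u i k * v j k) \<le> real (card I) * U * V"
    using row_bounded_star[OF u v fin] by simp
qed

definition sum4 :: "nat set \<Rightarrow> (nat \<Rightarrow> nat \<Rightarrow> nat \<Rightarrow> nat \<Rightarrow> real) \<Rightarrow> real" where
  "sum4 I f = (\<Sum>i\<in>I. \<Sum>j\<in>I. \<Sum>k\<in>I. \<Sum>l\<in>I. f i j k l)"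

lemma sum4_add: "sum4 I (\<lambda>i j k l. f i j k l + g i j k l) = sum4 I f + sum4 I g"
  by (simp add: sum4_def sum.distrib)

lemma sum4_mono: "(\<And>i j k l. f i j k l \<le> g i j k l) \<Longrightarrow> sum4 I f \<le> sum4 I g"
  by (simp add: sum4_def sum_mono)

lemma sum4_swap34: "sum4 I f = sum4 I (\<lambda>i j k l. f i j l k)"
  unfolding sum4_def by (rule sum.cong[OF refl], rule sum.cong[OF refl], rule sum.swap)

lemma sum4_swap23: "sum4 I f = sum4 I (\<lambda>i j k l. f i k j l)"
  unfolding sum4_def by (rule sum.cong[OF refl], rule sum.swap)

lemma sum4_swap12: "sum4 I f = sum4 I (\<lambda>i j k l. f j i k l)"
  unfolding sum4_def by (rule sum.swap)

text \<open>The statements differ in which of the four vertices is the leaf; each follows from the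
  preceding one by a transposition of summation variables.\<close>

lemma sum4_leaf:
  assumes ne: "I \<noteq> {}" and u: "row_bounded I U u" and b: "\<And>i j k. 0 \<le> b i j k"
    and B: "(\<Sum>i\<in>I. \<Sum>j\<in>I. \<Sum>k\<in>I. b i j k) \<le> B"
  shows "sum4 I (\<lambda>i j k l. (u i l + u j l + u k l) * b i j k) \<le> 3 * U * B"
    and "sum4 I (\<lambda>i j k l. (u i k + u j k + u l k) * b i j l) \<le> 3 * U * B"
    and "sum4 I (\<lambda>i j k l. (u i j + u k j + u l j) * b i k l) \<le> 3 * U * B"
    and "sum4 I (\<lambda>i j k l. (u j i + u k i + u l i) * b j k l) \<le> 3 * U * B"
proof -
  have "0 \<le> U" using row_bounded_nonneg[OF u] ne by blast
  then have "3 * U * (\<Sum>i\<in>I. \<Sum>j\<in>I. \<Sum>k\<in>I. b i j k) \<le> 3 * U * B" using B by (intro mult_left_mono) auto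
  then show 1: "sum4 I (\<lambda>i j k l. (u i l + u j l + u k l) * b i j k) \<le> 3 * U * B"
    unfolding sum4_def using row_bounded_leaf[OF u b] by (rule order_trans[rotated])
  show 2: "sum4 I (\<lambda>i j k l. (u i k + u j k + u l k) * b i j l) \<le> 3 * U * B"
    using 1 by (subst sum4_swap34)
  show 3: "sum4 I (\<lambda>i j k l. (u i j + u k j + u l j) * b i k l) \<le> 3 * U * B"
    using 2 by (subst sum4_swap23)
  show "sum4 I (\<lambda>i j k l. (u j i + u k i + u l i) * b j k l) \<le> 3 * U * B"
    using 3 by (subst sum4_swap12)
qed

section \<open>Domination of diagrams by trees and cycles\<close>

text \<open>Replacing each base by the largest one gives a single power with exponent at least d of
  a number in [0, 1]. At a vertex of degree at least d this turns its three edges into one edge with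
  exponent d.\<close>

lemma power_product_le:
  fixes x y z :: real
  assumes "0 \<le> x" "x \<le> 1" "0 \<le> y" "y \<le> 1" "0 \<le> z" "z \<le> 1" "d \<le> p + q + r"
  shows "x ^ p * y ^ q * z ^ r \<le> x ^ d + y ^ d + z ^ d"
proof -
  define m where "m = max x (max y z)"
  have m: "x \<le> m" "y \<le> m" "z \<le> m" "0 \<le> m" "m \<le> 1" using assms by (auto simp: m_def)
  have "x ^ p * y ^ q * z ^ r \<le> m ^ p * m ^ q * m ^ r"
    using assms m by (intro mult_mono power_mono) auto
  also have "\<dots> = m ^ (p + q + r)" by (simp add: power_add)
  also have "\<dots> \<le> m ^ d" using assms m by (intro power_decreasing) auto
  also have "\<dots> \<le> x ^ d + y ^ d + z ^ d" using assms by (auto simp: m_def max_def)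
  finally show ?thesis .
qed

lemma power_product2_le:
  fixes x y :: real
  assumes "0 \<le> x" "x \<le> 1" "0 \<le> y" "y \<le> 1" "2 \<le> p + q"
  shows "x ^ p * y ^ q \<le> x\<^sup>2 + y\<^sup>2"
  using power_product_le[of x y 0 2 p q 0] assms by simp

text \<open>Each summand joins, by an edge with exponent \<open>d\<close>, a leaf to a path with two edges with exponents
  1 and 2 on the other three vertices, so that it sums over all vertices like a spanning tree.\<close>

definition tree_weight :: "nat \<Rightarrow> real \<Rightarrow> real \<Rightarrow> real \<Rightarrow> real \<Rightarrow> real \<Rightarrow> real \<Rightarrow> real" where
  "tree_weight d x12 x34 x13 x14 x23 x24 =
     (x12 ^ d + x23 ^ d + x24 ^ d) * (x34\<^sup>2 * x13 + x34\<^sup>2 * x14)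
   + (x12 ^ d + x13 ^ d + x14 ^ d) * (x34\<^sup>2 * x23 + x34\<^sup>2 * x24)
   + (x14 ^ d + x24 ^ d + x34 ^ d) * (x12 * x13\<^sup>2 + x12 * x23\<^sup>2)
   + (x13 ^ d + x23 ^ d + x34 ^ d) * (x12 * x14\<^sup>2 + x12 * x24\<^sup>2)
   + (x12 ^ d + x23 ^ d + x24 ^ d) * (x34 * x13\<^sup>2 + x34 * x14\<^sup>2)
   + (x12 ^ d + x13 ^ d + x14 ^ d) * (x34 * x23\<^sup>2 + x34 * x24\<^sup>2)"

text \<open>The two 4-cycles through the edges 12 and 34. They are the diagrams containing these
  edges in which every vertex has degree 2 and no edge is repeated; for d \<ge> 3 the degrees are
  too large for that.\<close>

definition cycle_weight :: "nat \<Rightarrow> real \<Rightarrow> real \<Rightarrow> real \<Rightarrow> real \<Rightarrow> real \<Rightarrow> real \<Rightarrow> real" where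
  "cycle_weight d x12 x34 x13 x14 x23 x24 =
     (if d = 2 then x12 * x24 * x34 * x13 + x12 * x23 * x34 * x14 else 0)"

text \<open>The additional edges 12 and 34 raise every degree to at least d = k + 1. Collecting the
  edges at one vertex by \<open>power_product_le\<close> makes it a leaf, and the edges among the
  other three vertices must provide a path with exponents 1 and 2. If u, v \<ge> 1, a cross edge
  such as 13 and the edge 34, with exponent at least 2, form that path, with leaf 2. If u = 0 and
  vertex 3 carries at least two cross edges, these and the edge 12 form it, with leaf 4; similarly
  with 3 and 4 exchanged. For v = 0 the two pairs change roles. The 4-cycles are what
  remains.\<close>

lemma diagram_weight_le:
  fixes x12 x34 x13 x14 x23 x24 :: real
  assumes r: "0 \<le> x12" "x12 \<le> 1" "0 \<le> x34" "x34 \<le> 1" "0 \<le> x13" "x13 \<le> 1" "0 \<le> x14" "x14 \<le> 1"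
      "0 \<le> x23" "x23 \<le> 1" "0 \<le> x24" "x24 \<le> 1"
    and k: "1 \<le> k" "k \<le> u + A + B" "k \<le> u + C + D" "k \<le> v + A + C" "k \<le> v + B + D"
    and cross: "0 < A + B + C + D"
  shows "x12 ^ Suc u * x34 ^ Suc v * x13 ^ A * x14 ^ B * x23 ^ C * x24 ^ D
    \<le> tree_weight (Suc k) x12 x34 x13 x14 x23 x24 + cycle_weight (Suc k) x12 x34 x13 x14 x23 x24"
proof -
  let ?P = "x12 ^ Suc u * x34 ^ Suc v * x13 ^ A * x14 ^ B * x23 ^ C * x24 ^ D"
  let ?d = "Suc k"
  let ?W = "tree_weight ?d x12 x34 x13 x14 x23 x24" and ?C = "cycle_weight ?d x12 x34 x13 x14 x23 x24"
  let ?L1 = "x12 ^ ?d + x13 ^ ?d + x14 ^ ?d" and ?L2 = "x12 ^ ?d + x23 ^ ?d + x24 ^ ?d"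
  let ?L3 = "x13 ^ ?d + x23 ^ ?d + x34 ^ ?d" and ?L4 = "x14 ^ ?d + x24 ^ ?d + x34 ^ ?d"
  note nn = mult_nonneg_nonneg add_nonneg_nonneg zero_le_power
  have L: "0 \<le> ?L1" "0 \<le> ?L2" "0 \<le> ?L3" "0 \<le> ?L4" using r by auto
  have b: "0 \<le> x34\<^sup>2 * x13" "0 \<le> x34\<^sup>2 * x14" "0 \<le> x34\<^sup>2 * x23" "0 \<le> x34\<^sup>2 * x24"
    "0 \<le> x12 * x13\<^sup>2" "0 \<le> x12 * x23\<^sup>2" "0 \<le> x12 * x14\<^sup>2" "0 \<le> x12 * x24\<^sup>2"
    "0 \<le> x34 * x13\<^sup>2" "0 \<le> x34 * x14\<^sup>2" "0 \<le> x34 * x23\<^sup>2" "0 \<le> x34 * x24\<^sup>2"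
    using r by auto
  have W0: "0 \<le> ?W"
    unfolding tree_weight_def
    by (rule add_nonneg_nonneg mult_nonneg_nonneg[OF L(1)] mult_nonneg_nonneg[OF L(2)] mult_nonneg_nonneg[OF L(3)]
        mult_nonneg_nonneg[OF L(4)] b)+
  have C0: "0 \<le> ?C"
    unfolding cycle_weight_def using r by auto
  \<comment> \<open>Each nonnegative summand is at most the whole sum; the eight bounds are packed
    into one \<open>max\<close>, to be instantiated once with \<open>tree_weight\<close>.\<close>
  have g: "p1 * (a1 + a2) + p2 * (b1 + b2) + p3 * c + p4 * e + p5 * f + p6 * g \<ge> max (max (max (p1 * a1) (p1 * a2)) (max (p2 * b1) (p2 * b2))) (max (max (p3 * c) (p4 * e)) (max (p5 * f) (p6 * g)))"
    if "0 \<le> p1" "0 \<le> p2" "0 \<le> p3" "0 \<le> p4" "0 \<le> p5" "0 \<le> p6" "0 \<le> a1" "0 \<le> a2" "0 \<le> b1" "0 \<le> b2" "0 \<le> c" "0 \<le> e" "0 \<le> f" "0 \<le> g"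
    for p1 p2 p3 p4 p5 p6 a1 a2 b1 b2 c e f g :: real
  proof -
    have "0 \<le> p1 * a1" "0 \<le> p1 * a2" "0 \<le> p2 * b1" "0 \<le> p2 * b2" "0 \<le> p3 * c" "0 \<le> p4 * e" "0 \<le> p5 * f" "0 \<le> p6 * g"
      using that by auto
    then show ?thesis by (simp add: distrib_left)
  qed
  have bound: "max (max (max (?L2 * (x34\<^sup>2 * x13)) (?L2 * (x34\<^sup>2 * x14))) (max (?L1 * (x34\<^sup>2 * x23)) (?L1 * (x34\<^sup>2 * x24))))
     (max (max (?L4 * (x12 * x13\<^sup>2 + x12 * x23\<^sup>2)) (?L3 * (x12 * x14\<^sup>2 + x12 * x24\<^sup>2)))
       (max (?L2 * (x34 * x13\<^sup>2 + x34 * x14\<^sup>2)) (?L1 * (x34 * x23\<^sup>2 + x34 * x24\<^sup>2)))) \<le> ?W"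
    unfolding tree_weight_def by (rule g; (rule L | rule b | (rule add_nonneg_nonneg; rule b)))
  have t: "?L2 * (x34\<^sup>2 * x13) \<le> ?W"
    "?L2 * (x34\<^sup>2 * x14) \<le> ?W"
    "?L1 * (x34\<^sup>2 * x23) \<le> ?W"
    "?L1 * (x34\<^sup>2 * x24) \<le> ?W"
    "?L4 * (x12 * x13\<^sup>2 + x12 * x23\<^sup>2) \<le> ?W"
    "?L3 * (x12 * x14\<^sup>2 + x12 * x24\<^sup>2) \<le> ?W"
    "?L2 * (x34 * x13\<^sup>2 + x34 * x14\<^sup>2) \<le> ?W"
    "?L1 * (x34 * x23\<^sup>2 + x34 * x24\<^sup>2) \<le> ?W"
    using bound by (simp_all only: max.bounded_iff)
  have pd: "x ^ n \<le> x" if "0 \<le> x" "x \<le> 1" "1 \<le> n" for x :: real and n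
    using power_decreasing[of 1 n x] that by simp
  have pd2: "x ^ n \<le> x\<^sup>2" if "0 \<le> x" "x \<le> 1" "2 \<le> n" for x :: real and n
    using power_decreasing[of 2 n x] that by simp
  have p1: "x ^ n \<le> 1" if "0 \<le> x" "x \<le> 1" for x :: real and n
    using power_le_one[of x n] that by simp
  have L1: "x12 ^ Suc u * x13 ^ A * x14 ^ B \<le> ?L1" using r k by (intro power_product_le) auto
  have L2: "x12 ^ Suc u * x23 ^ C * x24 ^ D \<le> ?L2" using r k by (intro power_product_le) auto
  have L3: "x13 ^ A * x23 ^ C * x34 ^ Suc v \<le> ?L3" using r k by (intro power_product_le) auto
  have L4: "x14 ^ B * x24 ^ D * x34 ^ Suc v \<le> ?L4" using r k by (intro power_product_le) auto
  have "?P \<le> ?W \<or> ?P \<le> ?C"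
  proof -
    consider (pos) "1 \<le> u" "1 \<le> v" | (u0) "u = 0" | (v0) "v = 0" by linarith
    then show ?thesis
    proof cases
      case pos
      have v2: "x34 ^ Suc v \<le> x34\<^sup>2" using r pos by (intro pd2) auto
      consider "1 \<le> A" | "1 \<le> B" | "1 \<le> C" | "1 \<le> D" using cross by linarith
      then show ?thesis
      proof cases
        case 1
        have "?P = (x12 ^ Suc u * x23 ^ C * x24 ^ D) * (x34 ^ Suc v * x13 ^ A) * x14 ^ B" by (simp only: mult_ac)
        also have "\<dots> \<le> ?L2 * (x34\<^sup>2 * x13) * 1"
          using r 1 by (intro mult_mono L2 v2 pd p1 nn) auto
        finally show ?thesis using t by (simp only: mult_1_right) linarith
      next
        case 2
        have "?P = (x12 ^ Suc u * x23 ^ C * x24 ^ D) * (x34 ^ Suc v * x14 ^ B) * x13 ^ A" by (simp only: mult_ac)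
        also have "\<dots> \<le> ?L2 * (x34\<^sup>2 * x14) * 1"
          using r 2 by (intro mult_mono L2 v2 pd p1 nn) auto
        finally show ?thesis using t by (simp only: mult_1_right) linarith
      next
        case 3
        have "?P = (x12 ^ Suc u * x13 ^ A * x14 ^ B) * (x34 ^ Suc v * x23 ^ C) * x24 ^ D" by (simp only: mult_ac)
        also have "\<dots> \<le> ?L1 * (x34\<^sup>2 * x23) * 1"
          using r 3 by (intro mult_mono L1 v2 pd p1 nn) auto
        finally show ?thesis using t by (simp only: mult_1_right) linarith
      next
        case 4
        have "?P = (x12 ^ Suc u * x13 ^ A * x14 ^ B) * (x34 ^ Suc v * x24 ^ D) * x23 ^ C" by (simp only: mult_ac)
        also have "\<dots> \<le> ?L1 * (x34\<^sup>2 * x24) * 1"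
          using r 4 by (intro mult_mono L1 v2 pd p1 nn) auto
        finally show ?thesis using t by (simp only: mult_1_right) linarith
      qed
    next
      case u0
      consider "2 \<le> A + C" | "2 \<le> B + D" | "A + C \<le> 1" "B + D \<le> 1" by linarith
      then show ?thesis
      proof cases
        case 1
        have "?P = (x14 ^ B * x24 ^ D * x34 ^ Suc v) * (x12 * (x13 ^ A * x23 ^ C))" by (simp add: u0 mult_ac)
        also have "\<dots> \<le> ?L4 * (x12 * (x13\<^sup>2 + x23\<^sup>2))"
          using r 1 by (intro mult_mono L4 power_product2_le nn) auto
        finally show ?thesis using t by (simp only: distrib_left) linarith
      next
        case 2
        have "?P = (x13 ^ A * x23 ^ C * x34 ^ Suc v) * (x12 * (x14 ^ B * x24 ^ D))" by (simp add: u0 mult_ac)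
        also have "\<dots> \<le> ?L3 * (x12 * (x14\<^sup>2 + x24\<^sup>2))"
          using r 2 by (intro mult_mono L3 power_product2_le nn) auto
        finally show ?thesis using t by (simp only: distrib_left) linarith
      next
        case 3
        \<comment> \<open>The vertices 1 and 2 need k cross edges each, so 2 * k \<le> A + B + C + D
          \<le> 2. The cross edges then match {1, 2} with {3, 4}, which closes a 4-cycle.\<close>
        then have k1: "k = 1" using k u0 by linarith
        have vv: "x34 ^ Suc v \<le> x34" using r by (intro pd) auto
        consider "A = 1" "D = 1" "B = 0" "C = 0" | "A = 0" "D = 0" "B = 1" "C = 1"
          using 3 k u0 k1 by linarith
        then show ?thesis
        proof cases
          case 1
          have "?P = (x12 * x24) * x34 ^ Suc v * x13" by (simp add: u0 1 mult_ac)
          also have "\<dots> \<le> (x12 * x24) * x34 * x13" using r by (intro mult_mono vv nn) auto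
          also have "\<dots> \<le> ?C"
            using r by (simp add: k1 cycle_weight_def)
          finally show ?thesis by simp
        next
          case 2
          have "?P = (x12 * x23) * x34 ^ Suc v * x14" by (simp add: u0 2 mult_ac)
          also have "\<dots> \<le> (x12 * x23) * x34 * x14" using r by (intro mult_mono vv nn) auto
          also have "\<dots> \<le> ?C"
            using r by (simp add: k1 cycle_weight_def)
          finally show ?thesis by simp
        qed
      qed
    next
      case v0
      consider "2 \<le> A + B" | "2 \<le> C + D" | "A + B \<le> 1" "C + D \<le> 1" by linarith
      then show ?thesis
      proof cases
        case 1
        have "?P = (x12 ^ Suc u * x23 ^ C * x24 ^ D) * (x34 * (x13 ^ A * x14 ^ B))" by (simp add: v0 mult_ac)
        also have "\<dots> \<le> ?L2 * (x34 * (x13\<^sup>2 + x14\<^sup>2))"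
          using r 1 by (intro mult_mono L2 power_product2_le nn) auto
        finally show ?thesis using t by (simp only: distrib_left) linarith
      next
        case 2
        have "?P = (x12 ^ Suc u * x13 ^ A * x14 ^ B) * (x34 * (x23 ^ C * x24 ^ D))" by (simp add: v0 mult_ac)
        also have "\<dots> \<le> ?L1 * (x34 * (x23\<^sup>2 + x24\<^sup>2))"
          using r 2 by (intro mult_mono L1 power_product2_le nn) auto
        finally show ?thesis using t by (simp only: distrib_left) linarith
      next
        case 3
        then have k1: "k = 1" using k v0 by linarith
        have uu: "x12 ^ Suc u \<le> x12" using r by (intro pd) auto
        consider "A = 1" "D = 1" "B = 0" "C = 0" | "A = 0" "D = 0" "B = 1" "C = 1"
          using 3 k v0 k1 by linarith
        then show ?thesis
        proof cases
          case 1
          have "?P = x12 ^ Suc u * x24 * x34 * x13" by (simp add: v0 1 mult_ac)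
          also have "\<dots> \<le> x12 * x24 * x34 * x13" using r by (intro mult_mono uu nn) auto
          also have "\<dots> \<le> ?C"
            using r by (simp add: k1 cycle_weight_def)
          finally show ?thesis by simp
        next
          case 2
          have "?P = x12 ^ Suc u * x23 * x34 * x14" by (simp add: v0 2 mult_ac)
          also have "\<dots> \<le> x12 * x23 * x34 * x14" using r by (intro mult_mono uu nn) auto
          also have "\<dots> \<le> ?C"
            using r by (simp add: k1 cycle_weight_def)
          finally show ?thesis by simp
        qed
      qed
    qed
  qed
  then show ?thesis using W0 C0 by linarith
qed

text \<open>Six leaf factors times two paths each make twelve products. Each product sums to at most
  \<open>3 * Sd * (real (card I) * S1 * S2)\<close>, the 3 counting the edges in a leaf factor;
  hence 36.\<close>

lemma sum4_tree_weight:
  fixes r :: "nat \<Rightarrow> nat \<Rightarrow> real"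
  assumes fin: "finite I" and ne: "I \<noteq> {}" and 1: "row_bounded I S1 r" and 2: "row_bounded I S2 (\<lambda>i j. (r i j)\<^sup>2)"
    and d: "row_bounded I Sd (\<lambda>i j. r i j ^ d)"
  shows "sum4 I (\<lambda>i j k l. tree_weight d (r i j) (r k l) (r i k) (r i l) (r j k) (r j l))
    \<le> 36 * real (card I) * S1 * S2 * Sd"
proof -
  have s: "r i j = r j i" for i j using 1 by (auto simp: row_bounded_def)
  have r0: "0 \<le> r i j" for i j using 1 by (auto simp: row_bounded_def)
  let ?N = "real (card I) * S1 * S2"
  note p12 = row_bounded_paths[OF 1 2 fin]
  have "real (card I) * S2 * S1 = ?N" by (simp add: mult_ac)
  note p21 = row_bounded_paths[OF 2 1 fin, unfolded this]
  have conv: "sum4 I f \<le> B" if "sum4 I g \<le> B" "\<And>i j k l. f i j k l = g i j k l" for f g B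
  proof -
    have "f = g" using that(2) by (intro ext)
    with that(1) show ?thesis by simp
  qed
  have f: "(x + y + z) * (p + q) = (x + y + z) * p + (x + y + z) * q" for x y z p q :: real
    by (rule distrib_left)
  have N: "3 * Sd * ?N = 3 * real (card I) * S1 * S2 * Sd" by (simp add: mult_ac)
  have t: "sum4 I (\<lambda>i j k l. ((r i j) ^ d + (r j k) ^ d + (r j l) ^ d) * ((r k l)\<^sup>2 * r i k)) \<le> 3 * Sd * ?N"
    "sum4 I (\<lambda>i j k l. ((r i j) ^ d + (r j k) ^ d + (r j l) ^ d) * ((r k l)\<^sup>2 * r i l)) \<le> 3 * Sd * ?N"
    "sum4 I (\<lambda>i j k l. ((r i j) ^ d + (r i k) ^ d + (r i l) ^ d) * ((r k l)\<^sup>2 * r j k)) \<le> 3 * Sd * ?N"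
    "sum4 I (\<lambda>i j k l. ((r i j) ^ d + (r i k) ^ d + (r i l) ^ d) * ((r k l)\<^sup>2 * r j l)) \<le> 3 * Sd * ?N"
    "sum4 I (\<lambda>i j k l. ((r i l) ^ d + (r j l) ^ d + (r k l) ^ d) * (r i j * (r i k)\<^sup>2)) \<le> 3 * Sd * ?N"
    "sum4 I (\<lambda>i j k l. ((r i l) ^ d + (r j l) ^ d + (r k l) ^ d) * (r i j * (r j k)\<^sup>2)) \<le> 3 * Sd * ?N"
    "sum4 I (\<lambda>i j k l. ((r i k) ^ d + (r j k) ^ d + (r k l) ^ d) * (r i j * (r i l)\<^sup>2)) \<le> 3 * Sd * ?N"
    "sum4 I (\<lambda>i j k l. ((r i k) ^ d + (r j k) ^ d + (r k l) ^ d) * (r i j * (r j l)\<^sup>2)) \<le> 3 * Sd * ?N"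
    "sum4 I (\<lambda>i j k l. ((r i j) ^ d + (r j k) ^ d + (r j l) ^ d) * (r k l * (r i k)\<^sup>2)) \<le> 3 * Sd * ?N"
    "sum4 I (\<lambda>i j k l. ((r i j) ^ d + (r j k) ^ d + (r j l) ^ d) * (r k l * (r i l)\<^sup>2)) \<le> 3 * Sd * ?N"
    "sum4 I (\<lambda>i j k l. ((r i j) ^ d + (r i k) ^ d + (r i l) ^ d) * (r k l * (r j k)\<^sup>2)) \<le> 3 * Sd * ?N"
    "sum4 I (\<lambda>i j k l. ((r i j) ^ d + (r i k) ^ d + (r i l) ^ d) * (r k l * (r j l)\<^sup>2)) \<le> 3 * Sd * ?N"
    subgoal by (rule conv[OF sum4_leaf(3)[OF ne d _ p12(2)]]) (use r0 in \<open>auto simp: s mult_ac add_ac\<close>)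
    subgoal by (rule conv[OF sum4_leaf(3)[OF ne d _ p12(3)]]) (use r0 in \<open>auto simp: s mult_ac add_ac\<close>)
    subgoal by (rule conv[OF sum4_leaf(4)[OF ne d _ p12(2)]]) (use r0 in \<open>auto simp: s mult_ac add_ac\<close>)
    subgoal by (rule conv[OF sum4_leaf(4)[OF ne d _ p12(3)]]) (use r0 in \<open>auto simp: s mult_ac add_ac\<close>)
    subgoal by (rule conv[OF sum4_leaf(1)[OF ne d _ p12(1)]]) (use r0 in \<open>auto simp: s mult_ac add_ac\<close>)
    subgoal by (rule conv[OF sum4_leaf(1)[OF ne d _ p12(2)]]) (use r0 in \<open>auto simp: s mult_ac add_ac\<close>)
    subgoal by (rule conv[OF sum4_leaf(2)[OF ne d _ p12(1)]]) (use r0 in \<open>auto simp: s mult_ac add_ac\<close>)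
    subgoal by (rule conv[OF sum4_leaf(2)[OF ne d _ p12(2)]]) (use r0 in \<open>auto simp: s mult_ac add_ac\<close>)
    subgoal by (rule conv[OF sum4_leaf(3)[OF ne d _ p21(2)]]) (use r0 in \<open>auto simp: s mult_ac add_ac\<close>)
    subgoal by (rule conv[OF sum4_leaf(3)[OF ne d _ p21(3)]]) (use r0 in \<open>auto simp: s mult_ac add_ac\<close>)
    subgoal by (rule conv[OF sum4_leaf(4)[OF ne d _ p21(2)]]) (use r0 in \<open>auto simp: s mult_ac add_ac\<close>)
    subgoal by (rule conv[OF sum4_leaf(4)[OF ne d _ p21(3)]]) (use r0 in \<open>auto simp: s mult_ac add_ac\<close>)
    done
  show ?thesis
    unfolding tree_weight_def f sum4_add using t N by linarith
qed

section \<open>Sums over 4-cycles\<close>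

text \<open>The smallest factor is split into three cube roots, each of which is increased to the
  cube root of one of the other factors.\<close>

lemma four_product_le_min:
  fixes x y z w :: real
  assumes "0 \<le> w" "w \<le> x" "w \<le> y" "w \<le> z"
  shows "x * y * z * w \<le> x powr (4/3) * y powr (4/3) * z powr (4/3)"
proof -
  have p: "a powr (4/3) = a * a powr (1/3)" if "0 \<le> a" for a :: real
    using that powr_add[of a 1 "1/3"] by (cases "a = 0") auto
  have "w = w powr (1/3) * w powr (1/3) * w powr (1/3)"
    using assms by (cases "w = 0") (simp_all add: powr_add[symmetric])
  also have "\<dots> \<le> x powr (1/3) * y powr (1/3) * z powr (1/3)"
    using assms by (intro mult_mono powr_mono2) auto
  finally have "x * y * z * w \<le> x * y * z * (x powr (1/3) * y powr (1/3) * z powr (1/3))"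
    using assms by (intro mult_left_mono) auto
  also have "\<dots> = x powr (4/3) * y powr (4/3) * z powr (4/3)"
    using assms by (simp add: p mult_ac)
  finally show ?thesis .
qed

text \<open>The right-hand side sums over which factor is the smallest. For the edges of a 4-cycle,
  dropping one leaves a spanning path with exponents 4/3, which is the source of that exponent in
  the estimate for d = 2.\<close>

lemma four_product_le:
  fixes x y z w :: real
  assumes "0 \<le> x" "0 \<le> y" "0 \<le> z" "0 \<le> w"
  shows "x * y * z * w \<le> x powr (4/3) * y powr (4/3) * z powr (4/3) + x powr (4/3) * y powr (4/3) * w powr (4/3)
     + x powr (4/3) * z powr (4/3) * w powr (4/3) + y powr (4/3) * z powr (4/3) * w powr (4/3)"
    (is "_ \<le> ?a + ?b + ?c + ?d")
proof -
  have "0 \<le> ?a" "0 \<le> ?b" "0 \<le> ?c" "0 \<le> ?d" by auto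
  moreover consider "w \<le> x" "w \<le> y" "w \<le> z" | "z \<le> x" "z \<le> y" "z \<le> w" | "y \<le> x" "y \<le> z" "y \<le> w" | "x \<le> y" "x \<le> z" "x \<le> w"
    by linarith
  then have "x * y * z * w \<le> ?a \<or> x * y * z * w \<le> ?b \<or> x * y * z * w \<le> ?c \<or> x * y * z * w \<le> ?d"
  proof cases
    case 1 then show ?thesis using four_product_le_min[of w x y z] assms by simp
  next
    case 2 then show ?thesis using four_product_le_min[of z x y w] assms by (simp add: mult_ac)
  next
    case 3 then show ?thesis using four_product_le_min[of y x z w] assms by (simp add: mult_ac)
  next
    case 4 then show ?thesis using four_product_le_min[of x y z w] assms by (simp add: mult_ac)
  qed
  ultimately show ?thesis by linarith
qed

lemma sum4_cycle_weight:
  fixes r :: "nat \<Rightarrow> nat \<Rightarrow> real"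
  assumes fin: "finite I" and ne: "I \<noteq> {}" and r0: "\<And>i j. 0 \<le> r i j"
    and Q: "row_bounded I Q (\<lambda>i j. r i j powr (4/3))"
  shows "sum4 I (\<lambda>i j k l. cycle_weight 2 (r i j) (r k l) (r i k) (r i l) (r j k) (r j l))
    \<le> 12 * real (card I) * Q ^ 3"
proof -
  let ?q = "\<lambda>i j. r i j powr (4/3)"
  let ?N = "real (card I) * Q * Q"
  have s: "?q i j = ?q j i" for i j using Q by (auto simp: row_bounded_def)
  have q0: "0 \<le> ?q i j" for i j by simp
  note p = row_bounded_paths[OF Q Q fin]
  have conv: "sum4 I f \<le> B" if "sum4 I g \<le> B" "\<And>i j k l. f i j k l = g i j k l" for f g B
  proof -
    have "f = g" using that(2) by (intro ext)
    with that(1) show ?thesis by simp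
  qed
  let ?L1 = "\<lambda>i j k l. ?q i j + ?q i k + ?q i l"
  let ?L3 = "\<lambda>i j k l. ?q i k + ?q j k + ?q k l"
  let ?L4 = "\<lambda>i j k l. ?q i l + ?q j l + ?q k l"
  have t: "sum4 I (\<lambda>i j k l. ?L1 i j k l * (?q j l * ?q k l)) \<le> 3 * Q * ?N"
    "sum4 I (\<lambda>i j k l. ?L4 i j k l * (?q i j * ?q i k)) \<le> 3 * Q * ?N"
    "sum4 I (\<lambda>i j k l. ?L1 i j k l * (?q j k * ?q k l)) \<le> 3 * Q * ?N"
    "sum4 I (\<lambda>i j k l. ?L3 i j k l * (?q i j * ?q i l)) \<le> 3 * Q * ?N"
    subgoal by (rule conv[OF sum4_leaf(4)[OF ne Q _ p(3)]]) (simp_all only: s q0 mult_nonneg_nonneg)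
    subgoal by (rule conv[OF sum4_leaf(1)[OF ne Q _ p(1)]]) (simp_all only: s q0 mult_nonneg_nonneg)
    subgoal by (rule conv[OF sum4_leaf(4)[OF ne Q _ p(2)]]) (simp_all only: s q0 mult_nonneg_nonneg)
    subgoal by (rule conv[OF sum4_leaf(2)[OF ne Q _ p(1)]]) (simp_all only: s q0 mult_nonneg_nonneg)
    done
  have "sum4 I (\<lambda>i j k l. cycle_weight 2 (r i j) (r k l) (r i k) (r i l) (r j k) (r j l)) \<le>
    sum4 I (\<lambda>i j k l. ?L1 i j k l * (?q j l * ?q k l) + ?L4 i j k l * (?q i j * ?q i k)
       + ?L1 i j k l * (?q j k * ?q k l) + ?L3 i j k l * (?q i j * ?q i l))"
  proof (rule sum4_mono)
    fix i j k l
    define a b c e f g where "a = ?q i j" and "b = ?q k l" and "c = ?q i k" and "e = ?q i l" and "f = ?q j k" and "g = ?q j l"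
    have nn: "0 \<le> a" "0 \<le> b" "0 \<le> c" "0 \<le> e" "0 \<le> f" "0 \<le> g"
      by (auto simp: a_def b_def c_def e_def f_def g_def)
    have 1: "r i j * r j l * r k l * r i k \<le> a * g * b + a * g * c + a * b * c + g * b * c"
      unfolding a_def b_def c_def g_def by (rule four_product_le; rule r0)
    have 2: "r i j * r j k * r k l * r i l \<le> a * f * b + a * f * e + a * b * e + f * b * e"
      unfolding a_def b_def e_def f_def by (rule four_product_le; rule r0)
    \<comment> \<open>The four paths are grouped by an end vertex, i or l, as leaf edge times
      two-edge path; the terms containing \<open>e\<close> are added to complete the leaf factors of
      \<open>sum4_leaf\<close>. Two groups for each of the two cycles, at cost 3 each, give the
      constant 12.\<close>
    have 3: "a * g * b + a * g * c + a * b * c + g * b * c \<le> (a + c + e) * (g * b) + (e + g + b) * (a * c)"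
      using nn by (simp add: algebra_simps)
    have 4: "a * f * b + a * f * e + a * b * e + f * b * e \<le> (a + c + e) * (f * b) + (c + f + b) * (a * e)"
      using nn by (simp add: algebra_simps)
    have "cycle_weight 2 (r i j) (r k l) (r i k) (r i l) (r j k) (r j l) \<le>
      (a + c + e) * (g * b) + (e + g + b) * (a * c) + (a + c + e) * (f * b) + (c + f + b) * (a * e)"
      using 1 2 3 4 by (simp add: cycle_weight_def)
    then show "cycle_weight 2 (r i j) (r k l) (r i k) (r i l) (r j k) (r j l) \<le>
      ?L1 i j k l * (?q j l * ?q k l) + ?L4 i j k l * (?q i j * ?q i k)
       + ?L1 i j k l * (?q j k * ?q k l) + ?L3 i j k l * (?q i j * ?q i l)"
      by (simp only: a_def b_def c_def e_def f_def g_def)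
  qed
  also have "\<dots> \<le> 4 * (3 * Q * ?N)"
    unfolding sum4_add using t by linarith
  also have "\<dots> = 12 * real (card I) * Q ^ 3" by (simp add: power3_eq_cube mult_ac)
  finally show ?thesis .
qed

text \<open>For fixed i the differences i - j are distinct and lie between - n and n, so a row picks
  distinct terms of the sum over that range.\<close>

lemma row_bounded_differences:
  fixes F :: "int \<Rightarrow> real"
  assumes nn: "\<And>k. 0 \<le> F k" and even: "\<And>k. F (- k) = F k"
  shows "row_bounded {1..n} (\<Sum>k\<in>{-int n..int n}. F k) (\<lambda>i j. F (int i - int j))"
  unfolding row_bounded_def
proof (intro conjI allI ballI)
  fix i assume i: "i \<in> {1..n}"
  have "(\<Sum>j\<in>{1..n}. F (int i - int j)) = (\<Sum>k\<in>(\<lambda>j. int i - int j) ` {1..n}. F k)"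
    by (subst sum.reindex) (auto simp: inj_on_def)
  also have "\<dots> \<le> (\<Sum>k\<in>{-int n..int n}. F k)"
    by (rule sum_mono2) (use i nn in auto)
  finally show "(\<Sum>j\<in>{1..n}. F (int i - int j)) \<le> (\<Sum>k\<in>{-int n..int n}. F k)" .
next
  fix i j show "F (int i - int j) = F (int j - int i)" using even[of "int i - int j"] by simp
qed (rule nn)

section \<open>The variance of the Stein kernel\<close>

lemma all_moments_abs: "all_moments M W \<Longrightarrow> all_moments M (\<lambda>\<omega>. \<bar>W \<omega>\<bar>)"
  by (auto simp: all_moments_def)

lemma hermite_poly_has_derivative:
  "(hermite_poly c (Suc m) has_real_derivative hermite_poly (\<lambda>q. real (Suc q) * c (Suc q)) m x) (at x)"
proof -
  have "((\<lambda>x. \<Sum>q<Suc m. c q * hermite q x) has_real_derivative (\<Sum>q<Suc m. c q * (real q * hermite (q - 1) x))) (at x)"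
    by (intro DERIV_sum DERIV_cmult hermite_has_derivative)
  moreover have "(\<Sum>q<Suc m. c q * (real q * hermite (q - 1) x)) = hermite_poly (\<lambda>q. real (Suc q) * c (Suc q)) m x"
    unfolding hermite_poly_def by (subst sum.lessThan_Suc_shift) (simp add: mult_ac del: of_nat_Suc)
  ultimately show ?thesis by (simp add: hermite_poly_def[abs_def])
qed

lemma continuous_on_hermite_poly [continuous_intros]:
  "continuous_on A f \<Longrightarrow> continuous_on A (\<lambda>x. hermite_poly c m (f x))"
  unfolding hermite_poly_def by (intro continuous_intros)

lemma (in prob_space) covariance_sum:
  fixes F :: "'i \<Rightarrow> 'a \<Rightarrow> real"
  assumes F: "\<And>z. z \<in> Z \<Longrightarrow> all_moments M (F z)"
  shows "expectation (\<lambda>\<omega>. (k * (\<Sum>z\<in>Z. F z \<omega>) - expectation (\<lambda>\<omega>. k * (\<Sum>z\<in>Z. F z \<omega>)))\<^sup>2) =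
    k\<^sup>2 * (\<Sum>z\<in>Z. \<Sum>z'\<in>Z. expectation (\<lambda>\<omega>. F z \<omega> * F z' \<omega>) - expectation (F z) * expectation (F z'))"
proof -
  let ?S = "\<lambda>\<omega>. \<Sum>z\<in>Z. F z \<omega>"
  have S: "all_moments M ?S" by (intro all_moments_sum F)
  have i: "integrable M ?S" "integrable M (\<lambda>\<omega>. (?S \<omega>)\<^sup>2)"
    by (intro all_moments_integrable all_moments_power S)+
  have ES: "expectation ?S = (\<Sum>z\<in>Z. expectation (F z))"
    by (rule Bochner_Integration.integral_sum) (intro all_moments_integrable F)
  have "expectation (\<lambda>\<omega>. (?S \<omega>)\<^sup>2) = expectation (\<lambda>\<omega>. \<Sum>z\<in>Z. \<Sum>z'\<in>Z. F z \<omega> * F z' \<omega>)"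
    by (simp add: power2_eq_square sum_product)
  also have "\<dots> = (\<Sum>z\<in>Z. expectation (\<lambda>\<omega>. \<Sum>z'\<in>Z. F z \<omega> * F z' \<omega>))"
    by (rule Bochner_Integration.integral_sum) (intro all_moments_integrable all_moments_sum all_moments_mult F)
  also have "\<dots> = (\<Sum>z\<in>Z. \<Sum>z'\<in>Z. expectation (\<lambda>\<omega>. F z \<omega> * F z' \<omega>))"
    by (intro sum.cong refl Bochner_Integration.integral_sum) (intro all_moments_integrable all_moments_mult F)
  finally have ES2: "expectation (\<lambda>\<omega>. (?S \<omega>)\<^sup>2) = (\<Sum>z\<in>Z. \<Sum>z'\<in>Z. expectation (\<lambda>\<omega>. F z \<omega> * F z' \<omega>))" .
  have "expectation (\<lambda>\<omega>. (k * ?S \<omega> - expectation (\<lambda>\<omega>. k * ?S \<omega>))\<^sup>2) =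
    expectation (\<lambda>\<omega>. k\<^sup>2 * (?S \<omega>)\<^sup>2 - (2 * k\<^sup>2 * expectation ?S) * ?S \<omega> + k\<^sup>2 * (expectation ?S)\<^sup>2)"
    by (intro Bochner_Integration.integral_cong refl) (simp add: power2_eq_square algebra_simps)
  also have "\<dots> = k\<^sup>2 * expectation (\<lambda>\<omega>. (?S \<omega>)\<^sup>2) - (2 * k\<^sup>2 * expectation ?S) * expectation ?S + k\<^sup>2 * (expectation ?S)\<^sup>2"
    using i by (simp add: prob_space)
  also have "\<dots> = k\<^sup>2 * (expectation (\<lambda>\<omega>. (?S \<omega>)\<^sup>2) - expectation ?S * expectation ?S)"
    by (simp add: power2_eq_square algebra_simps)
  also have "\<dots> = k\<^sup>2 * (\<Sum>z\<in>Z. \<Sum>z'\<in>Z. expectation (\<lambda>\<omega>. F z \<omega> * F z' \<omega>) - expectation (F z) * expectation (F z'))"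
    unfolding ES2 ES by (simp add: sum_product sum_subtractf)
  finally show ?thesis .
qed

context gaussian_family
begin

definition poly_sum :: "nat set \<Rightarrow> real \<Rightarrow> (nat \<Rightarrow> real) \<Rightarrow> nat \<Rightarrow> 'a \<Rightarrow> real" where
  "poly_sum J \<kappa> c m \<omega> = \<kappa> * (\<Sum>j\<in>J. hermite_poly c (Suc m) (X j \<omega>))"

text \<open>The inner product of the Malliavin derivative of \<open>poly_sum J \<kappa> c m\<close> with the process whose
  divergence is \<open>poly_sum J \<kappa> c m\<close>; the truncation index of \<open>poly_sum\<close> is \<open>Suc m\<close> because
  differentiation lowers degrees by one.\<close>

definition stein_kernel :: "nat set \<Rightarrow> real \<Rightarrow> (nat \<Rightarrow> real) \<Rightarrow> nat \<Rightarrow> 'a \<Rightarrow> real" where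
  "stein_kernel J \<kappa> c m \<omega> = \<kappa>\<^sup>2 * (\<Sum>z\<in>J \<times> J. cov (fst z) (snd z) *
     (hermite_poly (\<lambda>q. c (Suc q)) m (X (fst z) \<omega>) * hermite_poly (\<lambda>q. real (Suc q) * c (Suc q)) m (X (snd z) \<omega>)))"

lemma hermite_poly_X_all_moments: "all_moments M (\<lambda>\<omega>. hermite_poly c m (X i \<omega>))"
  by (intro all_moments_hermite_poly X_all_moments)

lemma poly_sum_all_moments: "all_moments M (poly_sum J \<kappa> c m)"
  unfolding poly_sum_def[abs_def] by (intro all_moments_cmult all_moments_sum hermite_poly_X_all_moments)

lemma stein_kernel_all_moments: "all_moments M (stein_kernel J \<kappa> c m)"
  unfolding stein_kernel_def[abs_def]
  by (intro all_moments_cmult all_moments_sum all_moments_mult hermite_poly_X_all_moments)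

text \<open>Each \<open>hermite (Suc q) (X i)\<close> in the expansion is lowered to
  \<open>hermite q (X i)\<close> by integration by parts, at the price of differentiating
  \<open>f\<close> of the sum; this brings in the sum over j of \<open>cov i j\<close> times the
  derivative of the polynomial at \<open>X j\<close>. The condition \<open>c 0 = 0\<close> removes
  the one term that cannot be lowered. Linear growth of \<open>f\<close> is allowed so that the
  identity function qualifies.\<close>

lemma stein_kernel_identity:
  assumes J: "finite J" and c0: "c 0 = 0"
    and f: "\<And>x. (f has_real_derivative f' x) (at x)" and cf': "continuous_on UNIV f'"
    and fb: "\<And>x. \<bar>f x\<bar> \<le> K * (1 + \<bar>x\<bar>)" and f'b: "\<And>x. \<bar>f' x\<bar> \<le> K"
  shows "expectation (\<lambda>\<omega>. poly_sum J \<kappa> c m \<omega> * f (poly_sum J \<kappa> c m \<omega>)) =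
    expectation (\<lambda>\<omega>. stein_kernel J \<kappa> c m \<omega> * f' (poly_sum J \<kappa> c m \<omega>))"
proof -
  let ?Y = "poly_sum J \<kappa> c m"
  let ?p = "hermite_poly c (Suc m)" and ?p1 = "hermite_poly (\<lambda>q. c (Suc q)) m"
  let ?p' = "hermite_poly (\<lambda>q. real (Suc q) * c (Suc q)) m"
  have K0: "0 \<le> K" using f'b[of 0] by linarith
  have cf: "continuous_on UNIV f" by (intro continuous_at_imp_continuous_on ballI DERIV_isCont[OF f])
  have fm[measurable]: "f \<in> borel_measurable borel" "f' \<in> borel_measurable borel"
    by (intro borel_measurable_continuous_onI cf cf')+
  have Ym: "?Y \<in> borel_measurable M" by (rule all_moments_measurable[OF poly_sum_all_moments])
  have Y: "all_moments M ?Y" by (rule poly_sum_all_moments)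
  have fY: "all_moments M (\<lambda>\<omega>. f (?Y \<omega>))"
  proof (rule all_moments_bound)
    show "all_moments M (\<lambda>\<omega>. K * (1 + \<bar>?Y \<omega>\<bar>))"
      by (intro all_moments_cmult all_moments_add all_moments_const all_moments_abs Y)
    show "(\<lambda>\<omega>. f (?Y \<omega>)) \<in> borel_measurable M" using Ym by measurable
    show "AE \<omega> in M. \<bar>f (?Y \<omega>)\<bar> \<le> \<bar>K * (1 + \<bar>?Y \<omega>\<bar>)\<bar>"
    proof (rule AE_I2)
      fix \<omega> show "\<bar>f (?Y \<omega>)\<bar> \<le> \<bar>K * (1 + \<bar>?Y \<omega>\<bar>)\<bar>"
        using fb[of "?Y \<omega>"] by linarith
    qed
  qed
  have f'Y: "all_moments M (\<lambda>\<omega>. f' (?Y \<omega>))"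
  proof (rule all_moments_bound[OF _ all_moments_const[of K]])
    show "(\<lambda>\<omega>. f' (?Y \<omega>)) \<in> borel_measurable M" using Ym by measurable
    show "AE \<omega> in M. \<bar>f' (?Y \<omega>)\<bar> \<le> \<bar>K\<bar>"
      by (rule AE_I2) (use f'b in \<open>meson abs_ge_self order_trans\<close>)
  qed
  have one: "expectation (\<lambda>\<omega>. ?p (X i \<omega>) * f (?Y \<omega>)) =
     expectation (\<lambda>\<omega>. ?p1 (X i \<omega>) * (f' (?Y \<omega>) * (\<kappa> * (\<Sum>j\<in>J. cov i j * ?p' (X j \<omega>)))))" for i
  proof -
    let ?D = "\<lambda>\<omega>. f' (?Y \<omega>) * (\<kappa> * (\<Sum>j\<in>J. cov i j * ?p' (X j \<omega>)))"
    have D: "all_moments M ?D"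
      by (intro all_moments_mult f'Y all_moments_cmult all_moments_sum hermite_poly_X_all_moments)
    have ibp: "expectation (\<lambda>\<omega>. hermite (Suc q) (X i \<omega>) * f (?Y \<omega>)) = expectation (\<lambda>\<omega>. hermite q (X i \<omega>) * ?D \<omega>)" for q
      unfolding poly_sum_def
    proof (rule hermite_integration_by_parts[where \<Phi>="\<lambda>x. f (\<kappa> * (\<Sum>j\<in>J. ?p (x j)))" and D="\<lambda>x. f' (\<kappa> * (\<Sum>j\<in>J. ?p (x j))) * (\<kappa> * (\<Sum>j\<in>J. cov i j * ?p' (x j)))"])
      show "(\<lambda>x. f (\<kappa> * (\<Sum>j\<in>J. ?p (x j)))) \<in> borel_measurable seq_space" by measurable
      show "(\<lambda>x. f' (\<kappa> * (\<Sum>j\<in>J. ?p (x j))) * (\<kappa> * (\<Sum>j\<in>J. cov i j * ?p' (x j)))) \<in> borel_measurable seq_space" by measurable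
      fix r :: "nat \<Rightarrow> real"
      have h: "((\<lambda>s. ?p (r j + cov i j * s)) has_real_derivative ?p' (r j + cov i j * t) * (cov i j)) (at t)" for j t
        by (rule DERIV_chain2[OF hermite_poly_has_derivative]) (auto intro!: derivative_eq_intros)
      show "((\<lambda>s. f (\<kappa> * (\<Sum>j\<in>J. ?p (r j + cov i j * s)))) has_real_derivative
        f' (\<kappa> * (\<Sum>j\<in>J. ?p (r j + cov i j * t))) * (\<kappa> * (\<Sum>j\<in>J. cov i j * ?p' (r j + cov i j * t)))) (at t)" for t
      proof (rule DERIV_chain2[OF f])
        have "((\<lambda>s. \<Sum>j\<in>J. ?p (r j + cov i j * s)) has_real_derivative (\<Sum>j\<in>J. ?p' (r j + cov i j * t) * (cov i j))) (at t)"
          by (rule DERIV_sum) (rule h)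
        then have "((\<lambda>s. \<kappa> * (\<Sum>j\<in>J. ?p (r j + cov i j * s))) has_real_derivative \<kappa> * (\<Sum>j\<in>J. ?p' (r j + cov i j * t) * (cov i j))) (at t)"
          by (rule DERIV_cmult)
        then show "((\<lambda>s. \<kappa> * (\<Sum>j\<in>J. ?p (r j + cov i j * s))) has_real_derivative \<kappa> * (\<Sum>j\<in>J. cov i j * ?p' (r j + cov i j * t))) (at t)"
          by (simp only: mult.commute[of _ "cov i _"])
      qed
      show "continuous_on UNIV (\<lambda>t. f' (\<kappa> * (\<Sum>j\<in>J. ?p (r j + cov i j * t))) * (\<kappa> * (\<Sum>j\<in>J. cov i j * ?p' (r j + cov i j * t))))"
        by (intro continuous_intros continuous_on_compose2[OF cf']) auto
    qed (use fY D in \<open>simp_all add: poly_sum_def\<close>)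
    have "expectation (\<lambda>\<omega>. ?p (X i \<omega>) * f (?Y \<omega>)) = (\<Sum>q<Suc m. c q * expectation (\<lambda>\<omega>. hermite q (X i \<omega>) * f (?Y \<omega>)))"
      by (rule hermite_poly_integral) (intro all_moments_integrable all_moments_mult herm_all_moments fY)
    also have "\<dots> = (\<Sum>q<m. c (Suc q) * expectation (\<lambda>\<omega>. hermite (Suc q) (X i \<omega>) * f (?Y \<omega>)))"
      by (subst sum.lessThan_Suc_shift) (simp add: c0)
    also have "\<dots> = (\<Sum>q<m. c (Suc q) * expectation (\<lambda>\<omega>. hermite q (X i \<omega>) * ?D \<omega>))"
      by (simp only: ibp)
    also have "\<dots> = expectation (\<lambda>\<omega>. ?p1 (X i \<omega>) * ?D \<omega>)"
      by (rule hermite_poly_integral[symmetric]) (intro all_moments_integrable all_moments_mult herm_all_moments D)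
    finally show ?thesis .
  qed
  have "expectation (\<lambda>\<omega>. ?Y \<omega> * f (?Y \<omega>)) = expectation (\<lambda>\<omega>. \<kappa> * (\<Sum>i\<in>J. ?p (X i \<omega>) * f (?Y \<omega>)))"
    by (intro Bochner_Integration.integral_cong refl) (simp add: poly_sum_def[of _ _ _ _ _] sum_distrib_right mult.assoc)
  also have "\<dots> = \<kappa> * (\<Sum>i\<in>J. expectation (\<lambda>\<omega>. ?p (X i \<omega>) * f (?Y \<omega>)))"
    by (subst integral_mult_right_zero, subst Bochner_Integration.integral_sum)
       (intro all_moments_integrable all_moments_mult hermite_poly_X_all_moments fY, simp)
  also have "\<dots> = \<kappa> * (\<Sum>i\<in>J. expectation (\<lambda>\<omega>. ?p1 (X i \<omega>) * (f' (?Y \<omega>) * (\<kappa> * (\<Sum>j\<in>J. cov i j * ?p' (X j \<omega>))))))"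
    by (simp only: one)
  also have "\<dots> = expectation (\<lambda>\<omega>. \<kappa> * (\<Sum>i\<in>J. ?p1 (X i \<omega>) * (f' (?Y \<omega>) * (\<kappa> * (\<Sum>j\<in>J. cov i j * ?p' (X j \<omega>))))))"
    by (subst integral_mult_right_zero, subst Bochner_Integration.integral_sum)
       (intro all_moments_integrable all_moments_mult all_moments_cmult all_moments_sum hermite_poly_X_all_moments f'Y, simp)
  also have "\<dots> = expectation (\<lambda>\<omega>. stein_kernel J \<kappa> c m \<omega> * f' (?Y \<omega>))"
  proof (intro Bochner_Integration.integral_cong refl)
    fix \<omega>
    have "stein_kernel J \<kappa> c m \<omega> = \<kappa>\<^sup>2 * (\<Sum>i\<in>J. \<Sum>j\<in>J. cov i j * (?p1 (X i \<omega>) * ?p' (X j \<omega>)))"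
      by (simp add: stein_kernel_def sum.cartesian_product split_beta')
    then show "\<kappa> * (\<Sum>i\<in>J. ?p1 (X i \<omega>) * (f' (?Y \<omega>) * (\<kappa> * (\<Sum>j\<in>J. cov i j * ?p' (X j \<omega>))))) =
      stein_kernel J \<kappa> c m \<omega> * f' (?Y \<omega>)"
      by (simp add: sum_distrib_left sum_distrib_right power2_eq_square mult_ac)
  qed
  finally show ?thesis .
qed

lemma hermite_poly4_expectation:
  "expectation (\<lambda>\<omega>. hermite_poly w1 m (X i \<omega>) * (hermite_poly w2 m (X j \<omega>) * hermite_poly w3 m (X k \<omega>) * hermite_poly w4 m (X l \<omega>))) =
   (\<Sum>a<m. \<Sum>b<m. \<Sum>c<m. \<Sum>e<m. w1 a * w2 b * w3 c * w4 e * herm4 i j k l a b c e)"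
proof -
  let ?P2 = "\<lambda>\<omega>. hermite_poly w2 m (X j \<omega>)" and ?P3 = "\<lambda>\<omega>. hermite_poly w3 m (X k \<omega>)" and ?P4 = "\<lambda>\<omega>. hermite_poly w4 m (X l \<omega>)"
  let ?H = "\<lambda>q i \<omega>. hermite q (X i \<omega>)"
  note am = all_moments_integrable all_moments_mult herm_all_moments hermite_poly_X_all_moments
  have 4: "expectation (\<lambda>\<omega>. ?P4 \<omega> * (?H a i \<omega> * ?H b j \<omega> * ?H c k \<omega>)) = (\<Sum>e<m. w4 e * herm4 i j k l a b c e)" for a b c
    by (subst hermite_poly_integral) (intro am, simp add: herm4_def mult_ac)
  have 3: "expectation (\<lambda>\<omega>. ?P3 \<omega> * (?H a i \<omega> * ?H b j \<omega> * ?P4 \<omega>)) = (\<Sum>c<m. w3 c * (\<Sum>e<m. w4 e * herm4 i j k l a b c e))" for a b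
    by (subst hermite_poly_integral, intro am, subst 4[symmetric], simp add: mult_ac)
  have 2: "expectation (\<lambda>\<omega>. ?P2 \<omega> * (?H a i \<omega> * ?P3 \<omega> * ?P4 \<omega>)) = (\<Sum>b<m. w2 b * (\<Sum>c<m. w3 c * (\<Sum>e<m. w4 e * herm4 i j k l a b c e)))" for a
    by (subst hermite_poly_integral, intro am, subst 3[symmetric], simp add: mult_ac)
  have "expectation (\<lambda>\<omega>. hermite_poly w1 m (X i \<omega>) * (?P2 \<omega> * ?P3 \<omega> * ?P4 \<omega>)) =
      (\<Sum>a<m. w1 a * (\<Sum>b<m. w2 b * (\<Sum>c<m. w3 c * (\<Sum>e<m. w4 e * herm4 i j k l a b c e))))"
    by (subst hermite_poly_integral, intro am, subst 2[symmetric], simp add: mult_ac)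
  then show ?thesis by (simp add: sum_distrib_left mult.assoc)
qed

lemma hermite_poly2_expectation:
  "expectation (\<lambda>\<omega>. hermite_poly w1 m (X i \<omega>) * hermite_poly w2 m (X j \<omega>)) =
   (\<Sum>a<m. \<Sum>b<m. w1 a * w2 b * expectation (\<lambda>\<omega>. hermite a (X i \<omega>) * hermite b (X j \<omega>)))"
proof -
  note am = all_moments_integrable all_moments_mult herm_all_moments hermite_poly_X_all_moments
  have 2: "expectation (\<lambda>\<omega>. hermite_poly w2 m (X j \<omega>) * hermite a (X i \<omega>)) = (\<Sum>b<m. w2 b * expectation (\<lambda>\<omega>. hermite a (X i \<omega>) * hermite b (X j \<omega>)))" for a
    by (subst hermite_poly_integral) (intro am, simp add: mult_ac)
  have "expectation (\<lambda>\<omega>. hermite_poly w1 m (X i \<omega>) * hermite_poly w2 m (X j \<omega>)) =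
     (\<Sum>a<m. w1 a * expectation (\<lambda>\<omega>. hermite a (X i \<omega>) * hermite_poly w2 m (X j \<omega>)))"
    by (rule hermite_poly_integral) (intro am)
  also have "\<dots> = (\<Sum>a<m. w1 a * (\<Sum>b<m. w2 b * expectation (\<lambda>\<omega>. hermite a (X i \<omega>) * hermite b (X j \<omega>))))"
    by (simp add: 2[symmetric] mult.commute)
  finally show ?thesis by (simp add: sum_distrib_left mult.assoc)
qed

lemma abs_cov_le_1: "\<bar>cov i j\<bar> \<le> 1"
proof -
  have "\<bar>cov i j\<bar> \<le> sqrt (expectation (\<lambda>\<omega>. (X i \<omega>)\<^sup>2)) * sqrt (expectation (\<lambda>\<omega>. (X j \<omega>)\<^sup>2))"
    unfolding cov_def
    by (rule integral_cauchy_schwarz) (auto intro!: all_moments_integrable all_moments_power X_all_moments)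
  also have "\<dots> = 1" using cov_self[of i] cov_self[of j] by (simp add: cov_def power2_eq_square)
  finally show ?thesis .
qed

abbreviation pair_weight :: "nat \<Rightarrow> nat \<Rightarrow> nat \<Rightarrow> nat \<Rightarrow> nat \<Rightarrow> real" where
  "pair_weight d i j k l \<equiv>
     tree_weight d \<bar>cov i j\<bar> \<bar>cov k l\<bar> \<bar>cov i k\<bar> \<bar>cov i l\<bar> \<bar>cov j k\<bar> \<bar>cov j l\<bar> +
     cycle_weight d \<bar>cov i j\<bar> \<bar>cov k l\<bar> \<bar>cov i k\<bar> \<bar>cov i l\<bar> \<bar>cov j k\<bar> \<bar>cov j l\<bar>"

lemma pair_weight_nonneg: "0 \<le> pair_weight d i j k l"
  unfolding tree_weight_def cycle_weight_def by (intro add_nonneg_nonneg) (auto intro!: mult_nonneg_nonneg add_nonneg_nonneg)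

text \<open>The prefactor \<open>cov i j * cov k l\<close> supplies the two edges by which the
  product in \<open>diagram_weight_le\<close> exceeds the bare Wick monomial. Since
  \<open>pair_weight\<close> does not depend on the degrees of the Hermite polynomials, it factors
  out, and the majorized coefficients sum up again to the fourth moment of one polynomial in one
  variable.\<close>

lemma kernel_covariance_bound:
  assumes d: "2 \<le> d" and ck: "\<And>q. q < d \<Longrightarrow> c q = 0"
    and Q: "(\<integral>x. (hermite_poly (\<lambda>q. real (Suc q) * \<bar>c (Suc q)\<bar>) m x) ^ 4 \<partial>std_normal_distribution) \<le> Q"
  defines "p1 \<equiv> hermite_poly (\<lambda>q. c (Suc q)) m" and "p' \<equiv> hermite_poly (\<lambda>q. real (Suc q) * c (Suc q)) m"
  shows "cov i j * cov k l * (expectation (\<lambda>\<omega>. (p1 (X i \<omega>) * p' (X j \<omega>)) * (p1 (X k \<omega>) * p' (X l \<omega>)))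
       - expectation (\<lambda>\<omega>. p1 (X i \<omega>) * p' (X j \<omega>)) * expectation (\<lambda>\<omega>. p1 (X k \<omega>) * p' (X l \<omega>))) \<le> pair_weight d i j k l * Q"
proof -
  let ?W = "pair_weight d i j k l"
  let ?w = "\<lambda>q. real (Suc q) * \<bar>c (Suc q)\<bar>"
  let ?w1 = "\<lambda>q. c (Suc q)" and ?w' = "\<lambda>q. real (Suc q) * c (Suc q)"
  let ?\<Delta> = "\<lambda>a b e f. herm4 i j k l a b e f - herm4 i j k l a b 0 0 * herm4 i j k l 0 0 e f"
  have W0: "0 \<le> ?W" by (rule pair_weight_nonneg)
  have E4: "expectation (\<lambda>\<omega>. (p1 (X i \<omega>) * p' (X j \<omega>)) * (p1 (X k \<omega>) * p' (X l \<omega>))) =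
    (\<Sum>a<m. \<Sum>b<m. \<Sum>e<m. \<Sum>f<m. ?w1 a * ?w' b * ?w1 e * ?w' f * herm4 i j k l a b e f)"
    unfolding p1_def p'_def hermite_poly4_expectation[symmetric] by (simp add: mult_ac)
  have E2: "expectation (\<lambda>\<omega>. p1 (X i \<omega>) * p' (X j \<omega>)) = (\<Sum>a<m. \<Sum>b<m. ?w1 a * ?w' b * herm4 i j k l a b 0 0)"
    unfolding p1_def p'_def hermite_poly2_expectation by (simp add: herm4_def hermite_0)
  have E2': "expectation (\<lambda>\<omega>. p1 (X k \<omega>) * p' (X l \<omega>)) = (\<Sum>e<m. \<Sum>f<m. ?w1 e * ?w' f * herm4 i j k l 0 0 e f)"
    unfolding p1_def p'_def hermite_poly2_expectation by (simp add: herm4_def hermite_0)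
  have "expectation (\<lambda>\<omega>. p1 (X i \<omega>) * p' (X j \<omega>)) * expectation (\<lambda>\<omega>. p1 (X k \<omega>) * p' (X l \<omega>)) =
    (\<Sum>a<m. \<Sum>b<m. (?w1 a * ?w' b * herm4 i j k l a b 0 0) * (\<Sum>e<m. \<Sum>f<m. ?w1 e * ?w' f * herm4 i j k l 0 0 e f))"
    unfolding E2 E2' by (simp only: sum_distrib_right)
  also have "\<dots> = (\<Sum>a<m. \<Sum>b<m. \<Sum>e<m. \<Sum>f<m. ?w1 a * ?w' b * ?w1 e * ?w' f * (herm4 i j k l a b 0 0 * herm4 i j k l 0 0 e f))"
    by (simp add: sum_distrib_left mult_ac del: of_nat_Suc)
  finally have E22: "expectation (\<lambda>\<omega>. p1 (X i \<omega>) * p' (X j \<omega>)) * expectation (\<lambda>\<omega>. p1 (X k \<omega>) * p' (X l \<omega>)) = \<dots>" .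
  have "cov i j * cov k l * (expectation (\<lambda>\<omega>. (p1 (X i \<omega>) * p' (X j \<omega>)) * (p1 (X k \<omega>) * p' (X l \<omega>)))
       - expectation (\<lambda>\<omega>. p1 (X i \<omega>) * p' (X j \<omega>)) * expectation (\<lambda>\<omega>. p1 (X k \<omega>) * p' (X l \<omega>))) =
     (\<Sum>a<m. \<Sum>b<m. \<Sum>e<m. \<Sum>f<m. (cov i j * cov k l) * (?w1 a * ?w' b * ?w1 e * ?w' f * ?\<Delta> a b e f))"
    unfolding E4 E22 by (simp add: sum_subtractf right_diff_distrib sum_distrib_left del: of_nat_Suc)
  also have "\<dots> \<le> (\<Sum>a<m. \<Sum>b<m. \<Sum>e<m. \<Sum>f<m. ?W * (?w a * ?w b * ?w e * ?w f * herm4 0 0 0 0 a b e f))"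
  proof (intro sum_mono)
    fix a b e f
    let ?h = "herm4 0 0 0 0 a b e f"
    have h0: "0 \<le> ?h" by (rule herm4_diagonal_nonneg)
    \<comment> \<open>One weight dominates the coefficients of both polynomials, because the factor
      q + 1 is at least 1. This is what makes the majorant a fourth power.\<close>
    have w: "\<bar>?w1 q\<bar> \<le> ?w q" "\<bar>?w' q\<bar> \<le> ?w q" "0 \<le> ?w q" for q
    proof -
      have "1 * \<bar>c (Suc q)\<bar> \<le> ?w q" by (intro mult_right_mono) auto
      then show "\<bar>?w1 q\<bar> \<le> ?w q" by simp
    qed (auto simp: abs_mult)
    show "(cov i j * cov k l) * (?w1 a * ?w' b * ?w1 e * ?w' f * ?\<Delta> a b e f) \<le> ?W * (?w a * ?w b * ?w e * ?w f * ?h)"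
    \<comment> \<open>Outside this case a coefficient or a covariance in front is 0. Inside it all
      degrees are at least d - 1, and division by \<open>?cc\<close> is possible; it turns the bound
      for the product with the two extra edges into one for the monomial alone.\<close>
    proof (cases "d \<le> Suc a \<and> d \<le> Suc b \<and> d \<le> Suc e \<and> d \<le> Suc f \<and> cov i j \<noteq> 0 \<and> cov k l \<noteq> 0")
      case False
      then have "(cov i j * cov k l) * (?w1 a * ?w' b * ?w1 e * ?w' f * ?\<Delta> a b e f) = 0"
        using ck by (auto simp: not_le)
      moreover have "0 \<le> ?W * (?w a * ?w b * ?w e * ?w f * ?h)"
        by (intro mult_nonneg_nonneg W0 w h0)
      ultimately show ?thesis by linarith
    next
      case True
      let ?cc = "\<bar>cov i j\<bar> * \<bar>cov k l\<bar>"
      have cc: "0 < ?cc" using True by simp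
      have "\<bar>?\<Delta> a b e f\<bar> \<le> (?W / ?cc) * ?h"
      proof (rule herm4_covariance_bound)
        fix u v A B C D :: nat
        assume s: "u + A + B = a" "u + C + D = b" "v + A + C = e" "v + B + D = f" and cr: "0 < A + B + C + D"
        have k: "1 \<le> d - 1" "d - 1 \<le> u + A + B" "d - 1 \<le> u + C + D" "d - 1 \<le> v + A + C" "d - 1 \<le> v + B + D"
          using True s d by linarith+
        have "\<bar>cov i j\<bar> ^ Suc u * \<bar>cov k l\<bar> ^ Suc v * \<bar>cov i k\<bar> ^ A * \<bar>cov i l\<bar> ^ B * \<bar>cov j k\<bar> ^ C * \<bar>cov j l\<bar> ^ D
           \<le> tree_weight (Suc (d - 1)) \<bar>cov i j\<bar> \<bar>cov k l\<bar> \<bar>cov i k\<bar> \<bar>cov i l\<bar> \<bar>cov j k\<bar> \<bar>cov j l\<bar>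
            + cycle_weight (Suc (d - 1)) \<bar>cov i j\<bar> \<bar>cov k l\<bar> \<bar>cov i k\<bar> \<bar>cov i l\<bar> \<bar>cov j k\<bar> \<bar>cov j l\<bar>"
          by (rule diagram_weight_le; (rule abs_ge_zero abs_cov_le_1 k cr))
        also have "Suc (d - 1) = d" using d by simp
        finally have "?cc * \<bar>monomial (cov i j) (cov k l) (cov i k) (cov i l) (cov j k) (cov j l) u v A B C D\<bar> \<le> ?W"
          by (simp add: monomial_def abs_mult power_abs mult_ac)
        then show "\<bar>monomial (cov i j) (cov k l) (cov i k) (cov i l) (cov j k) (cov j l) u v A B C D\<bar> \<le> ?W / ?cc"
          using cc by (simp only: pos_le_divide_eq mult.commute)
      next
        show "0 \<le> ?W / ?cc" using W0 cc by (intro divide_nonneg_pos)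
      qed
      then have \<Delta>: "?cc * \<bar>?\<Delta> a b e f\<bar> \<le> ?W * ?h"
        using cc by (simp add: field_simps)
      have "(cov i j * cov k l) * (?w1 a * ?w' b * ?w1 e * ?w' f * ?\<Delta> a b e f)
         \<le> \<bar>(cov i j * cov k l) * (?w1 a * ?w' b * ?w1 e * ?w' f * ?\<Delta> a b e f)\<bar>" by (rule abs_ge_self)
      also have "\<dots> = (\<bar>?w1 a\<bar> * \<bar>?w' b\<bar> * \<bar>?w1 e\<bar> * \<bar>?w' f\<bar>) * (?cc * \<bar>?\<Delta> a b e f\<bar>)"
        by (simp only: abs_mult mult_ac)
      also have "\<dots> \<le> (?w a * ?w b * ?w e * ?w f) * (?W * ?h)"
        by (intro mult_mono w \<Delta> mult_nonneg_nonneg abs_ge_zero)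
      also have "\<dots> = ?W * (?w a * ?w b * ?w e * ?w f * ?h)" by (simp only: mult_ac)
      finally show ?thesis .
    qed
  qed
  also have "\<dots> = ?W * (\<Sum>a<m. \<Sum>b<m. \<Sum>e<m. \<Sum>f<m. ?w a * ?w b * ?w e * ?w f * herm4 0 0 0 0 a b e f)"
    by (simp add: sum_distrib_left)
  also have "(\<Sum>a<m. \<Sum>b<m. \<Sum>e<m. \<Sum>f<m. ?w a * ?w b * ?w e * ?w f * herm4 0 0 0 0 a b e f) =
     expectation (\<lambda>\<omega>. (hermite_poly ?w m (X 0 \<omega>)) ^ 4)"
    unfolding hermite_poly4_expectation[symmetric] by (simp add: power4_eq_xxxx mult_ac)
  also have "\<dots> = (\<integral>x. (hermite_poly ?w m x) ^ 4 \<partial>distr M borel (X 0))"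
    by (rule integral_distr[symmetric]) measurable
  also have "?W * \<dots> \<le> ?W * Q" unfolding X_distr by (intro mult_left_mono Q W0)
  finally show ?thesis .
qed

lemma stein_kernel_variance:
  assumes J: "finite J" and d: "2 \<le> d" and ck: "\<And>q. q < d \<Longrightarrow> c q = 0"
    and Q: "(\<integral>x. (hermite_poly (\<lambda>q. real (Suc q) * \<bar>c (Suc q)\<bar>) m x) ^ 4 \<partial>std_normal_distribution) \<le> Q"
  shows "expectation (\<lambda>\<omega>. (stein_kernel J \<kappa> c m \<omega> - expectation (stein_kernel J \<kappa> c m))\<^sup>2)
    \<le> \<kappa> ^ 4 * Q * sum4 J (pair_weight d)"
proof -
  let ?p1 = "hermite_poly (\<lambda>q. c (Suc q)) m" and ?p' = "hermite_poly (\<lambda>q. real (Suc q) * c (Suc q)) m"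
  let ?F = "\<lambda>z \<omega>. cov (fst z) (snd z) * (?p1 (X (fst z) \<omega>) * ?p' (X (snd z) \<omega>))"
  let ?S = "\<Sum>z\<in>J\<times>J. \<Sum>z'\<in>J\<times>J. expectation (\<lambda>\<omega>. ?F z \<omega> * ?F z' \<omega>) - expectation (?F z) * expectation (?F z')"
  have e1: "expectation (\<lambda>\<omega>. (stein_kernel J \<kappa> c m \<omega> - expectation (stein_kernel J \<kappa> c m))\<^sup>2) =
     (\<kappa>\<^sup>2)\<^sup>2 * ?S"
    unfolding stein_kernel_def[abs_def]
    by (rule covariance_sum) (intro all_moments_cmult all_moments_mult hermite_poly_X_all_moments)
  have "?S \<le> (\<Sum>z\<in>J\<times>J. \<Sum>z'\<in>J\<times>J. pair_weight d (fst z) (snd z) (fst z') (snd z') * Q)"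
  proof (intro sum_mono)
    fix z z' :: "nat \<times> nat"
    have "expectation (\<lambda>\<omega>. ?F z \<omega> * ?F z' \<omega>) =
      expectation (\<lambda>\<omega>. (cov (fst z) (snd z) * cov (fst z') (snd z')) * ((?p1 (X (fst z) \<omega>) * ?p' (X (snd z) \<omega>)) * (?p1 (X (fst z') \<omega>) * ?p' (X (snd z') \<omega>))))"
      by (intro Bochner_Integration.integral_cong refl) (simp only: mult_ac)
    then have "expectation (\<lambda>\<omega>. ?F z \<omega> * ?F z' \<omega>) - expectation (?F z) * expectation (?F z') =
      cov (fst z) (snd z) * cov (fst z') (snd z') * (expectation (\<lambda>\<omega>. (?p1 (X (fst z) \<omega>) * ?p' (X (snd z) \<omega>)) * (?p1 (X (fst z') \<omega>) * ?p' (X (snd z') \<omega>)))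
       - expectation (\<lambda>\<omega>. ?p1 (X (fst z) \<omega>) * ?p' (X (snd z) \<omega>)) * expectation (\<lambda>\<omega>. ?p1 (X (fst z') \<omega>) * ?p' (X (snd z') \<omega>)))"
      unfolding integral_mult_right_zero by (simp only: right_diff_distrib mult_ac)
    also have "\<dots> \<le> pair_weight d (fst z) (snd z) (fst z') (snd z') * Q"
      by (rule kernel_covariance_bound[OF d ck Q])
    finally show "expectation (\<lambda>\<omega>. ?F z \<omega> * ?F z' \<omega>) - expectation (?F z) * expectation (?F z')
      \<le> pair_weight d (fst z) (snd z) (fst z') (snd z') * Q" .
  qed
  also have "\<dots> = sum4 J (pair_weight d) * Q"
  proof -
    have P: "(\<Sum>z\<in>J\<times>J. h (fst z) (snd z)) = (\<Sum>i\<in>J. \<Sum>j\<in>J. h i j)" for h :: "nat \<Rightarrow> nat \<Rightarrow> real"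
      by (rule trans[OF sum.cong sum.cartesian_product[symmetric]]) (auto simp: split_beta')
    show ?thesis
      unfolding P[of "\<lambda>i j. \<Sum>z'\<in>J\<times>J. pair_weight d i j (fst z') (snd z') * Q"]
      unfolding P[of "\<lambda>k l. pair_weight d _ _ k l * Q"] sum4_def sum_distrib_right ..
  qed
  finally have "(\<kappa>\<^sup>2)\<^sup>2 * ?S \<le> (\<kappa>\<^sup>2)\<^sup>2 * (sum4 J (pair_weight d) * Q)"
    by (rule mult_left_mono) simp
  also have "(\<kappa>\<^sup>2)\<^sup>2 * (sum4 J (pair_weight d) * Q) = \<kappa> ^ 4 * Q * sum4 J (pair_weight d)"
    by (simp only: power4_eq_xxxx power2_eq_square mult_ac)
  finally show ?thesis unfolding e1 .
qed

end

section \<open>Removing the truncation\<close>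

lemma integral_tendsto_of_abs_diff_le:
  fixes U :: "nat \<Rightarrow> 'a \<Rightarrow> real"
  assumes U: "\<And>m. integrable M (U m)" "integrable M u"
    and V: "\<And>m. integrable M (V m)" and le: "\<And>m \<omega>. \<bar>U m \<omega> - u \<omega>\<bar> \<le> V m \<omega>"
    and lim: "(\<lambda>m. \<integral>\<omega>. V m \<omega> \<partial>M) \<longlonglongrightarrow> 0"
  shows "(\<lambda>m. \<integral>\<omega>. U m \<omega> \<partial>M) \<longlonglongrightarrow> (\<integral>\<omega>. u \<omega> \<partial>M)"
proof -
  have "(\<lambda>m. (\<integral>\<omega>. U m \<omega> \<partial>M) - (\<integral>\<omega>. u \<omega> \<partial>M)) \<longlonglongrightarrow> 0"
  proof (rule Lim_null_comparison[OF always_eventually lim], rule allI)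
    fix m
    have "norm ((\<integral>\<omega>. U m \<omega> \<partial>M) - (\<integral>\<omega>. u \<omega> \<partial>M)) = \<bar>\<integral>\<omega>. U m \<omega> - u \<omega> \<partial>M\<bar>" using U by simp
    also have "\<dots> \<le> (\<integral>\<omega>. \<bar>U m \<omega> - u \<omega>\<bar> \<partial>M)" by (rule integral_abs_bound)
    also have "\<dots> \<le> (\<integral>\<omega>. V m \<omega> \<partial>M)" using U V le by (intro integral_mono) auto
    finally show "norm ((\<integral>\<omega>. U m \<omega> \<partial>M) - (\<integral>\<omega>. u \<omega> \<partial>M)) \<le> (\<integral>\<omega>. V m \<omega> \<partial>M)" .
  qed
  then show ?thesis by (simp add: LIM_zero_iff)
qed

lemma integral_abs_mult_tendsto_0:
  fixes W :: "'a \<Rightarrow> real" and D :: "nat \<Rightarrow> 'a \<Rightarrow> real"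
  assumes [measurable]: "W \<in> borel_measurable M" "\<And>m. D m \<in> borel_measurable M"
    and W: "integrable M (\<lambda>\<omega>. (W \<omega>)\<^sup>2)" and D: "\<And>m. integrable M (\<lambda>\<omega>. (D m \<omega>)\<^sup>2)"
    and lim: "(\<lambda>m. \<integral>\<omega>. (D m \<omega>)\<^sup>2 \<partial>M) \<longlonglongrightarrow> 0"
  shows "(\<lambda>m. \<integral>\<omega>. \<bar>W \<omega>\<bar> * \<bar>D m \<omega>\<bar> \<partial>M) \<longlonglongrightarrow> 0"
proof (rule Lim_null_comparison)
  show "\<forall>\<^sub>F m in sequentially. norm (\<integral>\<omega>. \<bar>W \<omega>\<bar> * \<bar>D m \<omega>\<bar> \<partial>M) \<le> sqrt (\<integral>\<omega>. (W \<omega>)\<^sup>2 \<partial>M) * sqrt (\<integral>\<omega>. (D m \<omega>)\<^sup>2 \<partial>M)"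
  proof (intro always_eventually allI)
    fix m
    show "norm (\<integral>\<omega>. \<bar>W \<omega>\<bar> * \<bar>D m \<omega>\<bar> \<partial>M) \<le> sqrt (\<integral>\<omega>. (W \<omega>)\<^sup>2 \<partial>M) * sqrt (\<integral>\<omega>. (D m \<omega>)\<^sup>2 \<partial>M)"
      using integral_cauchy_schwarz[of "\<lambda>\<omega>. \<bar>W \<omega>\<bar>" M "\<lambda>\<omega>. \<bar>D m \<omega>\<bar>"] W D by simp
  qed
  have "(\<lambda>m. sqrt (\<integral>\<omega>. (W \<omega>)\<^sup>2 \<partial>M) * sqrt (\<integral>\<omega>. (D m \<omega>)\<^sup>2 \<partial>M)) \<longlonglongrightarrow> sqrt (\<integral>\<omega>. (W \<omega>)\<^sup>2 \<partial>M) * sqrt 0"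
    by (intro tendsto_intros lim)
  then show "(\<lambda>m. sqrt (\<integral>\<omega>. (W \<omega>)\<^sup>2 \<partial>M) * sqrt (\<integral>\<omega>. (D m \<omega>)\<^sup>2 \<partial>M)) \<longlonglongrightarrow> 0" by simp
qed

context gaussian_family
begin

text \<open>The mean of the kernel is the second moment of the sum, so the difference is the
  expectation of the centred kernel times \<open>f'\<close>; Cauchy-Schwarz with the bound 2 on
  \<open>f'\<close> concludes. The second moment is kept as a factor because it need not be 1 before
  the limit.\<close>

lemma stein_truncated:
  assumes J: "finite J" and c0: "c 0 = 0"
    and f: "\<And>x. (f has_real_derivative f' x) (at x)" and cf': "continuous_on UNIV f'"
    and fb: "\<And>x. \<bar>f x\<bar> \<le> K" and f'b: "\<And>x. \<bar>f' x\<bar> \<le> 2"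
    and B: "0 \<le> B" "expectation (\<lambda>\<omega>. (stein_kernel J \<kappa> c m \<omega> - expectation (stein_kernel J \<kappa> c m))\<^sup>2) \<le> B\<^sup>2"
  shows "\<bar>expectation (\<lambda>\<omega>. poly_sum J \<kappa> c m \<omega> * f (poly_sum J \<kappa> c m \<omega>)) -
     expectation (\<lambda>\<omega>. (poly_sum J \<kappa> c m \<omega>)\<^sup>2) * expectation (\<lambda>\<omega>. f' (poly_sum J \<kappa> c m \<omega>))\<bar> \<le> 2 * B"
proof -
  let ?Y = "poly_sum J \<kappa> c m" and ?T = "stein_kernel J \<kappa> c m"
  have Ym[measurable]: "?Y \<in> borel_measurable M" by (rule all_moments_measurable[OF poly_sum_all_moments])
  have Tm[measurable]: "?T \<in> borel_measurable M" by (rule all_moments_measurable[OF stein_kernel_all_moments])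
  have [measurable]: "f' \<in> borel_measurable borel" by (intro borel_measurable_continuous_onI cf')
  let ?K = "max 2 K"
  have 1: "expectation (\<lambda>\<omega>. ?Y \<omega> * f (?Y \<omega>)) = expectation (\<lambda>\<omega>. ?T \<omega> * f' (?Y \<omega>))"
  proof (rule stein_kernel_identity[where K="?K" and c=c and f=f and f'=f', OF J c0 f cf'])
    fix x
    have "\<bar>f x\<bar> \<le> ?K * 1" using fb[of x] by simp
    also have "\<dots> \<le> ?K * (1 + \<bar>x\<bar>)" by (intro mult_left_mono) auto
    finally show "\<bar>f x\<bar> \<le> ?K * (1 + \<bar>x\<bar>)" .
    show "\<bar>f' x\<bar> \<le> ?K" using f'b[of x] by simp
  qed
  \<comment> \<open>The kernel identity for the identity function.\<close>
  have 2: "expectation (\<lambda>\<omega>. ?Y \<omega> * ?Y \<omega>) = expectation (\<lambda>\<omega>. ?T \<omega> * 1)"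
    by (rule stein_kernel_identity[where K=1 and c=c and f="\<lambda>x. x" and f'="\<lambda>_. 1", OF J c0]) auto
  have f'i: "integrable M (\<lambda>\<omega>. f' (?Y \<omega>))"
    by (rule integrable_const_bound[where B=2]) (auto intro!: AE_I2 f'b)
  have f'2: "integrable M (\<lambda>\<omega>. (f' (?Y \<omega>))\<^sup>2)"
  proof (rule integrable_const_bound[where B="2\<^sup>2"])
    show "AE \<omega> in M. norm ((f' (?Y \<omega>))\<^sup>2) \<le> 2\<^sup>2"
      using power_mono[OF f'b, of _ 2] by (intro AE_I2) simp
  qed simp
  have T2: "integrable M (\<lambda>\<omega>. (?T \<omega> - expectation ?T)\<^sup>2)"
    by (intro all_moments_integrable all_moments_power all_moments_diff stein_kernel_all_moments all_moments_const)
  have Ti: "integrable M ?T" by (rule all_moments_integrable[OF stein_kernel_all_moments])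
  have Tf': "integrable M (\<lambda>\<omega>. ?T \<omega> * f' (?Y \<omega>))"
    by (rule integrable_mult_square[OF _ _ _ f'2]) (auto intro!: all_moments_integrable all_moments_power stein_kernel_all_moments)
  have "expectation (\<lambda>\<omega>. (?T \<omega> - expectation ?T) * f' (?Y \<omega>)) = expectation (\<lambda>\<omega>. ?T \<omega> * f' (?Y \<omega>)) - expectation ?T * expectation (\<lambda>\<omega>. f' (?Y \<omega>))"
    using Tf' f'i by (simp add: left_diff_distrib)
  then have e: "expectation (\<lambda>\<omega>. ?Y \<omega> * f (?Y \<omega>)) - expectation (\<lambda>\<omega>. (?Y \<omega>)\<^sup>2) * expectation (\<lambda>\<omega>. f' (?Y \<omega>)) =
     expectation (\<lambda>\<omega>. (?T \<omega> - expectation ?T) * f' (?Y \<omega>))"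
    using 1 2 by (simp add: power2_eq_square)
  have "\<bar>expectation (\<lambda>\<omega>. (?T \<omega> - expectation ?T) * f' (?Y \<omega>))\<bar> \<le>
     sqrt (expectation (\<lambda>\<omega>. (?T \<omega> - expectation ?T)\<^sup>2)) * sqrt (expectation (\<lambda>\<omega>. (f' (?Y \<omega>))\<^sup>2))"
    by (rule integral_cauchy_schwarz[OF _ _ T2 f'2]) auto
  also have "\<dots> \<le> B * 2"
  proof (intro mult_mono)
    show "sqrt (expectation (\<lambda>\<omega>. (?T \<omega> - expectation ?T)\<^sup>2)) \<le> B"
      using B by (intro real_le_lsqrt) auto
    have "expectation (\<lambda>\<omega>. (f' (?Y \<omega>))\<^sup>2) \<le> 2\<^sup>2"
      using power_mono[OF f'b, of _ 2] by (intro integral_le_const f'2 AE_I2) simp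
    then show "sqrt (expectation (\<lambda>\<omega>. (f' (?Y \<omega>))\<^sup>2)) \<le> 2" by (intro real_le_lsqrt) auto
  qed (use B in auto)
  finally show ?thesis unfolding e by simp
qed

lemma hermite_expansion_X:
  assumes g: "has_hermite_expansion g c"
  shows "(\<lambda>\<omega>. g (X j \<omega>)) \<in> borel_measurable M" "integrable M (\<lambda>\<omega>. (g (X j \<omega>))\<^sup>2)"
    "integrable M (\<lambda>\<omega>. (hermite_poly c m (X j \<omega>) - g (X j \<omega>))\<^sup>2)"
    "(\<lambda>m. expectation (\<lambda>\<omega>. (hermite_poly c m (X j \<omega>) - g (X j \<omega>))\<^sup>2)) \<longlonglongrightarrow> 0"
    "expectation (\<lambda>\<omega>. g (X j \<omega>)) = c 0"
    "expectation (\<lambda>\<omega>. (hermite_poly c m (X j \<omega>) - g (X j \<omega>))\<^sup>2) = (\<integral>x. (g x - hermite_poly c m x)\<^sup>2 \<partial>std_normal_distribution)"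
proof -
  note gg = hermite_expansion_L2[OF g]
  note [measurable] = gg(1)
  show "(\<lambda>\<omega>. g (X j \<omega>)) \<in> borel_measurable M" by measurable
  have tr: "integrable M (\<lambda>\<omega>. F (X j \<omega>))" if "integrable std_normal_distribution F" "F \<in> borel_measurable borel" for F :: "real \<Rightarrow> real"
    using that X_distr[of j] by (simp flip: integrable_distr_eq[of "X j" M borel F])
  have tri: "expectation (\<lambda>\<omega>. F (X j \<omega>)) = (\<integral>x. F x \<partial>std_normal_distribution)" if "F \<in> borel_measurable borel" for F :: "real \<Rightarrow> real"
    using integral_distr[of "X j" M borel F] that X_distr[of j] by simp
  show "integrable M (\<lambda>\<omega>. (g (X j \<omega>))\<^sup>2)" by (rule tr[OF gg(2)]) simp
  have "integrable M (\<lambda>\<omega>. (g (X j \<omega>) - hermite_poly c m (X j \<omega>))\<^sup>2)" for m by (rule tr[OF gg(3)]) simp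
  then show "integrable M (\<lambda>\<omega>. (hermite_poly c m (X j \<omega>) - g (X j \<omega>))\<^sup>2)" by (simp add: power2_commute)
  show e: "expectation (\<lambda>\<omega>. (hermite_poly c m (X j \<omega>) - g (X j \<omega>))\<^sup>2) = (\<integral>x. (g x - hermite_poly c m x)\<^sup>2 \<partial>std_normal_distribution)" for m
    by (subst tri[symmetric]) (simp_all add: power2_commute)
  show "(\<lambda>m. expectation (\<lambda>\<omega>. (hermite_poly c m (X j \<omega>) - g (X j \<omega>))\<^sup>2)) \<longlonglongrightarrow> 0"
    unfolding e by (rule gg(4))
  show "expectation (\<lambda>\<omega>. g (X j \<omega>)) = c 0"
    using hermite_expansion_coeff[OF g, of 0] tri[of g] by (simp add: hermite_0)
qed

text \<open>\<open>f'\<close> is only continuous and bounded, so its expectation along the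
  truncations P is rewritten by Stein's equation as the expectation of P * f(P) + h(P) - \<mu>.
  These quantities converge when P converges in \<open>L\<^sup>2\<close>, because f is bounded and
  2-Lipschitz and h is Lipschitz. The constant \<open>L\<close> affects only the speed of that
  convergence, while \<open>B\<close> is uniform in the truncation.\<close>

lemma lipschitz_test_bound:
  assumes g: "has_hermite_expansion g c" and c0: "c 0 = 0" and J: "finite J"
    and Y1: "expectation (\<lambda>\<omega>. (\<kappa> * (\<Sum>j\<in>J. g (X j \<omega>)))\<^sup>2) = 1"
    and B: "0 \<le> B" "\<And>m. expectation (\<lambda>\<omega>. (stein_kernel J \<kappa> c m \<omega> - expectation (stein_kernel J \<kappa> c m))\<^sup>2) \<le> B\<^sup>2"
    and h: "\<And>x y. \<bar>h x - h y\<bar> \<le> L * \<bar>x - y\<bar>" "\<And>x. 0 \<le> h x" "\<And>x. h x \<le> 1"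
  shows "\<bar>expectation (\<lambda>\<omega>. h (\<kappa> * (\<Sum>j\<in>J. g (X j \<omega>)))) - (\<integral>x. h x \<partial>std_normal_distribution)\<bar> \<le> 2 * B"
proof -
  let ?\<mu> = "\<integral>x. h x \<partial>std_normal_distribution"
  define Y where "Y \<omega> = \<kappa> * (\<Sum>j\<in>J. g (X j \<omega>))" for \<omega>
  define D where "D m \<omega> = poly_sum J \<kappa> c m \<omega> - Y \<omega>" for m \<omega>
  note gX = hermite_expansion_X[OF g]
  note [measurable] = gX(1)
  have Ym[measurable]: "Y \<in> borel_measurable M" unfolding Y_def[abs_def] by measurable
  have Pm[measurable]: "poly_sum J \<kappa> c m \<in> borel_measurable M" for m
    by (rule all_moments_measurable[OF poly_sum_all_moments])
  have Dm[measurable]: "D m \<in> borel_measurable M" for m unfolding D_def[abs_def] by measurable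
  have Dle: "(D m \<omega>)\<^sup>2 \<le> (\<kappa>\<^sup>2 * real (card J)) * (\<Sum>j\<in>J. (hermite_poly c (Suc m) (X j \<omega>) - g (X j \<omega>))\<^sup>2)" for m \<omega>
  proof -
    have "D m \<omega> = \<kappa> * (\<Sum>j\<in>J. hermite_poly c (Suc m) (X j \<omega>) - g (X j \<omega>))"
      by (simp add: D_def Y_def poly_sum_def sum_subtractf right_diff_distrib)
    then have "(D m \<omega>)\<^sup>2 = \<kappa>\<^sup>2 * (\<Sum>j\<in>J. hermite_poly c (Suc m) (X j \<omega>) - g (X j \<omega>))\<^sup>2"
      by (simp add: power_mult_distrib)
    also have "\<dots> \<le> \<kappa>\<^sup>2 * ((\<Sum>j\<in>J. (hermite_poly c (Suc m) (X j \<omega>) - g (X j \<omega>))\<^sup>2) * real (card J))"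
      using Cauchy_Schwarz_ineq_sum[of "\<lambda>j. hermite_poly c (Suc m) (X j \<omega>) - g (X j \<omega>)" "\<lambda>_. 1" J]
      by (intro mult_left_mono) simp_all
    finally show ?thesis by (simp add: mult_ac)
  qed
  have Si: "integrable M (\<lambda>\<omega>. (\<kappa>\<^sup>2 * real (card J)) * (\<Sum>j\<in>J. (hermite_poly c (Suc m) (X j \<omega>) - g (X j \<omega>))\<^sup>2))" for m
    by (intro integrable_mult_right Bochner_Integration.integrable_sum gX(3))
  have D2: "integrable M (\<lambda>\<omega>. (D m \<omega>)\<^sup>2)" for m
    by (rule Bochner_Integration.integrable_bound[OF Si[of m]])
       (auto intro!: AE_I2 order_trans[OF Dle])
  have Dlim: "(\<lambda>m. expectation (\<lambda>\<omega>. (D m \<omega>)\<^sup>2)) \<longlonglongrightarrow> 0"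
  proof (rule Lim_null_comparison)
    show "\<forall>\<^sub>F m in sequentially. norm (expectation (\<lambda>\<omega>. (D m \<omega>)\<^sup>2)) \<le>
      (\<kappa>\<^sup>2 * real (card J)) * (\<Sum>j\<in>J. expectation (\<lambda>\<omega>. (hermite_poly c (Suc m) (X j \<omega>) - g (X j \<omega>))\<^sup>2))"
    proof (intro always_eventually allI)
      fix m
      have "norm (expectation (\<lambda>\<omega>. (D m \<omega>)\<^sup>2)) = expectation (\<lambda>\<omega>. (D m \<omega>)\<^sup>2)" by simp
      also have "\<dots> \<le> expectation (\<lambda>\<omega>. (\<kappa>\<^sup>2 * real (card J)) * (\<Sum>j\<in>J. (hermite_poly c (Suc m) (X j \<omega>) - g (X j \<omega>))\<^sup>2))"
        by (intro integral_mono D2 Si Dle)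
      also have "\<dots> = (\<kappa>\<^sup>2 * real (card J)) * (\<Sum>j\<in>J. expectation (\<lambda>\<omega>. (hermite_poly c (Suc m) (X j \<omega>) - g (X j \<omega>))\<^sup>2))"
        by (simp add: Bochner_Integration.integral_sum gX(3))
      finally show "norm (expectation (\<lambda>\<omega>. (D m \<omega>)\<^sup>2)) \<le> \<dots>" .
    qed
    have "(\<lambda>m. (\<kappa>\<^sup>2 * real (card J)) * (\<Sum>j\<in>J. expectation (\<lambda>\<omega>. (hermite_poly c (Suc m) (X j \<omega>) - g (X j \<omega>))\<^sup>2)))
       \<longlonglongrightarrow> (\<kappa>\<^sup>2 * real (card J)) * (\<Sum>j\<in>J. 0)"
      by (intro tendsto_mult tendsto_const tendsto_sum LIMSEQ_Suc gX(4))
    then show "(\<lambda>m. (\<kappa>\<^sup>2 * real (card J)) * (\<Sum>j\<in>J. expectation (\<lambda>\<omega>. (hermite_poly c (Suc m) (X j \<omega>) - g (X j \<omega>))\<^sup>2))) \<longlonglongrightarrow> 0"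
      by simp
  qed
  have P2: "integrable M (\<lambda>\<omega>. (poly_sum J \<kappa> c m \<omega>)\<^sup>2)" for m
    by (intro all_moments_integrable all_moments_power poly_sum_all_moments)
  have Y2: "integrable M (\<lambda>\<omega>. (Y \<omega>)\<^sup>2)"
  proof (rule Bochner_Integration.integrable_bound[OF integrable_mult_right[of 2, OF Bochner_Integration.integrable_add[OF P2[of 0] D2[of 0]]]])
    show "AE \<omega> in M. norm ((Y \<omega>)\<^sup>2) \<le> norm (2 * ((poly_sum J \<kappa> c 0 \<omega>)\<^sup>2 + (D 0 \<omega>)\<^sup>2))"
    proof (rule AE_I2)
      fix \<omega>
      have y: "Y \<omega> = poly_sum J \<kappa> c 0 \<omega> - D 0 \<omega>" by (simp add: D_def)
      have "(Y \<omega>)\<^sup>2 + (poly_sum J \<kappa> c 0 \<omega> + D 0 \<omega>)\<^sup>2 = 2 * ((poly_sum J \<kappa> c 0 \<omega>)\<^sup>2 + (D 0 \<omega>)\<^sup>2)"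
        unfolding y by (simp add: power2_eq_square algebra_simps)
      moreover have "0 \<le> (poly_sum J \<kappa> c 0 \<omega> + D 0 \<omega>)\<^sup>2" by simp
      ultimately have "(Y \<omega>)\<^sup>2 \<le> 2 * ((poly_sum J \<kappa> c 0 \<omega>)\<^sup>2 + (D 0 \<omega>)\<^sup>2)" by linarith
      then show "norm ((Y \<omega>)\<^sup>2) \<le> norm (2 * ((poly_sum J \<kappa> c 0 \<omega>)\<^sup>2 + (D 0 \<omega>)\<^sup>2))" by simp
    qed
  qed simp
  have one2: "integrable M (\<lambda>\<omega>. (1::real)\<^sup>2)" by simp
  have lim1: "(\<lambda>m. expectation (\<lambda>\<omega>. \<bar>1\<bar> * \<bar>D m \<omega>\<bar>)) \<longlonglongrightarrow> 0"
    by (rule integral_abs_mult_tendsto_0[OF _ _ one2 D2 Dlim]) auto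
  have limY: "(\<lambda>m. expectation (\<lambda>\<omega>. \<bar>Y \<omega>\<bar> * \<bar>D m \<omega>\<bar>)) \<longlonglongrightarrow> 0"
    by (rule integral_abs_mult_tendsto_0[OF _ _ Y2 D2 Dlim]) auto
  have Di: "integrable M (\<lambda>\<omega>. \<bar>D m \<omega>\<bar>)" for m
    using integrable_mult_square[OF _ _ one2 D2[of m]] by simp
  have YDi: "integrable M (\<lambda>\<omega>. \<bar>Y \<omega>\<bar> * \<bar>D m \<omega>\<bar>)" for m
    by (rule integrable_mult_square) (use Y2 D2 in auto)
  have ch: "continuous_on UNIV h" by (rule continuous_on_real_lipschitz[OF h(1)])
  have [measurable]: "h \<in> borel_measurable borel" by (rule borel_measurable_continuous_onI[OF ch])
  obtain f f' K where f: "\<And>x. (f has_real_derivative f' x) (at x)" and cf': "continuous_on UNIV f'"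
    and fK: "\<And>x. \<bar>f x\<bar> \<le> K" and f'2: "\<And>x. \<bar>f' x\<bar> \<le> 2" and st: "\<And>x. f' x - x * f x = h x - ?\<mu>"
    using stein_solution[OF ch h(2,3)] by blast
  have K0: "0 \<le> K" using fK[of 0] by linarith
  have cf: "continuous_on UNIV f" by (intro continuous_at_imp_continuous_on ballI DERIV_isCont[OF f])
  have [measurable]: "f \<in> borel_measurable borel" by (rule borel_measurable_continuous_onI[OF cf])
  have flip: "\<bar>f x - f y\<bar> \<le> 2 * \<bar>x - y\<bar>" for x y
    using field_differentiable_bound[of UNIV f f' 2 x y] f f'2 by (auto simp: has_field_derivative_at_within)
  let ?P = "\<lambda>m. poly_sum J \<kappa> c m"
  have iPf: "integrable M (\<lambda>\<omega>. W \<omega> * f (W \<omega>))" if [measurable]: "W \<in> borel_measurable M" and "integrable M (\<lambda>\<omega>. (W \<omega>)\<^sup>2)" for W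
  proof (rule integrable_mult_square)
    have "\<bar>f x\<bar>\<^sup>2 \<le> K\<^sup>2" for x by (rule power_mono[OF fK]) simp
    then show "integrable M (\<lambda>\<omega>. (f (W \<omega>))\<^sup>2)"
      by (intro integrable_const_bound[where B="K\<^sup>2"]) auto
  qed (use that in auto)
  have ih: "integrable M (\<lambda>\<omega>. h (W \<omega>))" if [measurable]: "W \<in> borel_measurable M" for W
    by (rule integrable_const_bound[where B=1]) (auto simp: h)
  define a b v where "a m = expectation (\<lambda>\<omega>. ?P m \<omega> * f (?P m \<omega>))"
    and "b m = expectation (\<lambda>\<omega>. h (?P m \<omega>)) - ?\<mu>" and "v m = expectation (\<lambda>\<omega>. (?P m \<omega>)\<^sup>2)" for m
  have key: "\<bar>a m - v m * (a m + b m)\<bar> \<le> 2 * B" for m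
  proof -
    have "expectation (\<lambda>\<omega>. f' (?P m \<omega>)) = expectation (\<lambda>\<omega>. ?P m \<omega> * f (?P m \<omega>) + (h (?P m \<omega>) - ?\<mu>))"
      by (intro Bochner_Integration.integral_cong refl) (use st in \<open>simp add: algebra_simps\<close>)
    also have "\<dots> = a m + b m"
      unfolding a_def b_def using iPf[OF Pm P2] ih[OF Pm[of m]] by (simp add: prob_space)
    finally have "expectation (\<lambda>\<omega>. f' (?P m \<omega>)) = a m + b m" .
    then show ?thesis
      using stein_truncated[where c=c and f=f and f'=f', OF J c0 f cf' fK f'2 B(1) B(2)[of m]] by (simp add: a_def v_def)
  qed
  have alim: "a \<longlonglongrightarrow> expectation (\<lambda>\<omega>. Y \<omega> * f (Y \<omega>))"
    unfolding a_def
  proof (rule integral_tendsto_of_abs_diff_le[where V="\<lambda>m \<omega>. K * \<bar>D m \<omega>\<bar> + 2 * (\<bar>Y \<omega>\<bar> * \<bar>D m \<omega>\<bar>)"])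
    show "integrable M (\<lambda>\<omega>. ?P m \<omega> * f (?P m \<omega>))" for m by (rule iPf[OF Pm P2])
    show "integrable M (\<lambda>\<omega>. Y \<omega> * f (Y \<omega>))" by (rule iPf[OF Ym Y2])
    show "integrable M (\<lambda>\<omega>. K * \<bar>D m \<omega>\<bar> + 2 * (\<bar>Y \<omega>\<bar> * \<bar>D m \<omega>\<bar>))" for m
      by (intro Bochner_Integration.integrable_add integrable_mult_right Di YDi)
    show "\<bar>?P m \<omega> * f (?P m \<omega>) - Y \<omega> * f (Y \<omega>)\<bar> \<le> K * \<bar>D m \<omega>\<bar> + 2 * (\<bar>Y \<omega>\<bar> * \<bar>D m \<omega>\<bar>)" for m \<omega>
    proof -
      have "?P m \<omega> * f (?P m \<omega>) - Y \<omega> * f (Y \<omega>) = D m \<omega> * f (?P m \<omega>) + Y \<omega> * (f (?P m \<omega>) - f (Y \<omega>))"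
        by (simp add: D_def algebra_simps)
      then have "\<bar>?P m \<omega> * f (?P m \<omega>) - Y \<omega> * f (Y \<omega>)\<bar> \<le> \<bar>D m \<omega>\<bar> * \<bar>f (?P m \<omega>)\<bar> + \<bar>Y \<omega>\<bar> * \<bar>f (?P m \<omega>) - f (Y \<omega>)\<bar>"
        by (metis abs_mult abs_triangle_ineq)
      also have "\<dots> \<le> \<bar>D m \<omega>\<bar> * K + \<bar>Y \<omega>\<bar> * (2 * \<bar>D m \<omega>\<bar>)"
        by (intro add_mono mult_left_mono fK) (use flip in \<open>auto simp: D_def\<close>)
      finally show ?thesis by (simp add: mult_ac)
    qed
    have "(\<lambda>m. K * expectation (\<lambda>\<omega>. \<bar>D m \<omega>\<bar>) + 2 * expectation (\<lambda>\<omega>. \<bar>Y \<omega>\<bar> * \<bar>D m \<omega>\<bar>)) \<longlonglongrightarrow> K * 0 + 2 * 0"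
      using lim1 by (intro tendsto_intros limY) simp
    then show "(\<lambda>m. expectation (\<lambda>\<omega>. K * \<bar>D m \<omega>\<bar> + 2 * (\<bar>Y \<omega>\<bar> * \<bar>D m \<omega>\<bar>))) \<longlonglongrightarrow> 0"
      using Di YDi by simp
  qed
  have vlim: "v \<longlonglongrightarrow> 1"
  proof -
    have "v \<longlonglongrightarrow> expectation (\<lambda>\<omega>. (Y \<omega>)\<^sup>2)"
      unfolding v_def
    proof (rule integral_tendsto_of_abs_diff_le[where V="\<lambda>m \<omega>. (D m \<omega>)\<^sup>2 + 2 * (\<bar>Y \<omega>\<bar> * \<bar>D m \<omega>\<bar>)"])
      show "integrable M (\<lambda>\<omega>. (D m \<omega>)\<^sup>2 + 2 * (\<bar>Y \<omega>\<bar> * \<bar>D m \<omega>\<bar>))" for m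
        by (intro Bochner_Integration.integrable_add integrable_mult_right D2 YDi)
      show "\<bar>(?P m \<omega>)\<^sup>2 - (Y \<omega>)\<^sup>2\<bar> \<le> (D m \<omega>)\<^sup>2 + 2 * (\<bar>Y \<omega>\<bar> * \<bar>D m \<omega>\<bar>)" for m \<omega>
      proof -
        have "(?P m \<omega>)\<^sup>2 - (Y \<omega>)\<^sup>2 = (D m \<omega>)\<^sup>2 + 2 * (Y \<omega> * D m \<omega>)"
          by (simp add: D_def power2_eq_square algebra_simps)
        then have "\<bar>(?P m \<omega>)\<^sup>2 - (Y \<omega>)\<^sup>2\<bar> \<le> \<bar>(D m \<omega>)\<^sup>2\<bar> + \<bar>2 * (Y \<omega> * D m \<omega>)\<bar>"
          by (metis abs_triangle_ineq)
        then show ?thesis by (simp add: abs_mult)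
      qed
      have "(\<lambda>m. expectation (\<lambda>\<omega>. (D m \<omega>)\<^sup>2) + 2 * expectation (\<lambda>\<omega>. \<bar>Y \<omega>\<bar> * \<bar>D m \<omega>\<bar>)) \<longlonglongrightarrow> 0 + 2 * 0"
        by (intro tendsto_intros limY Dlim)
      then show "(\<lambda>m. expectation (\<lambda>\<omega>. (D m \<omega>)\<^sup>2 + 2 * (\<bar>Y \<omega>\<bar> * \<bar>D m \<omega>\<bar>))) \<longlonglongrightarrow> 0"
        using D2 YDi by simp
    qed (rule P2 Y2)+
    then show ?thesis using Y1 by (simp add: Y_def)
  qed
  have blim: "b \<longlonglongrightarrow> expectation (\<lambda>\<omega>. h (Y \<omega>)) - ?\<mu>"
    unfolding b_def
  proof (intro tendsto_diff tendsto_const integral_tendsto_of_abs_diff_le[where V="\<lambda>m \<omega>. L * \<bar>D m \<omega>\<bar>"] ih Pm Ym)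
    show "integrable M (\<lambda>\<omega>. L * \<bar>D m \<omega>\<bar>)" for m by (intro integrable_mult_right Di)
    show "\<bar>h (?P m \<omega>) - h (Y \<omega>)\<bar> \<le> L * \<bar>D m \<omega>\<bar>" for m \<omega> unfolding D_def by (rule h(1))
    show "(\<lambda>m. expectation (\<lambda>\<omega>. L * \<bar>D m \<omega>\<bar>)) \<longlonglongrightarrow> 0" using tendsto_mult_left[OF lim1, of L] by simp
  qed
  let ?a = "expectation (\<lambda>\<omega>. Y \<omega> * f (Y \<omega>))" and ?b = "expectation (\<lambda>\<omega>. h (Y \<omega>)) - ?\<mu>"
  \<comment> \<open>The limiting second moment is 1, so the two copies of \<open>?a\<close> cancel
    and only \<open>?b\<close> remains.\<close>
  have "(\<lambda>m. \<bar>a m - v m * (a m + b m)\<bar>) \<longlonglongrightarrow> \<bar>?a - 1 * (?a + ?b)\<bar>"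
    by (intro tendsto_intros alim blim vlim)
  then have "\<bar>?a - 1 * (?a + ?b)\<bar> \<le> 2 * B"
    by (rule LIMSEQ_le_const2) (use key in auto)
  then show ?thesis by (simp add: Y_def)
qed

end

section \<open>The limit variance\<close>

text \<open>Rows away from the boundary contain a finite set that captures the total sum up to a
  quarter of it. Each of the remaining rows, at most 2m of them, is at least \<open>- A\<close>,
  where \<open>A\<close> is the sum of the absolute values.\<close>

lemma toeplitz_average_lower_bound:
  fixes F :: "int \<Rightarrow> real"
  assumes F: "F summable_on UNIV" and L: "0 < infsum F UNIV"
  shows "\<exists>N. \<forall>n\<ge>N. infsum F UNIV / 2 \<le> (1 / real n) * (\<Sum>i=1..n. \<Sum>j=1..n. F (int i - int j))"
proof -
  define L where "L = infsum F UNIV"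
  have L0: "0 < L" using L by (simp add: L_def)
  have absF: "(\<lambda>k. \<bar>F k\<bar>) summable_on UNIV" using iffD1[OF summable_on_iff_abs_summable_on_real F] by simp
  define A where "A = infsum (\<lambda>k. \<bar>F k\<bar>) UNIV"
  have A: "\<bar>sum F S\<bar> \<le> A" if "finite S" for S
  proof -
    have "\<bar>sum F S\<bar> \<le> (\<Sum>k\<in>S. \<bar>F k\<bar>)" by (rule sum_abs)
    also have "\<dots> \<le> A" unfolding A_def using absF that by (intro finite_sum_le_infsum) auto
    finally show ?thesis .
  qed
  have A0: "0 \<le> A" using A[of "{}"] by simp
  have "(F has_sum L) UNIV" unfolding L_def using F by (rule has_sum_infsum)
  then have "\<forall>\<^sub>F S in finite_subsets_at_top UNIV. dist (sum F S) L < L / 4"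
    using L0 unfolding has_sum_def tendsto_iff by (auto dest: spec[of _ "L / 4"])
  then obtain S0 where S0: "finite S0" "\<And>S. finite S \<Longrightarrow> S0 \<subseteq> S \<Longrightarrow> dist (sum F S) L < L / 4"
    unfolding eventually_finite_subsets_at_top by auto
  \<comment> \<open>\<open>S0\<close> lies in [-m, m], so the differences in row i include
    \<open>S0\<close> whenever m < i and i + m \<le> n.\<close>
  define m where "m = nat (Max (insert 0 (abs ` S0)))"
  have m: "\<bar>k\<bar> \<le> int m" if "k \<in> S0" for k
  proof -
    have "\<bar>k\<bar> \<le> Max (insert 0 (abs ` S0))" using that S0(1) by (intro Max_ge) auto
    moreover have "0 \<le> \<bar>k\<bar>" by simp
    ultimately show ?thesis unfolding m_def by linarith
  qed
  have row: "3 * L / 4 - (A + L) * (of_bool (i \<le> m) + of_bool (n < i + m)) \<le> (\<Sum>j=1..n. F (int i - int j))"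
    if i: "i \<in> {1..n}" for i n
  proof -
    have e: "(\<Sum>j=1..n. F (int i - int j)) = sum F ((\<lambda>j. int i - int j) ` {1..n})"
      by (subst sum.reindex) (auto simp: inj_on_def)
    show ?thesis
    proof (cases "i \<le> m \<or> n < i + m")
      case True
      have "A + L \<le> (A + L) * (of_bool (i \<le> m) + of_bool (n < i + m))"
        using mult_left_mono[of 1 "of_bool (i \<le> m) + of_bool (n < i + m)" "A + L"] True A0 L0 by auto
      moreover have "- A \<le> (\<Sum>j=1..n. F (int i - int j))"
        unfolding e using A[of "(\<lambda>j. int i - int j) ` {1..n}"] by auto
      moreover have "3 * L / 4 - x \<le> y" if "A + L \<le> x" "- A \<le> y" for x y
        using that L0 by (simp add: field_simps)
      ultimately show ?thesis by blast
    next
      case False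
      have "S0 \<subseteq> (\<lambda>j. int i - int j) ` {1..n}"
      proof
        fix k assume "k \<in> S0"
        then have k: "\<bar>k\<bar> \<le> int m" by (rule m)
        have "k = int i - int (nat (int i - k))" "nat (int i - k) \<in> {1..n}"
          using k False by auto
        then show "k \<in> (\<lambda>j. int i - int j) ` {1..n}" by blast
      qed
      then have "dist (\<Sum>j=1..n. F (int i - int j)) L < L / 4" unfolding e by (intro S0) auto
      moreover have "3 * L / 4 \<le> y" if "dist y L < L / 4" for y
        using that unfolding dist_real_def abs_less_iff by linarith
      ultimately show ?thesis using False by simp
    qed
  qed
  \<comment> \<open>The boundary rows lose at most \<open>A + L\<close> each, so the average stays
    above L / 2 once 2 m (A + L) / n \<le> L / 4.\<close>
  obtain N where N: "8 * real m * (A + L) / L < real N" using reals_Archimedean2 by blast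
  have "L / 2 \<le> (1 / real n) * (\<Sum>i=1..n. \<Sum>j=1..n. F (int i - int j))" if n: "Suc N \<le> n" for n
  proof -
    have n0: "0 < real n" using n by simp
    have c1: "(\<Sum>i=1..n. of_bool (i \<le> m) :: real) \<le> real m"
    proof -
      have "(\<Sum>i=1..n. of_bool (i \<le> m) :: real) = real (card ({1..n} \<inter> {i. i \<le> m}))"
        by (simp add: sum.If_cases of_bool_def)
      also have "\<dots> \<le> real (card {1..m})" by (intro of_nat_mono card_mono) auto
      finally show ?thesis by simp
    qed
    have c2: "(\<Sum>i=1..n. of_bool (n < i + m) :: real) \<le> real m"
    proof -
      have "(\<Sum>i=1..n. of_bool (n < i + m) :: real) = real (card ({1..n} \<inter> {i. n < i + m}))"
        by (simp add: sum.If_cases of_bool_def)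
      also have "\<dots> \<le> real (card {n - m<..n})" by (intro of_nat_mono card_mono) auto
      finally show ?thesis by simp
    qed
    have "8 * real m * (A + L) < real N * L" using N L0 by (simp add: pos_divide_less_eq)
    also have "\<dots> \<le> real n * L" using n L0 by (intro mult_right_mono) auto
    finally have big: "8 * real m * (A + L) \<le> real n * L" by simp
    have "real n * (L / 2) \<le> real n * (3 * L / 4) - (A + L) * (real m + real m)"
      using big by (simp add: algebra_simps)
    also have "\<dots> \<le> real n * (3 * L / 4) - (A + L) * ((\<Sum>i=1..n. of_bool (i \<le> m)) + (\<Sum>i=1..n. of_bool (n < i + m)))"
      using c1 c2 A0 L0 by (intro diff_left_mono mult_left_mono add_mono) auto
    also have "\<dots> = (\<Sum>i=1..n. 3 * L / 4 - (A + L) * (of_bool (i \<le> m) + of_bool (n < i + m)))"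
      by (simp only: sum_subtractf sum_distrib_left[symmetric] sum.distrib) simp
    also have "\<dots> \<le> (\<Sum>i=1..n. \<Sum>j=1..n. F (int i - int j))"
      by (intro sum_mono row)
    finally show ?thesis using n0 by (simp add: field_simps)
  qed
  then show ?thesis unfolding L_def by blast
qed

text \<open>For q \<ge> d the double series is dominated by
  \<open>fact q * (c q)\<^sup>2 * \<bar>\<rho> k\<bar> ^ d\<close>, a product of summable families,
  so the sums may be exchanged. The sum over q is the covariance of g at lag k, which brings the
  limit variance into the form of \<open>toeplitz_average_lower_bound\<close>.\<close>

lemma limit_variance_eq:
  fixes \<rho> :: "int \<Rightarrow> real" and c :: "nat \<Rightarrow> real"
  assumes s: "summable (\<lambda>q. fact q * (c q)\<^sup>2)" and c0: "\<And>q. q < d \<Longrightarrow> c q = 0"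
    and \<rho>1: "\<And>k. \<bar>\<rho> k\<bar> \<le> 1" and \<rho>d: "(\<lambda>k. \<bar>\<rho> k\<bar> ^ d) summable_on UNIV"
  shows "(\<lambda>k. \<Sum>q. fact q * (c q)\<^sup>2 * \<rho> k ^ q) summable_on UNIV"
    and "limit_variance c d \<rho> = (\<Sum>\<^sub>\<infinity>k\<in>UNIV. \<Sum>q. fact q * (c q)\<^sup>2 * \<rho> k ^ q)"
proof -
  define a where "a q = fact q * (c q)\<^sup>2" for q
  have a0: "0 \<le> a q" for q by (simp add: a_def)
  have aS: "a summable_on {d..}"
  proof (rule summable_on_subset)
    show "a summable_on UNIV" using s a0 by (intro norm_summable_imp_summable_on) (simp add: a_def)
  qed simp
  have row: "(\<Sum>\<^sub>\<infinity>q\<in>{d..}. a q * \<rho> k ^ q) = (\<Sum>q. a q * \<rho> k ^ q)" for k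
  proof -
    have "summable (\<lambda>q. norm (a q * \<rho> k ^ q))"
    proof (rule summable_comparison_test)
      show "\<exists>N. \<forall>q\<ge>N. norm (norm (a q * \<rho> k ^ q)) \<le> a q"
        using a0 \<rho>1 by (auto simp: abs_mult power_abs intro!: mult_left_le power_le_one)
      show "summable a" using s by (simp add: a_def[abs_def])
    qed
    then have "((\<lambda>q. a q * \<rho> k ^ q) has_sum (\<Sum>q. a q * \<rho> k ^ q)) UNIV"
      by (intro norm_summable_imp_has_sum summable_sums) (auto intro: summable_norm_cancel)
    then have "(\<Sum>q. a q * \<rho> k ^ q) = (\<Sum>\<^sub>\<infinity>q\<in>UNIV. a q * \<rho> k ^ q)" by (rule infsumI[symmetric])
    also have "\<dots> = (\<Sum>\<^sub>\<infinity>q\<in>{d..}. a q * \<rho> k ^ q)"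
      by (rule infsum_cong_neutral) (auto simp: a_def c0)
    finally show ?thesis by simp
  qed
  have "(\<lambda>(q, k). a q * \<bar>\<rho> k\<bar> ^ d) summable_on ({d..} \<times> UNIV)"
  proof (rule summable_on_SigmaI)
    show "((\<lambda>k. case (q, k) of (q, k) \<Rightarrow> a q * \<bar>\<rho> k\<bar> ^ d) has_sum a q * infsum (\<lambda>k. \<bar>\<rho> k\<bar> ^ d) UNIV) UNIV" for q
      using has_sum_cmult_right[OF has_sum_infsum[OF \<rho>d], of "a q"] by simp
    show "(\<lambda>q. a q * infsum (\<lambda>k. \<bar>\<rho> k\<bar> ^ d) UNIV) summable_on {d..}"
      using aS by (rule summable_on_cmult_left)
  qed (simp add: a0)
  then have "(\<lambda>z. norm ((\<lambda>(q, k). a q * \<rho> k ^ q) z)) summable_on ({d..} \<times> UNIV)"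
  proof (rule summable_on_comparison_test)
    fix z :: "nat \<times> int" assume z: "z \<in> {d..} \<times> UNIV"
    have "\<bar>\<rho> (snd z)\<bar> ^ fst z \<le> \<bar>\<rho> (snd z)\<bar> ^ d"
      using z \<rho>1 by (intro power_decreasing) auto
    then show "norm ((\<lambda>(q, k). a q * \<rho> k ^ q) z) \<le> (case z of (q, k) \<Rightarrow> a q * \<bar>\<rho> k\<bar> ^ d)"
      using a0 by (auto simp: abs_mult power_abs split_beta' intro!: mult_left_mono)
  qed simp
  then have sm: "(\<lambda>(q, k). a q * \<rho> k ^ q) summable_on ({d..} \<times> UNIV)"
    by (rule abs_summable_summable)
  have "(\<lambda>(k, q). a q * \<rho> k ^ q) summable_on (UNIV \<times> {d..})"
    using sm by (subst (asm) summable_on_swap) simp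
  then have "(\<lambda>k. \<Sum>\<^sub>\<infinity>q\<in>{d..}. a q * \<rho> k ^ q) summable_on UNIV"
    by (rule summable_on_Sigma_banach)
  then show "(\<lambda>k. \<Sum>q. fact q * (c q)\<^sup>2 * \<rho> k ^ q) summable_on UNIV"
    unfolding row by (simp add: a_def)
  have "limit_variance c d \<rho> = (\<Sum>\<^sub>\<infinity>q\<in>{d..}. \<Sum>\<^sub>\<infinity>k\<in>UNIV. a q * \<rho> k ^ q)"
    unfolding limit_variance_def a_def by (simp add: infsum_cmult_right')
  also have "\<dots> = (\<Sum>\<^sub>\<infinity>k\<in>UNIV. \<Sum>\<^sub>\<infinity>q\<in>{d..}. a q * \<rho> k ^ q)"
    by (rule infsum_swap_banach[OF sm])
  finally show "limit_variance c d \<rho> = (\<Sum>\<^sub>\<infinity>k\<in>UNIV. \<Sum>q. fact q * (c q)\<^sup>2 * \<rho> k ^ q)"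
    unfolding row by (simp add: a_def)
qed

context gaussian_family
begin

text \<open>The truncations converge in \<open>L\<^sup>2\<close> at both indices, and orthogonality
  reduces their covariance to the diagonal. At i = j this also gives the summability of
  \<open>fact q * (c q)\<^sup>2\<close>.\<close>

lemma hermite_expansion_covariance_sums:
  assumes g: "has_hermite_expansion g c"
  shows "(\<lambda>q. fact q * (c q)\<^sup>2 * cov i j ^ q) sums expectation (\<lambda>\<omega>. g (X i \<omega>) * g (X j \<omega>))"
proof -
  note gX = hermite_expansion_X[OF g]
  note [measurable] = gX(1)
  let ?D = "\<lambda>m i \<omega>. hermite_poly c m (X i \<omega>) - g (X i \<omega>)"
  have Dm[measurable]: "?D m i \<in> borel_measurable M" for m i by measurable
  have P2: "integrable M (\<lambda>\<omega>. (hermite_poly c m (X i \<omega>))\<^sup>2)" for m i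
    by (intro all_moments_integrable all_moments_power hermite_poly_X_all_moments)
  have "(\<lambda>m. expectation (\<lambda>\<omega>. hermite_poly c m (X i \<omega>) * hermite_poly c m (X j \<omega>)))
     \<longlonglongrightarrow> expectation (\<lambda>\<omega>. g (X i \<omega>) * g (X j \<omega>))"
  proof (rule integral_tendsto_of_abs_diff_le[where V="\<lambda>m \<omega>. (?D m i \<omega>)\<^sup>2 + (?D m j \<omega>)\<^sup>2
        + \<bar>g (X i \<omega>)\<bar> * \<bar>?D m j \<omega>\<bar> + \<bar>g (X j \<omega>)\<bar> * \<bar>?D m i \<omega>\<bar>"])
    show "integrable M (\<lambda>\<omega>. hermite_poly c m (X i \<omega>) * hermite_poly c m (X j \<omega>))" for m
      by (intro all_moments_integrable all_moments_mult hermite_poly_X_all_moments)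
    show "integrable M (\<lambda>\<omega>. g (X i \<omega>) * g (X j \<omega>))"
      by (rule integrable_mult_square[OF _ _ gX(2) gX(2)]) auto
    have gD: "integrable M (\<lambda>\<omega>. \<bar>g (X i \<omega>)\<bar> * \<bar>?D m j \<omega>\<bar>)" for i j m
      by (rule integrable_mult_square) (use gX(2,3) in auto)
    show "integrable M (\<lambda>\<omega>. (?D m i \<omega>)\<^sup>2 + (?D m j \<omega>)\<^sup>2 + \<bar>g (X i \<omega>)\<bar> * \<bar>?D m j \<omega>\<bar> + \<bar>g (X j \<omega>)\<bar> * \<bar>?D m i \<omega>\<bar>)" for m
      by (intro Bochner_Integration.integrable_add gX(3) gD)
    have l: "(\<lambda>m. expectation (\<lambda>\<omega>. \<bar>g (X i \<omega>)\<bar> * \<bar>?D m j \<omega>\<bar>)) \<longlonglongrightarrow> 0" for i j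
      by (rule integral_abs_mult_tendsto_0[OF _ _ gX(2) gX(3) gX(4)]) auto
    have "(\<lambda>m. expectation (\<lambda>\<omega>. (?D m i \<omega>)\<^sup>2) + expectation (\<lambda>\<omega>. (?D m j \<omega>)\<^sup>2) + expectation (\<lambda>\<omega>. \<bar>g (X i \<omega>)\<bar> * \<bar>?D m j \<omega>\<bar>)
       + expectation (\<lambda>\<omega>. \<bar>g (X j \<omega>)\<bar> * \<bar>?D m i \<omega>\<bar>)) \<longlonglongrightarrow> 0 + 0 + 0 + 0"
      by (intro tendsto_add gX(4) l)
    then show "(\<lambda>m. expectation (\<lambda>\<omega>. (?D m i \<omega>)\<^sup>2 + (?D m j \<omega>)\<^sup>2 + \<bar>g (X i \<omega>)\<bar> * \<bar>?D m j \<omega>\<bar> + \<bar>g (X j \<omega>)\<bar> * \<bar>?D m i \<omega>\<bar>)) \<longlonglongrightarrow> 0"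
      using gX(3) gD by simp
    fix m \<omega>
    define x y p q where "x = g (X i \<omega>)" and "y = g (X j \<omega>)" and "p = ?D m i \<omega>" and "q = ?D m j \<omega>"
    have "hermite_poly c m (X i \<omega>) * hermite_poly c m (X j \<omega>) - g (X i \<omega>) * g (X j \<omega>) = p * q + (x * q + y * p)"
      by (simp add: x_def y_def p_def q_def algebra_simps)
    also have "\<bar>\<dots>\<bar> \<le> \<bar>p * q\<bar> + (\<bar>x * q\<bar> + \<bar>y * p\<bar>)" by linarith
    also have "\<bar>p * q\<bar> \<le> p\<^sup>2 + q\<^sup>2"
    proof -
      have "2 * (\<bar>p\<bar> * \<bar>q\<bar>) \<le> p\<^sup>2 + q\<^sup>2" using sum_squares_bound[of "\<bar>p\<bar>" "\<bar>q\<bar>"] by simp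
      moreover have "0 \<le> \<bar>p\<bar> * \<bar>q\<bar>" by simp
      ultimately show ?thesis unfolding abs_mult by linarith
    qed
    finally show "\<bar>hermite_poly c m (X i \<omega>) * hermite_poly c m (X j \<omega>) - g (X i \<omega>) * g (X j \<omega>)\<bar>
       \<le> (?D m i \<omega>)\<^sup>2 + (?D m j \<omega>)\<^sup>2 + \<bar>g (X i \<omega>)\<bar> * \<bar>?D m j \<omega>\<bar> + \<bar>g (X j \<omega>)\<bar> * \<bar>?D m i \<omega>\<bar>"
      by (simp add: x_def y_def p_def q_def abs_mult)
  qed
  moreover have "expectation (\<lambda>\<omega>. hermite_poly c m (X i \<omega>) * hermite_poly c m (X j \<omega>)) = (\<Sum>q<m. fact q * (c q)\<^sup>2 * cov i j ^ q)" for m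
  proof -
    have "expectation (\<lambda>\<omega>. hermite_poly c m (X i \<omega>) * hermite_poly c m (X j \<omega>)) =
      (\<Sum>a<m. \<Sum>b<m. if a = b then fact a * (c a)\<^sup>2 * cov i j ^ a else 0)"
      unfolding hermite_poly2_expectation expectation_hermite_mult
      by (intro sum.cong refl) (simp add: power2_eq_square)
    then show ?thesis by simp
  qed
  ultimately show ?thesis by (simp add: sums_def)
qed

lemma hermite_coeff_summable:
  assumes g: "has_hermite_expansion g c"
  shows "summable (\<lambda>q. fact q * (c q)\<^sup>2)"
  using sums_summable[OF hermite_expansion_covariance_sums[OF g, of 0 0]] by (simp add: cov_self)

lemma partial_sum_moments:
  assumes g: "has_hermite_expansion g c" and c0: "c 0 = 0"
  shows "variance (partial_sum g X n) = expectation (\<lambda>\<omega>. (partial_sum g X n \<omega>)\<^sup>2)"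
    and "variance (partial_sum g X n) = (1 / real n) * (\<Sum>i=1..n. \<Sum>j=1..n. \<Sum>q. fact q * (c q)\<^sup>2 * cov i j ^ q)"
proof -
  note gX = hermite_expansion_X[OF g]
  note [measurable] = gX(1)
  have gg: "integrable M (\<lambda>\<omega>. g (X i \<omega>) * g (X j \<omega>))" for i j
    by (rule integrable_mult_square[OF _ _ gX(2) gX(2)]) auto
  have gi: "integrable M (\<lambda>\<omega>. g (X i \<omega>))" for i
    using integrable_mult_square[OF gX(1)[of i] _ gX(2)[of i], of "\<lambda>_. 1"] by simp
  have "expectation (partial_sum g X n) = 0"
    unfolding partial_sum_def[abs_def] using gi by (simp add: Bochner_Integration.integral_sum gX(5) c0)
  then show v: "variance (partial_sum g X n) = expectation (\<lambda>\<omega>. (partial_sum g X n \<omega>)\<^sup>2)" by simp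
  have "(partial_sum g X n \<omega>)\<^sup>2 = (1 / real n) * (\<Sum>i=1..n. \<Sum>j=1..n. g (X i \<omega>) * g (X j \<omega>))" for \<omega>
    by (simp add: partial_sum_def power_divide power2_eq_square[of "sum _ _"] sum_product)
  then have "expectation (\<lambda>\<omega>. (partial_sum g X n \<omega>)\<^sup>2) = (1 / real n) * (\<Sum>i=1..n. \<Sum>j=1..n. expectation (\<lambda>\<omega>. g (X i \<omega>) * g (X j \<omega>)))"
    using gg by (simp add: Bochner_Integration.integral_sum)
  also have "(\<Sum>i=1..n. \<Sum>j=1..n. expectation (\<lambda>\<omega>. g (X i \<omega>) * g (X j \<omega>))) = (\<Sum>i=1..n. \<Sum>j=1..n. \<Sum>q. fact q * (c q)\<^sup>2 * cov i j ^ q)"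
    by (intro sum.cong refl sums_unique hermite_expansion_covariance_sums g)
  finally show "variance (partial_sum g X n) = (1 / real n) * (\<Sum>i=1..n. \<Sum>j=1..n. \<Sum>q. fact q * (c q)\<^sup>2 * cov i j ^ q)"
    unfolding v .
qed

lemma partial_sum_variance_bounded_below:
  assumes g: "has_hermite_expansion g c" and d: "1 \<le> d" and c0: "\<And>q. q < d \<Longrightarrow> c q = 0"
    and \<rho>: "\<And>i j. cov i j = \<rho> (int i - int j)" and \<rho>1: "\<And>k. \<bar>\<rho> k\<bar> \<le> 1"
    and \<rho>d: "(\<lambda>k. \<bar>\<rho> k\<bar> ^ d) summable_on UNIV" and L: "0 < limit_variance c d \<rho>"
  shows "\<exists>v0>0. \<forall>n\<ge>1. 0 < variance (partial_sum g X n) \<longrightarrow> v0 \<le> variance (partial_sum g X n)"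
proof -
  define F where "F k = (\<Sum>q. fact q * (c q)\<^sup>2 * \<rho> k ^ q)" for k
  let ?L = "limit_variance c d \<rho>"
  note lv = limit_variance_eq[OF hermite_coeff_summable[OF g] c0 \<rho>1 \<rho>d]
  have F: "F summable_on UNIV" "?L = infsum F UNIV" using lv by (simp_all add: F_def[abs_def])
  have c00: "c 0 = 0" using c0 d by simp
  have V: "variance (partial_sum g X n) = (1 / real n) * (\<Sum>i=1..n. \<Sum>j=1..n. F (int i - int j))" for n
    unfolding partial_sum_moments(2)[OF g c00] by (simp add: F_def \<rho>)
  obtain N where N: "\<And>n. N \<le> n \<Longrightarrow> ?L / 2 \<le> variance (partial_sum g X n)"
    unfolding V F(2) using toeplitz_average_lower_bound[OF F(1)] L F(2) by auto
  define S where "S = insert (?L / 2) ((\<lambda>n. variance (partial_sum g X n)) ` {n. n < N \<and> 0 < variance (partial_sum g X n)})"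
  have fS: "finite S" by (simp add: S_def)
  show ?thesis
  proof (intro exI[of _ "Min S"] conjI allI impI)
    show "0 < Min S" using fS L by (subst Min_gr_iff) (auto simp: S_def)
    fix n assume "0 < variance (partial_sum g X n)"
    then show "Min S \<le> variance (partial_sum g X n)"
    proof (cases "n < N")
      case True
      then show ?thesis using \<open>0 < variance (partial_sum g X n)\<close> fS by (intro Min_le) (auto simp: S_def)
    next
      case False
      have "Min S \<le> ?L / 2" using fS by (intro Min_le) (auto simp: S_def)
      then show ?thesis using N[of n] False by simp
    qed
  qed
qed

end

section \<open>The total variation estimate\<close>

text \<open>Shifting by the smaller index moves the pair to the times 0 and |i - j|.\<close>

lemma stationary_covariance:
  assumes st: "stationary_seq M X" and Xm: "\<And>n. X n \<in> borel_measurable M"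
  shows "(\<integral>\<omega>. X i \<omega> * X j \<omega> \<partial>M) = autocov M X (int i - int j)"
proof -
  have le: "(\<integral>\<omega>. X i \<omega> * X j \<omega> \<partial>M) = autocov M X (int i - int j)" if "i \<le> j" for i j
  proof -
    let ?f = "\<lambda>x :: nat \<Rightarrow> real. x 0 * x (j - i)"
    have fm: "?f \<in> borel_measurable seq_space" by measurable
    have m: "(\<lambda>\<omega> l. X (l + k) \<omega>) \<in> M \<rightarrow>\<^sub>M seq_space" for k
      by (rule measurable_PiM_single') (auto simp: space_PiM Xm)
    have "(\<integral>\<omega>. X i \<omega> * X j \<omega> \<partial>M) = (\<integral>\<omega>. ?f (\<lambda>l. X (l + i) \<omega>) \<partial>M)"
      using that by simp
    also have "\<dots> = (\<integral>x. ?f x \<partial>distr M seq_space (\<lambda>\<omega> l. X (l + i) \<omega>))"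
      by (rule integral_distr[symmetric]) (rule m fm)+
    also have "distr M seq_space (\<lambda>\<omega> l. X (l + i) \<omega>) = distr M seq_space (\<lambda>\<omega> l. X l \<omega>)"
      using st unfolding stationary_seq_def by blast
    also have "(\<integral>x. ?f x \<partial>distr M seq_space (\<lambda>\<omega> l. X l \<omega>)) = (\<integral>\<omega>. ?f (\<lambda>l. X l \<omega>) \<partial>M)"
      using m[of 0] by (intro integral_distr fm) simp
    also have "nat \<bar>int i - int j\<bar> = j - i" using that by linarith
    then have "(\<integral>\<omega>. ?f (\<lambda>l. X l \<omega>) \<partial>M) = autocov M X (int i - int j)"
      unfolding autocov_def by (simp only:)
    finally show ?thesis .
  qed
  show ?thesis
  proof (cases "i \<le> j")
    case True then show ?thesis by (rule le)
  next
    case False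
    then have "(\<integral>\<omega>. X j \<omega> * X i \<omega> \<partial>M) = autocov M X (int j - int i)" by (intro le) simp
    then show ?thesis by (simp add: autocov_def mult.commute abs_minus_commute)
  qed
qed

lemma tv_dist_le:
  assumes "prob_space M" and Y: "Y \<in> borel_measurable M"
    and "prob_space N" and Z: "distributed N lborel Z std_normal_density"
    and b: "\<And>h L. (\<And>x y. \<bar>h x - h y\<bar> \<le> L * \<bar>x - y\<bar>) \<Longrightarrow> (\<And>x. 0 \<le> h x) \<Longrightarrow> (\<And>x. h x \<le> 1) \<Longrightarrow>
       \<bar>(\<integral>\<omega>. h (Y \<omega>) \<partial>M) - (\<integral>x. h x \<partial>std_normal_distribution)\<bar> \<le> b"
  shows "tv_dist M Y N Z \<le> b"
  unfolding tv_dist_def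
proof (rule cSUP_least)
  fix B :: "real set" assume B: "B \<in> sets borel"
  interpret M: prob_space M by fact
  interpret N: prob_space N by fact
  have Zm: "Z \<in> borel_measurable N" using Z by (auto simp: distributed_def)
  have "distr N borel Z = distr N lborel Z" by (rule distr_cong) auto
  also have "\<dots> = std_normal_distribution" by (rule distributed_distr_eq_density[OF Z])
  finally have dZ: "distr N borel Z = std_normal_distribution" .
  have "\<bar>measure (distr M borel Y) B - measure std_normal_distribution B\<bar> \<le> b"
  proof (rule total_variation_from_lipschitz[OF _ real_dist_normal_dist _ B])
    show "real_distribution (distr M borel Y)" by (rule M.real_distribution_distr) (rule Y)
    fix h :: "real \<Rightarrow> real" and L
    assume h: "\<And>x y. \<bar>h x - h y\<bar> \<le> L * \<bar>x - y\<bar>" "\<And>x. 0 \<le> h x" "\<And>x. h x \<le> 1"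
    have hm: "h \<in> borel_measurable borel"
      by (rule borel_measurable_continuous_onI[OF continuous_on_real_lipschitz[OF h(1)]])
    have "(\<integral>x. h x \<partial>distr M borel Y) = (\<integral>\<omega>. h (Y \<omega>) \<partial>M)" by (rule integral_distr[OF Y hm])
    then show "\<bar>(\<integral>x. h x \<partial>distr M borel Y) - (\<integral>x. h x \<partial>std_normal_distribution)\<bar> \<le> b"
      using b[OF h] by simp
  qed
  moreover have "measure (distr M borel Y) B = measure M {\<omega> \<in> space M. Y \<omega> \<in> B}"
    using Y B by (subst measure_distr) (auto intro!: arg_cong[where f="measure M"])
  moreover have "measure std_normal_distribution B = measure N {\<omega> \<in> space N. Z \<omega> \<in> B}"
    unfolding dZ[symmetric] using Zm B by (subst measure_distr) (auto intro!: arg_cong[where f="measure N"])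
  ultimately show "\<bar>measure M {\<omega> \<in> space M. Y \<omega> \<in> B} - measure N {\<omega> \<in> space N. Z \<omega> \<in> B}\<bar> \<le> b" by simp
qed auto

text \<open>\<open>R\<close> is to be a bound uniform in n, so that the leaves with exponent d only
  affect the constant.\<close>

lemma (in gaussian_family) sum4_pair_weight_le:
  assumes \<rho>: "\<And>i j. cov i j = \<rho> (int i - int j)" and even: "\<And>k. \<rho> (- k) = \<rho> k" and n: "1 \<le> n"
    and R: "(\<Sum>k\<in>{-int n..int n}. \<bar>\<rho> k\<bar> ^ d) \<le> R"
  shows "sum4 {1..n} (pair_weight d) \<le> 36 * real n * (\<Sum>k\<in>{-int n..int n}. \<bar>\<rho> k\<bar>) * (\<Sum>k\<in>{-int n..int n}. \<bar>\<rho> k\<bar>\<^sup>2) * R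
     + (if d = 2 then 12 * real n * (\<Sum>k\<in>{-int n..int n}. \<bar>\<rho> k\<bar> powr (4/3)) ^ 3 else 0)"
proof -
  let ?I = "{1..n}" and ?K = "{-int n..int n}"
  have ne: "?I \<noteq> {}" using n by simp
  have 1: "row_bounded ?I (\<Sum>k\<in>?K. \<bar>\<rho> k\<bar>) (\<lambda>i j. \<bar>cov i j\<bar>)"
    unfolding \<rho> by (rule row_bounded_differences) (simp_all add: even)
  have 2: "row_bounded ?I (\<Sum>k\<in>?K. \<bar>\<rho> k\<bar>\<^sup>2) (\<lambda>i j. \<bar>cov i j\<bar>\<^sup>2)"
    unfolding \<rho> by (rule row_bounded_differences) (simp_all add: even)
  have d: "row_bounded ?I (\<Sum>k\<in>?K. \<bar>\<rho> k\<bar> ^ d) (\<lambda>i j. \<bar>cov i j\<bar> ^ d)"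
    unfolding \<rho> by (rule row_bounded_differences) (simp_all add: even)
  have q: "row_bounded ?I (\<Sum>k\<in>?K. \<bar>\<rho> k\<bar> powr (4/3)) (\<lambda>i j. \<bar>cov i j\<bar> powr (4/3))"
    unfolding \<rho> by (rule row_bounded_differences) (simp_all add: even)
  have "sum4 ?I (\<lambda>i j k l. tree_weight d \<bar>cov i j\<bar> \<bar>cov k l\<bar> \<bar>cov i k\<bar> \<bar>cov i l\<bar> \<bar>cov j k\<bar> \<bar>cov j l\<bar>)
    \<le> 36 * real (card ?I) * (\<Sum>k\<in>?K. \<bar>\<rho> k\<bar>) * (\<Sum>k\<in>?K. \<bar>\<rho> k\<bar>\<^sup>2) * (\<Sum>k\<in>?K. \<bar>\<rho> k\<bar> ^ d)"
    by (rule sum4_tree_weight[OF _ ne 1 2 d]) simp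
  also have "\<dots> \<le> 36 * real (card ?I) * (\<Sum>k\<in>?K. \<bar>\<rho> k\<bar>) * (\<Sum>k\<in>?K. \<bar>\<rho> k\<bar>\<^sup>2) * R"
    by (intro mult_left_mono R mult_nonneg_nonneg sum_nonneg) auto
  finally have t: "sum4 ?I (\<lambda>i j k l. tree_weight d \<bar>cov i j\<bar> \<bar>cov k l\<bar> \<bar>cov i k\<bar> \<bar>cov i l\<bar> \<bar>cov j k\<bar> \<bar>cov j l\<bar>)
    \<le> 36 * real n * (\<Sum>k\<in>?K. \<bar>\<rho> k\<bar>) * (\<Sum>k\<in>?K. \<bar>\<rho> k\<bar>\<^sup>2) * R" by simp
  have c: "sum4 ?I (\<lambda>i j k l. cycle_weight d \<bar>cov i j\<bar> \<bar>cov k l\<bar> \<bar>cov i k\<bar> \<bar>cov i l\<bar> \<bar>cov j k\<bar> \<bar>cov j l\<bar>)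
    \<le> (if d = 2 then 12 * real n * (\<Sum>k\<in>?K. \<bar>\<rho> k\<bar> powr (4/3)) ^ 3 else 0)"
  proof (cases "d = 2")
    case True
    have "sum4 ?I (\<lambda>i j k l. cycle_weight 2 \<bar>cov i j\<bar> \<bar>cov k l\<bar> \<bar>cov i k\<bar> \<bar>cov i l\<bar> \<bar>cov j k\<bar> \<bar>cov j l\<bar>)
      \<le> 12 * real (card ?I) * (\<Sum>k\<in>?K. \<bar>\<rho> k\<bar> powr (4/3)) ^ 3"
      by (rule sum4_cycle_weight[OF _ ne _ q]) auto
    then show ?thesis using True by simp
  next
    case False
    then show ?thesis by (simp add: cycle_weight_def sum4_def)
  qed
  show ?thesis unfolding sum4_add using t c by linarith
qed

theorem theorem1p1:
  fixes M :: "'a measure" and X :: "nat \<Rightarrow> 'a \<Rightarrow> real"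
    and N :: "'b measure" and Z :: "'b \<Rightarrow> real"
    and g Ag :: "real \<Rightarrow> real" and c :: "nat \<Rightarrow> real" and d :: nat
    and \<rho> :: "int \<Rightarrow> real"
  assumes "prob_space M"
    and "gaussian_seq M X"
    and "stationary_seq M X"
    and "\<And>n. prob_space.expectation M (X n) = 0"
    and "\<And>n. prob_space.variance M (X n) = 1"
    and "\<rho> = autocov M X"
    and "has_hermite_rank g c d" and "d \<ge> 2"
    and "has_hermite_expansion Ag (\<lambda>q. \<bar>c q\<bar>)"
    and "Ag \<in> gauss_sobolev 1 4"
    and "(\<lambda>j. \<bar>\<rho> j\<bar> ^ d) summable_on UNIV"
    and "limit_variance c d \<rho> > 0"
    and "prob_space N"
    and "distributed N lborel Z std_normal_density"
  shows "\<exists>C::real. \<forall>n\<ge>1. prob_space.variance M (partial_sum g X n) > 0 \<longrightarrow>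
     (d = 2 \<longrightarrow>
        tv_dist M (normalized_sum M g X n) N Z
          \<le> C * real n powr (-1/2) * (\<Sum>k\<in>{-int n..int n}. \<bar>\<rho> k\<bar>) powr (1/2)
            + C * real n powr (-1/2) * (\<Sum>k\<in>{-int n..int n}. \<bar>\<rho> k\<bar> powr (4/3)) powr (3/2))
   \<and> (d \<ge> 3 \<longrightarrow>
        tv_dist M (normalized_sum M g X n) N Z
          \<le> C * real n powr (-1/2) * (\<Sum>k\<in>{-int n..int n}. \<bar>\<rho> k\<bar> ^ (d - 1))
                * (\<Sum>k\<in>{-int n..int n}. \<bar>\<rho> k\<bar>\<^sup>2) powr (1/2)
            + C * real n powr (-1/2) * (\<Sum>k\<in>{-int n..int n}. \<bar>\<rho> k\<bar>\<^sup>2) powr (1/2)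
                * (\<Sum>k\<in>{-int n..int n}. \<bar>\<rho> k\<bar>) powr (1/2))"
proof -
  interpret gaussian_family M X
    using assms(1,2,4,5) by (intro gaussian_family.intro gaussian_family_axioms.intro)
  have g: "has_hermite_expansion g c" and c0: "\<And>q. q < d \<Longrightarrow> c q = 0"
    using assms(7) by (auto simp: has_hermite_rank_def)
  have c00: "c 0 = 0" using c0 \<open>d \<ge> 2\<close> by simp
  have cov_\<rho>: "cov i j = \<rho> (int i - int j)" for i j
    unfolding cov_def \<open>\<rho> = autocov M X\<close> by (rule stationary_covariance[OF assms(3) X_measurable])
  have even: "\<rho> (- k) = \<rho> k" for k by (simp add: \<open>\<rho> = autocov M X\<close> autocov_def)
  have \<rho>1: "\<bar>\<rho> k\<bar> \<le> 1" for k
    using abs_cov_le_1[of 0 "nat \<bar>k\<bar>"] by (simp add: \<open>\<rho> = autocov M X\<close> autocov_def cov_def)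
  obtain Q where Q: "\<And>m. (\<integral>x. (hermite_poly (\<lambda>q. real (Suc q) * \<bar>c (Suc q)\<bar>) m x) ^ 4 \<partial>std_normal_distribution) \<le> Q"
    using fourth_moment_of_truncations[OF assms(9,10)] by blast
  have "0 \<le> (\<integral>x. (hermite_poly (\<lambda>q. real (Suc q) * \<bar>c (Suc q)\<bar>) 0 x) ^ 4 \<partial>std_normal_distribution)"
    by simp
  then have Q0: "0 \<le> Q" using Q[of 0] by linarith
  define R where "R = infsum (\<lambda>k. \<bar>\<rho> k\<bar> ^ d) UNIV"
  have R: "(\<Sum>k\<in>{-int n..int n}. \<bar>\<rho> k\<bar> ^ d) \<le> R" for n
    unfolding R_def by (rule finite_sum_le_infsum[OF assms(11)]) auto
  have R0: "0 \<le> R" unfolding R_def by (rule infsum_nonneg) simp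
  obtain v0 where v0: "0 < v0" "\<And>n. 1 \<le> n \<Longrightarrow> 0 < variance (partial_sum g X n) \<Longrightarrow> v0 \<le> variance (partial_sum g X n)"
    using partial_sum_variance_bounded_below[OF g _ c0 cov_\<rho> \<rho>1 assms(11,12)] \<open>d \<ge> 2\<close> by auto
  \<comment> \<open>\<open>2 * sqrt Q / v0\<close> collects the Stein factor, the fourth moment and
    the lower bound on the variance. The summand \<open>6 * sqrt R\<close> serves d \<ge> 3, while
    \<open>6 * R\<close> and \<open>4\<close> serve the two terms for d = 2.\<close>
  define C where "C = 2 * sqrt Q / v0 * (6 * sqrt R + 6 * R + 4)"
  have tv: "tv_dist M (normalized_sum M g X n) N Z \<le> 2 * sqrt Q / v0 * (sqrt (sum4 {1..n} (pair_weight d)) / real n)"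
    if n: "1 \<le> n" and v: "0 < variance (partial_sum g X n)" for n
  proof -
    define V where "V = variance (partial_sum g X n)"
    have V0: "0 < V" "v0 \<le> V" using v v0(2)[OF n v] by (simp_all add: V_def)
    define \<kappa> where "\<kappa> = 1 / sqrt (real n) / sqrt V"
    let ?S = "sum4 {1..n} (pair_weight d)"
    have S0: "0 \<le> ?S" unfolding sum4_def by (intro sum_nonneg pair_weight_nonneg)
    have n0: "0 < real n" using n by simp
    have ns: "normalized_sum M g X n = (\<lambda>\<omega>. \<kappa> * (\<Sum>j\<in>{1..n}. g (X j \<omega>)))"
      by (intro ext) (simp add: normalized_sum_def partial_sum_def V_def \<kappa>_def)
    have \<kappa>2: "\<kappa>\<^sup>2 = 1 / (real n * V)" using n0 V0 by (simp add: \<kappa>_def power_divide power_mult_distrib)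
    have "\<kappa> * (\<Sum>j\<in>{1..n}. g (X j \<omega>)) = (1 / sqrt V) * partial_sum g X n \<omega>" for \<omega>
      by (simp add: \<kappa>_def partial_sum_def)
    then have "expectation (\<lambda>\<omega>. (\<kappa> * (\<Sum>j\<in>{1..n}. g (X j \<omega>)))\<^sup>2) = (1 / sqrt V)\<^sup>2 * expectation (\<lambda>\<omega>. (partial_sum g X n \<omega>)\<^sup>2)"
      by (simp only: power_mult_distrib integral_mult_right_zero)
    also have "\<dots> = 1"
      using V0 unfolding partial_sum_moments(1)[OF g c00, symmetric] V_def[symmetric] by (simp add: power_divide)
    finally have Y1: "expectation (\<lambda>\<omega>. (\<kappa> * (\<Sum>j\<in>{1..n}. g (X j \<omega>)))\<^sup>2) = 1" .
    \<comment> \<open>The square root of the bound in \<open>stein_kernel_variance\<close>, which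
      contains \<open>\<kappa> ^ 4\<close>.\<close>
    define B where "B = \<kappa>\<^sup>2 * (sqrt Q * sqrt ?S)"
    have B0: "0 \<le> B" unfolding B_def using Q0 S0 by (intro mult_nonneg_nonneg) auto
    have "B\<^sup>2 = \<kappa> ^ 4 * Q * ?S"
      unfolding B_def using Q0 S0 by (simp add: power_mult_distrib)
    then have Bm: "expectation (\<lambda>\<omega>. (stein_kernel {1..n} \<kappa> c m \<omega> - expectation (stein_kernel {1..n} \<kappa> c m))\<^sup>2) \<le> B\<^sup>2" for m
      using stein_kernel_variance[OF _ \<open>d \<ge> 2\<close> c0 Q, of "{1..n}" \<kappa>] by simp
    have gm: "(\<lambda>\<omega>. \<kappa> * (\<Sum>j\<in>{1..n}. g (X j \<omega>))) \<in> borel_measurable M"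
      by (intro borel_measurable_times borel_measurable_const borel_measurable_sum hermite_expansion_X(1)[OF g])
    have "tv_dist M (normalized_sum M g X n) N Z \<le> 2 * B"
      unfolding ns
    proof (rule tv_dist_le[OF assms(1) gm assms(13,14)])
      fix h :: "real \<Rightarrow> real" and L
      assume "\<And>x y. \<bar>h x - h y\<bar> \<le> L * \<bar>x - y\<bar>" "\<And>x. 0 \<le> h x" "\<And>x. h x \<le> 1"
      then show "\<bar>expectation (\<lambda>\<omega>. h (\<kappa> * (\<Sum>j\<in>{1..n}. g (X j \<omega>)))) - (\<integral>x. h x \<partial>std_normal_distribution)\<bar> \<le> 2 * B"
        by (intro lipschitz_test_bound[OF g c00 _ Y1 B0 Bm]) auto
    qed
    also have "2 * B \<le> 2 * (1 / (real n * v0) * (sqrt Q * sqrt ?S))"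
      unfolding B_def \<kappa>2 using V0 v0 n0 Q0 S0
      by (intro mult_left_mono mult_right_mono divide_left_mono mult_nonneg_nonneg) auto
    also have "\<dots> = 2 * sqrt Q / v0 * (sqrt ?S / real n)" by (simp add: mult_ac)
    finally show ?thesis .
  qed
  have C0: "0 \<le> C" unfolding C_def using Q0 R0 v0 by (intro mult_nonneg_nonneg divide_nonneg_pos) auto
  show ?thesis
  proof (intro exI[of _ C] allI impI conjI)
    fix n :: nat assume n: "1 \<le> n" and v: "0 < variance (partial_sum g X n)" and d2: "d = 2"
    let ?K = "{-int n..int n}"
    define S1 where "S1 = (\<Sum>k\<in>?K. \<bar>\<rho> k\<bar>)"
    define T where "T = (\<Sum>k\<in>?K. \<bar>\<rho> k\<bar> powr (4/3))"
    have S10: "0 \<le> S1" and T0: "0 \<le> T" by (auto simp: S1_def T_def intro!: sum_nonneg)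
    have n0: "0 < real n" using n by simp
    have "sum4 {1..n} (pair_weight d) \<le> 36 * real n * S1 * (\<Sum>k\<in>?K. \<bar>\<rho> k\<bar>\<^sup>2) * R + 12 * real n * T ^ 3"
      using sum4_pair_weight_le[OF cov_\<rho> even n R] d2 by (simp add: S1_def T_def)
    \<comment> \<open>For d = 2 the sum of squares is itself a sum of d-th powers, hence at most
      \<open>R\<close>.\<close>
    also have "\<dots> \<le> 36 * real n * S1 * R * R + 12 * real n * T ^ 3"
      using R[of n] d2 S10 R0 by (intro add_right_mono mult_right_mono mult_left_mono) auto
    \<comment> \<open>The square of a sum of nonnegative numbers dominates the sum of their squares;
      4 is an integer whose square exceeds 12.\<close>
    also have "\<dots> \<le> real n * (6 * R * sqrt S1 + 4 * sqrt (T ^ 3))\<^sup>2"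
    proof -
      have "(6 * R * sqrt S1 + 4 * sqrt (T ^ 3))\<^sup>2 = 36 * R\<^sup>2 * S1 + 16 * T ^ 3 + 48 * (R * sqrt S1 * sqrt (T ^ 3))"
        using S10 T0 by (simp add: power2_sum power_mult_distrib)
      moreover have "0 \<le> R * sqrt S1 * sqrt (T ^ 3)" "0 \<le> T ^ 3" using R0 S10 T0 by auto
      ultimately have "36 * R\<^sup>2 * S1 + 12 * T ^ 3 \<le> (6 * R * sqrt S1 + 4 * sqrt (T ^ 3))\<^sup>2" by linarith
      then have "real n * (36 * R\<^sup>2 * S1 + 12 * T ^ 3) \<le> real n * (6 * R * sqrt S1 + 4 * sqrt (T ^ 3))\<^sup>2"
        by (intro mult_left_mono) auto
      then show ?thesis by (simp add: power2_eq_square algebra_simps)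
    qed
    finally have "sqrt (sum4 {1..n} (pair_weight d)) \<le> sqrt (real n * (6 * R * sqrt S1 + 4 * sqrt (T ^ 3))\<^sup>2)"
      by (rule real_sqrt_le_mono)
    also have "\<dots> = sqrt (real n) * (6 * R * sqrt S1 + 4 * sqrt (T ^ 3))"
      using R0 S10 T0 by (simp add: real_sqrt_mult)
    finally have s: "sqrt (sum4 {1..n} (pair_weight d)) / real n \<le> sqrt (real n) * (6 * R * sqrt S1 + 4 * sqrt (T ^ 3)) / real n"
      by (rule divide_right_mono) simp
    have rn: "sqrt (real n) / real n = real n powr (-1/2)"
      using n0 powr_minus[of "real n" "1/2"] sqrt_divide_self_eq[of "real n"] by (simp add: powr_half_sqrt)
    have "tv_dist M (normalized_sum M g X n) N Z \<le> 2 * sqrt Q / v0 * (sqrt (real n) * (6 * R * sqrt S1 + 4 * sqrt (T ^ 3)) / real n)"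
      by (rule order_trans[OF tv[OF n v] mult_left_mono[OF s]]) (use v0 Q0 in simp)
    also have "\<dots> = (2 * sqrt Q / v0 * (6 * R)) * real n powr (-1/2) * sqrt S1 + (2 * sqrt Q / v0 * 4) * real n powr (-1/2) * sqrt (T ^ 3)"
      unfolding rn[symmetric] by (simp add: distrib_left add_divide_distrib mult_ac)
    also have "\<dots> \<le> C * real n powr (-1/2) * sqrt S1 + C * real n powr (-1/2) * sqrt (T ^ 3)"
      unfolding C_def using Q0 R0 v0 S10 T0
      by (intro add_mono mult_right_mono mult_left_mono) auto
    finally have bound: "tv_dist M (normalized_sum M g X n) N Z
        \<le> C * real n powr (-1/2) * sqrt S1 + C * real n powr (-1/2) * sqrt (T ^ 3)" .
    have e1: "sqrt S1 = S1 powr (1/2)" using S10 by (simp add: powr_half_sqrt)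
    have e2: "sqrt (T ^ 3) = T powr (3/2)"
    proof (cases "T = 0")
      case False
      then have "T powr (3/2) = (T powr 3) powr (1/2)" by (simp add: powr_powr)
      then show ?thesis using T0 False by (simp add: powr_half_sqrt powr_numeral)
    qed simp
    show "tv_dist M (normalized_sum M g X n) N Z \<le> C * real n powr (-1/2) * (\<Sum>k\<in>?K. \<bar>\<rho> k\<bar>) powr (1/2)
            + C * real n powr (-1/2) * (\<Sum>k\<in>?K. \<bar>\<rho> k\<bar> powr (4/3)) powr (3/2)"
      using bound unfolding e1 e2 unfolding S1_def T_def .
  next
    fix n :: nat assume n: "1 \<le> n" and v: "0 < variance (partial_sum g X n)" and d3: "3 \<le> d"
    let ?K = "{-int n..int n}"
    define S1 where "S1 = (\<Sum>k\<in>?K. \<bar>\<rho> k\<bar>)"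
    define S2 where "S2 = (\<Sum>k\<in>?K. \<bar>\<rho> k\<bar>\<^sup>2)"
    have S0: "0 \<le> S1" "0 \<le> S2" by (auto simp: S1_def S2_def intro!: sum_nonneg)
    have n0: "0 < real n" using n by simp
    have "sum4 {1..n} (pair_weight d) \<le> 36 * real n * S1 * S2 * R"
      using sum4_pair_weight_le[OF cov_\<rho> even n R] d3 by (simp add: S1_def S2_def)
    then have "sqrt (sum4 {1..n} (pair_weight d)) \<le> sqrt (36 * real n * S1 * S2 * R)"
      by (rule real_sqrt_le_mono)
    also have "\<dots> = sqrt (real n) * (6 * sqrt R * (sqrt S2 * sqrt S1))"
      by (simp add: real_sqrt_mult)
    finally have s: "sqrt (sum4 {1..n} (pair_weight d)) / real n \<le> sqrt (real n) * (6 * sqrt R * (sqrt S2 * sqrt S1)) / real n"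
      by (rule divide_right_mono) simp
    have rn: "sqrt (real n) / real n = real n powr (-1/2)"
      using n0 powr_minus[of "real n" "1/2"] sqrt_divide_self_eq[of "real n"] by (simp add: powr_half_sqrt)
    have "tv_dist M (normalized_sum M g X n) N Z \<le> 2 * sqrt Q / v0 * (sqrt (real n) * (6 * sqrt R * (sqrt S2 * sqrt S1)) / real n)"
      by (rule order_trans[OF tv[OF n v] mult_left_mono[OF s]]) (use v0 Q0 in simp)
    also have "\<dots> = (2 * sqrt Q / v0 * (6 * sqrt R)) * real n powr (-1/2) * (sqrt S2 * sqrt S1)"
      unfolding rn[symmetric] by simp
    also have "\<dots> \<le> C * real n powr (-1/2) * (sqrt S2 * sqrt S1)"
      unfolding C_def using Q0 R0 v0 S0
      by (intro mult_right_mono mult_left_mono) auto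
    finally have bound: "tv_dist M (normalized_sum M g X n) N Z \<le> C * real n powr (-1/2) * (sqrt S2 * sqrt S1)" .
    have "sqrt S2 * sqrt S1 = S2 powr (1/2) * S1 powr (1/2)" using S0 by (simp add: powr_half_sqrt)
    with bound have "tv_dist M (normalized_sum M g X n) N Z \<le> C * real n powr (-1/2) * S2 powr (1/2) * S1 powr (1/2)"
      by (simp only: mult.assoc)
    \<comment> \<open>The bound obtained has the form of the second term of the estimate; the first
      term is nonnegative and is added to it.\<close>
    moreover have "0 \<le> C * real n powr (-1/2) * (\<Sum>k\<in>?K. \<bar>\<rho> k\<bar> ^ (d - 1)) * S2 powr (1/2)"
      using C0 by (intro mult_nonneg_nonneg sum_nonneg) auto
    ultimately show "tv_dist M (normalized_sum M g X n) N Z \<le> C * real n powr (-1/2) * (\<Sum>k\<in>?K. \<bar>\<rho> k\<bar> ^ (d - 1))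
                * (\<Sum>k\<in>?K. \<bar>\<rho> k\<bar>\<^sup>2) powr (1/2)
            + C * real n powr (-1/2) * (\<Sum>k\<in>?K. \<bar>\<rho> k\<bar>\<^sup>2) powr (1/2)
                * (\<Sum>k\<in>?K. \<bar>\<rho> k\<bar>) powr (1/2)"
      unfolding S1_def S2_def by linarith
  qed
qed

end
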